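(* Let $\Lambda$ be the limit set of a CIFS $\{S_i\}_{i\in\mathcal{I}}$ on $\mathbb{R}^d$ and let $F$ be the set of fixed points of the maps $S_i$, $i\in\mathcal{I}$. Let $F$ have covering class $f\in\mathcal{G}(0,d)$, and let $g\in\mathcal{G}(\dim_{\mathrm H}\Lambda,d)$ be the pointwise minimal function in $\mathcal{G}(\dim_{\mathrm H}\Lambda,d)$ satisfying $f\leq g$. Then $\Lambda$ has covering class $g$.
   Context: For a non-empty bounded set $E\subset\mathbb{R}^d$, $N_r(E)$ is the least number of open balls of radius $r$ required to cover $E$, and $s_E(r)=\frac{\log N_r(E)}{\log(1/r)}$ for $0<r<1$. $\dim_{\mathrm H}$ is Hausdorff dimension. For $0\leq\lambda\leq\alpha$, $\mathcal{G}(\lambda,\alpha)$ is the set of continuous functions $g\colon\mathbb{R}\to[\lambda,\alpha]$ such that $D^+g(x)\in[\lambda-g(x),\alpha-g(x)]$ for all $x\in\mathbb{R}$, where $D^+g(x)=\limsup_{\varepsilon\to0^+}\frac{g(x+\varepsilon)-g(x)}{\varepsilon}$ is the upper right Dini derivative. A non-empty bounded set $E\subset\mathbb{R}^d$ has covering class $g\in\mathcal{G}(0,d)$ if $\lim_{x\to\infty}\bigl(s_E(\exp(-\exp(x)))-g(x)\bigr)=0$. Note $\mathcal{G}(\lambda,d)\subset\mathcal{G}(0,d)$ for $0\leq\lambda\leq d$. CIFS. Let $d\in\mathbb{N}$, let $X\subset\mathbb{R}^d$ (Euclidean norm) be compact and connected, and let $\mathcal{I}$ be a non-empty countable index set. Let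 $S_i\colon X\to X$ ($i\in\mathcal{I}$) be injective and uniformly contracting: there is $0<c<1$ with $0<\|S_i(x)-S_i(y)\|\leq c\|x-y\|$ for all $i\in\mathcal{I}$ and all distinct $x,y\in X$. Let $\mathcal{I}^*=\bigcup_{n\geq0}\mathcal{I}^n$ be the set of finite words; for $\mathtt{i}=(i_1,\dots,i_n)$ write $S_{\mathtt{i}}=S_{i_1}\circ\cdots\circ S_{i_n}$ (the identity for the empty word). For $\gamma\in\mathcal{I}^{\mathbb{N}}$, $\gamma|_n\in\mathcal{I}^n$ is its prefix of length $n$. The limit set (attractor) is $\Lambda=\bigcup_{\gamma\in\mathcal{I}^{\mathbb{N}}}\bigcap_{n=1}^\infty S_{\gamma|_n}(X)$. The family $\{S_i\}_{i\in\mathcal{I}}$ is called a CIFS if: (i) Conformality: there is an open, bounded, connected $V\subset\mathbb{R}^d$ with $X\subset V$ such that each $S_i$ extends to a conformal $C^{1+\varepsilon}$ diffeomorphism on $V$ (of $V$ onto its image in $V$). (ii) Bounded distortion: there is $K\geq1$ with $\|S_{\mathtt{i}}'(x)\|\leq K\|S_{\mathtt{i}}'(y)\|$ for all $x,y\in V$, $\mathtt{i}\in\mathcal{I}^*$, where $S_{\mathtt{i}}'(x)$ is the Jacobian matrix and $\|\cdot\|$ the spectral norm. (iii) Open set condition: $X$ has non-empty interior $U$, $S_i(U)\subset U$ for all $i$, and $S_i(U)\cap S_j(U)=\varnothing$ for $i\neq j$. (iv) Cone condition: $\inf_{x\in X}\inf_{r\in(0,1)}r^{-d}\mathcal{L}^d(B(x,r)\cap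 U)>0$, where $\mathcal{L}^d$ is Lebesgue measure and $B(x,r)$ the open ball. *)

theory Defs
  imports "HOL-Analysis.Analysis"
begin

text \<open>For unbounded \<open>E\<close> the set below is empty and \<open>Inf\<close> is the default value 0; covering
  numbers are only used for bounded sets.\<close>

definition covering_number :: "real \<Rightarrow> 'a::metric_space set \<Rightarrow> nat" where
  "covering_number r E = Inf {card C |C. finite C \<and> E \<subseteq> (\<Union>x\<in>C. ball x r)}"

definition covering_exponent :: "'a::metric_space set \<Rightarrow> real \<Rightarrow> real" where
  "covering_exponent E r = ln (real (covering_number r E)) / ln (1 / r)"

definition upper_right_dini :: "(real \<Rightarrow> real) \<Rightarrow> real \<Rightarrow> ereal" where
  "upper_right_dini g x = Limsup (at_right 0) (\<lambda>\<epsilon>. ereal ((g (x + \<epsilon>) - g x) / \<epsilon>))"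

definition dini_class :: "real \<Rightarrow> real \<Rightarrow> (real \<Rightarrow> real) set" where
  "dini_class l a = {g. continuous_on UNIV g \<and> range g \<subseteq> {l..a} \<and>
     (\<forall>x. upper_right_dini g x \<in> {ereal (l - g x)..ereal (a - g x)})}"

definition has_covering_class :: "(real ^ 'n) set \<Rightarrow> (real \<Rightarrow> real) \<Rightarrow> bool" where
  "has_covering_class E g \<longleftrightarrow>
     E \<noteq> {} \<and> bounded E \<and> g \<in> dini_class 0 (real CARD('n)) \<and>
     ((\<lambda>x. covering_exponent E (exp (- exp x)) - g x) \<longlongrightarrow> 0) at_top"

text \<open>In Isabelle \<open>0 powr 0 = 0\<close>, so the exponent 0 is treated separately: there every non-empty
  set contributes 1, and \<open>hausdorff_measure 0\<close> is counting measure.\<close>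

definition diameter_pow :: "real \<Rightarrow> 'a::metric_space set \<Rightarrow> real" where
  "diameter_pow s U = (if U = {} then 0 else if s = 0 then 1 else diameter U powr s)"

definition hausdorff_premeasure :: "real \<Rightarrow> real \<Rightarrow> 'a::metric_space set \<Rightarrow> ennreal" where
  "hausdorff_premeasure \<delta> s E =
     (INF U \<in> {U :: nat \<Rightarrow> 'a set. E \<subseteq> (\<Union>n. U n) \<and> (\<forall>n. bounded (U n) \<and> diameter (U n) \<le> \<delta>)}.
        \<Sum>n. ennreal (diameter_pow s (U n)))"

definition hausdorff_measure :: "real \<Rightarrow> 'a::metric_space set \<Rightarrow> ennreal" where
  "hausdorff_measure s E = (SUP \<delta>\<in>{0<..}. hausdorff_premeasure \<delta> s E)"

text \<open>The dimension can be taken to be a real number: for subsets of \<open>real ^ 'n\<close> the set of exponents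
  contains every \<open>s > CARD('n)\<close>, so it is non-empty and bounded below.\<close>

definition hausdorff_dim :: "(real ^ 'n) set \<Rightarrow> real" where
  "hausdorff_dim E = Inf {s. 0 \<le> s \<and> hausdorff_measure s E = 0}"

definition spectral_norm :: "real ^ 'n ^ 'm \<Rightarrow> real" where
  "spectral_norm A = onorm ((*v) A)"

text \<open>\<open>C\<^sup>1\<^sup>+\<^sup>\<epsilon>\<close> is read locally: every point of \<open>V\<close> has a neighbourhood on which the derivative is
  \<open>\<epsilon>\<close>-Hoelder. This is weaker than a single Hoelder constant on \<open>V\<close>.\<close>

definition C1_Hoelder_on :: "real \<Rightarrow> (real ^ 'n) set \<Rightarrow> (real ^ 'n \<Rightarrow> real ^ 'n) \<Rightarrow> bool" where
  "C1_Hoelder_on \<epsilon> V f \<longleftrightarrow>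
     (\<forall>x\<in>V. f differentiable (at x)) \<and>
     (\<forall>z\<in>V. \<exists>\<rho>>0. \<exists>C. \<forall>x\<in>V \<inter> ball z \<rho>. \<forall>y\<in>V \<inter> ball z \<rho>.
        spectral_norm (jacobian f (at x) - jacobian f (at y)) \<le> C * dist x y powr \<epsilon>)"

definition C1_Hoelder_diffeo_on :: "real \<Rightarrow> (real ^ 'n) set \<Rightarrow> (real ^ 'n \<Rightarrow> real ^ 'n) \<Rightarrow> bool" where
  "C1_Hoelder_diffeo_on \<epsilon> V f \<longleftrightarrow>
     inj_on f V \<and> open (f ` V) \<and> C1_Hoelder_on \<epsilon> V f \<and> C1_Hoelder_on \<epsilon> (f ` V) (inv_into V f)"

text \<open>Orientation-reversing maps are allowed.\<close>

definition conformal_on :: "(real ^ 'n) set \<Rightarrow> (real ^ 'n \<Rightarrow> real ^ 'n) \<Rightarrow> bool" where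
  "conformal_on V f \<longleftrightarrow>
     (\<forall>x\<in>V. \<exists>c>0. \<exists>Q. orthogonal_matrix Q \<and> jacobian f (at x) = c *\<^sub>R Q)"

definition word_map :: "('i \<Rightarrow> 'a \<Rightarrow> 'a) \<Rightarrow> 'i list \<Rightarrow> 'a \<Rightarrow> 'a" where
  "word_map S w = foldr (\<lambda>i f. S i \<circ> f) w id"

definition limit_set :: "'a set \<Rightarrow> 'i set \<Rightarrow> ('i \<Rightarrow> 'a \<Rightarrow> 'a) \<Rightarrow> 'a set" where
  "limit_set X I S =
     (\<Union>\<gamma> \<in> {\<gamma> :: nat \<Rightarrow> 'i. range \<gamma> \<subseteq> I}. \<Inter>n\<in>{1..}. word_map S (map \<gamma> [0..<n]) ` X)"

definition fixed_points :: "'a set \<Rightarrow> 'i set \<Rightarrow> ('i \<Rightarrow> 'a \<Rightarrow> 'a) \<Rightarrow> 'a set" where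
  "fixed_points X I S = {x \<in> X. \<exists>i\<in>I. S i x = x}"

definition contractive_system ::
    "(real ^ 'n) set \<Rightarrow> 'i set \<Rightarrow> ('i \<Rightarrow> real ^ 'n \<Rightarrow> real ^ 'n) \<Rightarrow> bool" where
  "contractive_system X I S \<longleftrightarrow>
     compact X \<and> connected X \<and> I \<noteq> {} \<and> countable I \<and>
     (\<forall>i\<in>I. S i ` X \<subseteq> X) \<and>
     (\<exists>c. 0 < c \<and> c < 1 \<and>
        (\<forall>i\<in>I. \<forall>x\<in>X. \<forall>y\<in>X. x \<noteq> y \<longrightarrow>
           0 < norm (S i x - S i y) \<and> norm (S i x - S i y) \<le> c * norm (x - y)))"

text \<open>Only the values of \<open>S i\<close> on \<open>X\<close> matter; \<open>T i\<close> is the extension of \<open>S i\<close> to \<open>V\<close>. Bounded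
  distortion refers to the same \<open>V\<close> and the same extensions, so the two conditions share their
  existential quantifiers.\<close>

definition conformal_extension ::
    "(real ^ 'n) set \<Rightarrow> 'i set \<Rightarrow> ('i \<Rightarrow> real ^ 'n \<Rightarrow> real ^ 'n) \<Rightarrow>
     (real ^ 'n) set \<Rightarrow> ('i \<Rightarrow> real ^ 'n \<Rightarrow> real ^ 'n) \<Rightarrow> bool" where
  "conformal_extension X I S V T \<longleftrightarrow>
     open V \<and> bounded V \<and> connected V \<and> X \<subseteq> V \<and>
     (\<forall>i\<in>I. (\<forall>x\<in>X. T i x = S i x) \<and> T i ` V \<subseteq> V \<and> conformal_on V (T i) \<and>
        (\<exists>\<epsilon>. 0 < \<epsilon> \<and> \<epsilon> \<le> 1 \<and> C1_Hoelder_diffeo_on \<epsilon> V (T i)))"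

definition bounded_distortion ::
    "'i set \<Rightarrow> (real ^ 'n) set \<Rightarrow> ('i \<Rightarrow> real ^ 'n \<Rightarrow> real ^ 'n) \<Rightarrow> bool" where
  "bounded_distortion I V T \<longleftrightarrow>
     (\<exists>K\<ge>1. \<forall>w\<in>lists I. \<forall>x\<in>V. \<forall>y\<in>V.
        spectral_norm (jacobian (word_map T w) (at x))
          \<le> K * spectral_norm (jacobian (word_map T w) (at y)))"

definition open_set_condition ::
    "(real ^ 'n) set \<Rightarrow> 'i set \<Rightarrow> ('i \<Rightarrow> real ^ 'n \<Rightarrow> real ^ 'n) \<Rightarrow> bool" where
  "open_set_condition X I S \<longleftrightarrow>
     interior X \<noteq> {} \<and>
     (\<forall>i\<in>I. S i ` interior X \<subseteq> interior X) \<and>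
     (\<forall>i\<in>I. \<forall>j\<in>I. i \<noteq> j \<longrightarrow> S i ` interior X \<inter> S j ` interior X = {})"

definition cone_condition :: "(real ^ 'n) set \<Rightarrow> bool" where
  "cone_condition X \<longleftrightarrow>
     (INF x\<in>X. INF r\<in>{0<..<1}.
        measure lebesgue (ball x r \<inter> interior X) / r ^ CARD('n)) > 0"

definition CIFS ::
    "(real ^ 'n) set \<Rightarrow> 'i set \<Rightarrow> ('i \<Rightarrow> real ^ 'n \<Rightarrow> real ^ 'n) \<Rightarrow> bool" where
  "CIFS X I S \<longleftrightarrow>
     contractive_system X I S \<and>
     (\<exists>V T. conformal_extension X I S V T \<and> bounded_distortion I V T) \<and>
     open_set_condition X I S \<and>
     cone_condition X"

end

theory Submission
  imports Defs
begin

text \<open>In the variable \<open>t = exp x = ln (1 / r)\<close>, membership of \<open>g\<close> in \<open>dini_class l a\<close> says that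
  \<open>\<phi> g t = t * g (ln t)\<close> has difference quotients in \<open>{l..a}\<close>. The minimal function above \<open>f\<close>
  is therefore bounded by \<open>SUP u\<in>{0<..t}. \<phi> f u + l * (t - u)\<close>, and the theorem amounts, up to
  factors \<open>r powr o(1)\<close>, to \<open>N r \<Lambda> = (SUP \<rho>\<in>{r..1}. (\<rho> / r) powr h * N \<rho> F)\<close> with \<open>h\<close> the
  Hausdorff dimension of \<open>\<Lambda>\<close>.

  Let \<open>m w\<close> be the infimum over \<open>V\<close> of the derivative norm of the word \<open>w\<close>. By a mass
  distribution argument on finite subsystems, \<open>h\<close> is the critical exponent of the series
  \<open>\<Sum>w. m w powr s\<close> over all words. Upper bound: every point of \<open>\<Lambda>\<close> lies in some
  \<open>S\<^sub>v (S\<^sub>i X)\<close> with \<open>m v > r\<close> and \<open>m [i] \<le> r / m v\<close>; here \<open>S\<^sub>i X\<close> has diameter of order at most \<open>r / m v\<close>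
  and contains a fixed point, so \<open>N r \<Lambda>\<close> is at most a constant times the sum over \<open>v\<close> of
  \<open>N (r / m v) F\<close>, and the series converges for exponents above \<open>h\<close>. Lower bound: for
  \<open>s < h\<close> a finite subsystem has at least \<open>(\<rho> / r) powr s\<close> cylinders of ratio about \<open>r / \<rho>\<close> with
  boundedly many meeting any ball of radius \<open>r\<close>, and each of them contains a copy of \<open>F\<close> that needs
  about \<open>N \<rho> F\<close> balls of radius \<open>r\<close>.\<close>

section \<open>Dini derivatives\<close>

text \<open>With infinitely many maps, the words at which the ratio first drops to \<open>r\<close>
  may be infinite in number and far smaller than \<open>r\<close>. The upper bound therefore stops
  one letter earlier and lets fixed points stand for the last letters; only finitely many prefixes
  \<open>v\<close> with \<open>m v > r\<close> remain, because the series converges. The lower bound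
  meets the opposite obstacle: comparable cylinders need a positive least letter ratio, hence a
  finite alphabet. Divergence of the series makes some level sum at a slightly smaller exponent
  exceed 1, and finitely many words of that level become the letters of a new system.
  \<open>F\<close> still belongs to the whole system, as only the invariance of \<Lambda> under
  words matters. The infimum in \<open>m\<close> makes it super-multiplicative without a constant,
  so neither long words nor words used as letters lose a factor. No formula for the minimal
  \<open>g\<close> is needed: the upper bound uses \<open>f \<le> g\<close> and the growth of
  \<open>g\<close>, the lower bound compares \<open>g\<close> with one explicit member of the
  class.\<close>

lemma dini_growth_mono:
  fixes g :: "real \<Rightarrow> real"
  assumes cont: "continuous_on UNIV g"
    and freq: "\<And>x \<eta>. \<eta> > 0 \<Longrightarrow>
      \<exists>\<^sub>F e in at_right 0. g x + (l - g x - \<eta>) * e \<le> g (x + e)"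
    and "x \<le> y"
  shows "exp x * (g x - l) \<le> exp y * (g y - l)"
proof (rule field_le_epsilon)
  fix \<epsilon> :: real assume "\<epsilon> > 0"
  define \<kappa> where "\<kappa> = \<epsilon> / (y - x + 1)"
  have \<kappa>: "\<kappa> > 0" "\<kappa> * (y - x) \<le> \<epsilon>"
    using \<open>\<epsilon> > 0\<close> \<open>x \<le> y\<close> by (auto simp: \<kappa>_def field_simps)
  \<comment> \<open>The term \<open>\<kappa> * u\<close> turns weak growth into strict growth; its
    total gain over \<open>{x..y}\<close> is at most the allowed error \<epsilon>.\<close>
  define \<psi> where "\<psi> u = exp u * (g u - l) + \<kappa> * u" for u
  have cont_\<psi>: "continuous_on A \<psi>" for A
    unfolding \<psi>_def using cont by (intro continuous_intros) (auto intro: continuous_on_subset)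
  have rise: "\<exists>\<^sub>F e in at_right 0. \<psi> z < \<psi> (z + e)" for z
  proof -
    \<comment> \<open>This \<eta> makes the loss \<open>exp z * (2 * \<eta> * e)\<close> equal to
      the gain \<open>\<kappa> * e\<close>. The numerator of \<open>?F\<close> has derivative
      \<open>- \<eta>\<close> at 0, because \<open>exp e * (1 - e)\<close> is stationary there, so
      for small \<open>e\<close> it stays strictly above \<open>- 2 * \<eta> * e\<close>.\<close>
    define \<eta> where "\<eta> = \<kappa> / (2 * exp z)"
    have "\<eta> > 0" using \<kappa> by (simp add: \<eta>_def)
    let ?F = "\<lambda>e. ((g z - l) * (exp e * (1 - e) - 1) - \<eta> * e * exp e) / e"
    have D: "((\<lambda>e. (g z - l) * (exp e * (1 - e) - 1) - \<eta> * e * exp e) has_real_derivative - \<eta>) (at 0)"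
      by (auto intro!: derivative_eq_intros)
    have "(?F \<longlongrightarrow> - \<eta>) (at 0)"
      using D unfolding has_field_derivative_iff by simp
    hence "(?F \<longlongrightarrow> - \<eta>) (at_right 0)"
      by (rule filterlim_mono) (auto simp: at_le)
    moreover have "- 2 * \<eta> < - \<eta>" using \<open>\<eta> > 0\<close> by simp
    ultimately have ev: "\<forall>\<^sub>F e in at_right 0. - 2 * \<eta> < ?F e"
      by (intro order_tendstoD)
    have ev0: "\<forall>\<^sub>F e in at_right (0::real). e > 0"
      by (auto simp: eventually_at_filter)
    have "\<forall>\<^sub>F e in at_right 0. g z + (l - g z - \<eta>) * e \<le> g (z + e) \<longrightarrow> \<psi> z < \<psi> (z + e)"
      using ev ev0
    proof eventually_elim
      case (elim e)
      show ?case
      proof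
        assume a: "g z + (l - g z - \<eta>) * e \<le> g (z + e)"
        have "exp (z + e) * (g z + (l - g z - \<eta>) * e - l) \<le> exp (z + e) * (g (z + e) - l)"
          using a by (intro mult_left_mono) auto
        hence "\<psi> (z + e) - \<psi> z \<ge> exp z * ((g z - l) * (exp e * (1 - e) - 1) - \<eta> * e * exp e) + \<kappa> * e"
          by (simp add: \<psi>_def exp_add algebra_simps)
        moreover have "exp z * ((g z - l) * (exp e * (1 - e) - 1) - \<eta> * e * exp e) > exp z * (- 2 * \<eta> * e)"
          using elim by (intro mult_strict_left_mono) (auto simp: field_simps)
        moreover have "exp z * (- 2 * \<eta> * e) = - \<kappa> * e" by (simp add: \<eta>_def)
        ultimately show "\<psi> z < \<psi> (z + e)" by linarith
      qed
    qed
    from frequently_mp[OF this freq[OF \<open>\<eta> > 0\<close>]] show ?thesis .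
  qed
  have "\<psi> x \<le> \<psi> y"
  proof (rule ccontr)
    assume n: "\<not> \<psi> x \<le> \<psi> y"
    \<comment> \<open>At the last point of \<open>{x..y}\<close> where \<psi> is at least
      \<open>\<psi> x\<close>, \<open>rise\<close> produces a later one.\<close>
    define Z where "Z = {u\<in>{x..y}. \<psi> x \<le> \<psi> u}"
    have "Z = {x..y} \<inter> {u. \<psi> x \<le> \<psi> u}" by (auto simp: Z_def)
    hence "closed Z" by (auto intro!: closed_Int closed_Collect_le cont_\<psi>)
    moreover have "x \<in> Z" using \<open>x \<le> y\<close> by (auto simp: Z_def)
    moreover have bdd: "bdd_above Z" by (auto simp: Z_def intro!: bdd_aboveI[of _ y])
    ultimately have zZ: "Sup Z \<in> Z" by (intro closed_contains_Sup) auto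
    define z where "z = Sup Z"
    have z: "x \<le> z" "z < y" "\<psi> x \<le> \<psi> z"
      using zZ n unfolding z_def[symmetric] by (auto simp: Z_def less_le)
    have "\<exists>\<^sub>F e in at_right 0. \<psi> z < \<psi> (z + e)" by (rule rise)
    moreover have "\<forall>\<^sub>F e in at_right (0::real). e > 0 \<and> e < y - z"
      using z(2) by (auto simp: eventually_at_right_field intro!: exI[of _ "y - z"])
    ultimately have "\<exists>\<^sub>F e in at_right 0. \<psi> z < \<psi> (z + e) \<and> e > 0 \<and> e < y - z"
      using frequently_eventually_frequently by force
    then obtain e where e: "\<psi> z < \<psi> (z + e)" "e > 0" "e < y - z"
      by (auto dest: frequently_ex)
    hence "z + e \<in> Z" using z by (auto simp: Z_def)
    from cSup_upper[OF this bdd] e show False by (simp add: z_def)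
  qed
  thus "exp x * (g x - l) \<le> exp y * (g y - l) + \<epsilon>"
    using \<kappa> by (simp add: \<psi>_def algebra_simps)
qed

text \<open>A limit superior of at least \<open>l - g x\<close> makes the difference quotient large
  only frequently, not eventually; this is why \<open>dini_growth_mono\<close> assumes no
  more.\<close>

lemma dini_class_lower:
  assumes "g \<in> dini_class l a" "x \<le> y"
  shows "exp x * (g x - l) \<le> exp y * (g y - l)"
proof (rule dini_growth_mono[OF _ _ assms(2)])
  show "continuous_on UNIV g" using assms by (simp add: dini_class_def)
  fix x \<eta> :: real assume "\<eta> > 0"
  show "\<exists>\<^sub>F e in at_right 0. g x + (l - g x - \<eta>) * e \<le> g (x + e)"
  proof (rule ccontr)
    assume "\<not> ?thesis"
    hence "\<forall>\<^sub>F e in at_right 0. g (x + e) < g x + (l - g x - \<eta>) * e"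
      by (simp add: not_frequently not_le)
    moreover have "\<forall>\<^sub>F e in at_right (0::real). e > 0"
      by (auto simp: eventually_at_filter)
    ultimately have "\<forall>\<^sub>F e in at_right 0. ereal ((g (x + e) - g x) / e) \<le> ereal (l - g x - \<eta>)"
      by eventually_elim (auto simp: field_simps)
    hence "upper_right_dini g x \<le> ereal (l - g x - \<eta>)"
      unfolding upper_right_dini_def by (rule Limsup_bounded)
    moreover have "ereal (l - g x) \<le> upper_right_dini g x"
      using assms by (simp add: dini_class_def)
    ultimately have "ereal (l - g x) \<le> ereal (l - g x - \<eta>)" by (rule order_trans[rotated])
    thus False using \<open>\<eta> > 0\<close> by simp
  qed
qed

text \<open>The growth argument for \<open>- g\<close> and \<open>- a\<close>. Here the bound on the
  limit superior even holds eventually.\<close>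

lemma dini_class_upper:
  assumes "g \<in> dini_class l a" "x \<le> y"
  shows "exp x * (a - g x) \<le> exp y * (a - g y)"
proof -
  have "exp x * (- g x - - a) \<le> exp y * (- g y - - a)"
  proof (rule dini_growth_mono[of "\<lambda>x. - g x", OF _ _ assms(2)])
    show "continuous_on UNIV (\<lambda>x. - g x)"
      using assms by (auto simp: dini_class_def intro: continuous_intros)
    fix x \<eta> :: real assume "\<eta> > 0"
    have "upper_right_dini g x \<le> ereal (a - g x)"
      using assms by (simp add: dini_class_def)
    also have "\<dots> < ereal (a - g x + \<eta>)" using \<open>\<eta> > 0\<close> by simp
    finally have "\<forall>\<^sub>F e in at_right 0. ereal ((g (x + e) - g x) / e) < ereal (a - g x + \<eta>)"
      unfolding upper_right_dini_def by (rule Limsup_lessD)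
    moreover have "\<forall>\<^sub>F e in at_right (0::real). e > 0"
      by (auto simp: eventually_at_filter)
    ultimately have "\<forall>\<^sub>F e in at_right 0. - g x + (- a - - g x - \<eta>) * e \<le> - g (x + e)"
      by eventually_elim (auto simp: field_simps)
    thus "\<exists>\<^sub>F e in at_right 0. - g x + (- a - - g x - \<eta>) * e \<le> - g (x + e)"
      by (rule eventually_frequently[rotated]) simp
  qed
  thus ?thesis by (simp add: algebra_simps)
qed

text \<open>Converse to the two growth lemmas. The monotonicities squeeze the increment over a step
  \<open>e\<close> between multiples of \<open>1 - exp (- e)\<close>, which yields Lipschitz
  continuity and, after division by \<open>e\<close>, the Dini bounds in the limit.\<close>

lemma dini_classI:
  fixes G :: "real \<Rightarrow> real"
  assumes rng: "\<And>x. G x \<in> {l..a}"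
    and lo: "\<And>x y. x \<le> y \<Longrightarrow> exp x * (G x - l) \<le> exp y * (G y - l)"
    and up: "\<And>x y. x \<le> y \<Longrightarrow> exp x * (a - G x) \<le> exp y * (a - G y)"
  shows "G \<in> dini_class l a"
proof -
  have lo': "(1 - exp (- e)) * (l - G x) \<le> G (x + e) - G x"
    and up': "G (x + e) - G x \<le> (1 - exp (- e)) * (a - G x)" if "e \<ge> 0" for x e
  proof -
    have "exp (- e) * (exp (- x) * (exp x * (G x - l))) \<le> exp (- e) * (exp (- x) * (exp (x + e) * (G (x + e) - l)))"
      using that by (intro mult_left_mono lo) auto
    also have "exp (- e) * (exp (- x) * (exp (x + e) * (G (x + e) - l))) = G (x + e) - l"
      by (simp add: exp_add exp_minus field_simps)
    also have "exp (- e) * (exp (- x) * (exp x * (G x - l))) = exp (- e) * (G x - l)"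
      by (simp add: exp_minus)
    finally show "(1 - exp (- e)) * (l - G x) \<le> G (x + e) - G x"
      by (simp add: algebra_simps)
    have "exp (- e) * (exp (- x) * (exp x * (a - G x))) \<le> exp (- e) * (exp (- x) * (exp (x + e) * (a - G (x + e))))"
      using that by (intro mult_left_mono up) auto
    also have "exp (- e) * (exp (- x) * (exp (x + e) * (a - G (x + e)))) = a - G (x + e)"
      by (simp add: exp_add exp_minus field_simps)
    also have "exp (- e) * (exp (- x) * (exp x * (a - G x))) = exp (- e) * (a - G x)"
      by (simp add: exp_minus)
    finally show "G (x + e) - G x \<le> (1 - exp (- e)) * (a - G x)"
      by (simp add: algebra_simps)
  qed
  have le: "0 \<le> a - l" using rng[of 0] by auto
  have lip: "\<bar>G y - G x\<bar> \<le> (a - l) * \<bar>y - x\<bar>" if "x \<le> y" for x y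
  proof -
    have e: "0 \<le> 1 - exp (- (y - x))" "1 - exp (- (y - x)) \<le> y - x"
      using that exp_ge_add_one_self[of "- (y - x)"] by (simp, linarith)
    have r: "l \<le> G x" "G x \<le> a" using rng[of x] by auto
    have "G y - G x \<le> (1 - exp (- (y - x))) * (a - G x)" using up'[of "y - x" x] that by simp
    also have "\<dots> \<le> (y - x) * (a - l)" using e r that by (intro mult_mono) auto
    finally have 1: "G y - G x \<le> (y - x) * (a - l)" .
    have "G x - G y \<le> (1 - exp (- (y - x))) * (G x - l)"
      using lo'[of "y - x" x] that by (simp add: algebra_simps)
    also have "\<dots> \<le> (y - x) * (a - l)" using e r that by (intro mult_mono) auto
    finally show ?thesis using 1 that by (simp add: abs_if algebra_simps)
  qed
  have "(a - l)-lipschitz_on UNIV G"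
  proof (rule lipschitz_onI[OF _ le])
    fix x y show "dist (G x) (G y) \<le> (a - l) * dist x y"
      using lip[of x y] lip[of y x] by (cases "x \<le> y") (auto simp: dist_real_def abs_minus_commute)
  qed
  hence cont: "continuous_on UNIV G" by (rule lipschitz_on_continuous_on)
  have lim: "((\<lambda>e. ereal ((1 - exp (- e)) / e * k)) \<longlongrightarrow> ereal k) (at_right 0)" for k :: real
  proof -
    have D: "((\<lambda>e. 1 - exp (- e)) has_real_derivative (1::real)) (at 0)"
      by (auto intro!: derivative_eq_intros)
    have "((\<lambda>e. (1 - exp (- e)) / e) \<longlongrightarrow> (1::real)) (at 0)"
      using D unfolding has_field_derivative_iff by simp
    hence "((\<lambda>e. (1 - exp (- e)) / e) \<longlongrightarrow> (1::real)) (at_right 0)"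
      by (rule filterlim_mono) (auto simp: at_le)
    from tendsto_mult_right[OF this, of k] show ?thesis by simp
  qed
  have pos: "\<forall>\<^sub>F e in at_right (0::real). e > 0"
    by (auto simp: eventually_at_filter)
  have "upper_right_dini G x \<in> {ereal (l - G x)..ereal (a - G x)}" for x
  proof -
    have "ereal (l - G x) = Limsup (at_right 0) (\<lambda>e. ereal ((1 - exp (- e)) / e * (l - G x)))"
      by (rule lim_imp_Limsup[symmetric, OF _ lim]) simp
    also have "\<dots> \<le> upper_right_dini G x" unfolding upper_right_dini_def
    proof (rule Limsup_mono)
      show "\<forall>\<^sub>F e in at_right 0. ereal ((1 - exp (- e)) / e * (l - G x)) \<le> ereal ((G (x + e) - G x) / e)"
        using pos by eventually_elim (use lo' in \<open>auto simp: divide_right_mono\<close>)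
    qed
    finally have 1: "ereal (l - G x) \<le> upper_right_dini G x" .
    have "upper_right_dini G x \<le> Limsup (at_right 0) (\<lambda>e. ereal ((1 - exp (- e)) / e * (a - G x)))"
      unfolding upper_right_dini_def
    proof (rule Limsup_mono)
      show "\<forall>\<^sub>F e in at_right 0. ereal ((G (x + e) - G x) / e) \<le> ereal ((1 - exp (- e)) / e * (a - G x))"
        using pos by eventually_elim (use up' in \<open>auto simp: divide_right_mono\<close>)
    qed
    also have "\<dots> = ereal (a - G x)"
      by (rule lim_imp_Limsup[OF _ lim]) simp
    finally show ?thesis using 1 by simp
  qed
  thus ?thesis using cont rng by (auto simp: dini_class_def)
qed

text \<open>The competitor is \<open>h x = l + P x / exp x\<close>, where the running supremum
  \<open>P\<close> is the least repair of \<phi> that is increasing. The upper growth condition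
  survives the supremum, because between \<open>x\<close> and \<open>y\<close> the function \<phi>
  grows no faster than the condition on \<open>f\<close> allows.\<close>

lemma minimal_dini_le:
  assumes f: "f \<in> dini_class 0 a" and l: "0 \<le> l" "l \<le> a"
    and min: "\<And>h. h \<in> dini_class l a \<Longrightarrow> (\<And>x. f x \<le> h x) \<Longrightarrow> g x \<le> h x"
    and bound: "\<And>y. y \<le> x \<Longrightarrow> exp y * f y + l * (exp x - exp y) \<le> B"
  shows "exp x * g x \<le> B"
proof -
  define \<phi> where "\<phi> y = exp y * (f y - l)" for y
  define P where "P x = Sup (\<phi> ` {..x})" for x
  have fr: "0 \<le> f y" "f y \<le> a" for y using f by (auto simp: dini_class_def image_subset_iff)
  have \<phi>_le: "\<phi> y \<le> exp y * (a - l)" for y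
    unfolding \<phi>_def using fr by (intro mult_left_mono) auto
  have bdd: "bdd_above (\<phi> ` {..x})" for x
  proof (rule bdd_aboveI2)
    fix y assume "y \<in> {..x}"
    hence "exp y * (a - l) \<le> exp x * (a - l)" using l by (intro mult_right_mono) auto
    thus "\<phi> y \<le> exp x * (a - l)" using \<phi>_le[of y] by simp
  qed
  have P_ge: "\<phi> y \<le> P x" if "y \<le> x" for x y
    unfolding P_def using that by (intro cSup_upper bdd) auto
  have P_leI: "P x \<le> B" if "\<And>y. y \<le> x \<Longrightarrow> \<phi> y \<le> B" for x B
    unfolding P_def using that by (intro cSup_least) auto
  have P_mono: "P x \<le> P y" if "x \<le> y" for x y
    using that by (intro P_leI P_ge) auto
  have P_upper: "P y \<le> P x + (a - l) * (exp y - exp x)" if "x \<le> y" for x y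
  proof (rule P_leI)
    fix z assume z: "z \<le> y"
    show "\<phi> z \<le> P x + (a - l) * (exp y - exp x)"
    proof (cases "z \<le> x")
      case True
      have "0 \<le> (a - l) * (exp y - exp x)" using l that by simp
      thus ?thesis using P_ge[OF True] by simp
    next
      case False
      have "exp x * (a - f x) \<le> exp z * (a - f z)"
        using dini_class_upper[OF f, of x z] False by simp
      hence "\<phi> z \<le> \<phi> x + (a - l) * (exp z - exp x)" by (simp add: \<phi>_def algebra_simps)
      also have "\<dots> \<le> P x + (a - l) * (exp y - exp x)"
        using z l by (intro add_mono P_ge mult_left_mono) auto
      finally show ?thesis .
    qed
  qed
  \<comment> \<open>Let \<open>y\<close> tend to minus infinity: \<open>\<phi> y\<close> is at least
    \<open>- l * exp y\<close>, which vanishes. This gives \<open>l \<le> h x\<close>.\<close>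
  have P_0: "0 \<le> P x" for x
  proof (rule tendsto_lowerbound)
    have "((\<lambda>y. P x + l * exp y) \<longlongrightarrow> P x + l * 0) at_bot"
      by (intro tendsto_intros exp_at_bot)
    thus "((\<lambda>y. P x + l * exp y) \<longlongrightarrow> P x) at_bot" by simp
    show "\<forall>\<^sub>F y in at_bot. 0 \<le> P x + l * exp y"
      using eventually_le_at_bot[of x]
    proof eventually_elim
      case (elim y)
      have "- l * exp y \<le> \<phi> y" using fr[of y] by (simp add: \<phi>_def algebra_simps)
      thus ?case using P_ge[OF elim] by simp
    qed
  qed simp
  define h where "h x = l + P x / exp x" for x
  have eh: "exp x * h x = l * exp x + P x" for x by (simp add: h_def field_simps)
  have "h \<in> dini_class l a"
  proof (rule dini_classI)
    fix x
    have "P x \<le> exp x * (a - l)"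
    proof (rule P_leI)
      fix y assume "y \<le> x"
      hence "exp y * (a - l) \<le> exp x * (a - l)" using l by (intro mult_right_mono) auto
      thus "\<phi> y \<le> exp x * (a - l)" using \<phi>_le[of y] by simp
    qed
    thus "h x \<in> {l..a}" using P_0[of x] by (auto simp: h_def field_simps)
  next
    fix x y :: real assume "x \<le> y"
    thus "exp x * (h x - l) \<le> exp y * (h y - l)"
      using P_mono by (simp add: h_def)
    show "exp x * (a - h x) \<le> exp y * (a - h y)"
      using P_upper[OF \<open>x \<le> y\<close>] eh[of x] eh[of y] by (simp add: algebra_simps)
  qed
  moreover have "f x \<le> h x" for x
    using P_ge[of x x] by (simp add: \<phi>_def h_def field_simps)
  ultimately have "g x \<le> h x" by (rule min)
  hence "exp x * g x \<le> l * exp x + P x" unfolding eh[symmetric] by simp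
  also have "P x \<le> B - l * exp x"
    using bound by (intro P_leI) (auto simp: \<phi>_def algebra_simps)
  finally show ?thesis by simp
qed

section \<open>Covering numbers and packings\<close>

lemma covering_number_le:
  assumes "finite C" "E \<subseteq> (\<Union>x\<in>C. ball x r)"
  shows "covering_number r E \<le> card C"
  unfolding covering_number_def using assms by (intro cInf_lower) auto

lemma covering_number_attained:
  fixes E :: "'a::euclidean_space set"
  assumes "bounded E" "r > 0"
  obtains C where "finite C" "E \<subseteq> (\<Union>x\<in>C. ball x r)" "card C = covering_number r E"
proof -
  have "compact (closure E)" using assms by simp
  then obtain C where "finite C" "closure E \<subseteq> (\<Union>x\<in>C. ball x r)"
    using assms(2) unfolding compact_eq_totally_bounded by blast
  hence "card C \<in> {card C |C. finite C \<and> E \<subseteq> (\<Union>x\<in>C. ball x r)}"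
    using closure_subset by blast
  hence "covering_number r E \<in> {card C |C. finite C \<and> E \<subseteq> (\<Union>x\<in>C. ball x r)}"
    unfolding covering_number_def by (intro Inf_nat_def1) blast
  thus ?thesis using that by force
qed

lemma covering_number_mono:
  fixes E :: "'a::euclidean_space set"
  assumes "bounded E'" "E \<subseteq> E'" "0 < r" "r \<le> r'"
  shows "covering_number r' E \<le> covering_number r E'"
proof -
  obtain C where C: "finite C" "E' \<subseteq> (\<Union>x\<in>C. ball x r)" "card C = covering_number r E'"
    using covering_number_attained assms by blast
  have "E \<subseteq> (\<Union>x\<in>C. ball x r')"
    using C(2) assms by (force simp: subset_iff)
  from covering_number_le[OF C(1) this] C(3) show ?thesis by simp
qed

lemma covering_number_pos:
  fixes E :: "'a::euclidean_space set"
  assumes "bounded E" "E \<noteq> {}" "0 < r"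
  shows "1 \<le> covering_number r E"
proof -
  obtain C where C: "finite C" "E \<subseteq> (\<Union>x\<in>C. ball x r)" "card C = covering_number r E"
    using covering_number_attained assms by blast
  hence "C \<noteq> {}" using assms by auto
  thus ?thesis using C card_gt_0_iff[of C] by simp
qed

text \<open>One finite cover of the ball of radius \<kappa> by unit balls, scaled by
  \<open>r\<close> and moved to each centre, serves all radii and all sets. This absorbs every
  constant factor that radii pick up later.\<close>

lemma covering_number_le_of_larger_balls:
  obtains M :: nat where "M > 0"
    "\<And>(r::real) (E::'a::euclidean_space set) (J::'j set) p.
       \<lbrakk>0 < r; finite J; E \<subseteq> (\<Union>j\<in>J. ball (p j) (\<kappa> * r))\<rbrakk> \<Longrightarrow> covering_number r E \<le> M * card J"
proof -
  have "compact (cball (0::'a) \<kappa>)" by simp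
  then obtain K where K: "finite K" "cball (0::'a) \<kappa> \<subseteq> (\<Union>x\<in>K. ball x 1)"
    unfolding compact_eq_totally_bounded using zero_less_one by blast
  show ?thesis
  proof (rule that[of "card K + 1"])
    fix r :: real and E :: "'a set" and J :: "'j set" and p
    assume a: "0 < r" "finite J" "E \<subseteq> (\<Union>j\<in>J. ball (p j) (\<kappa> * r))"
    let ?C = "(\<lambda>(j, x). p j + r *\<^sub>R x) ` (J \<times> K)"
    have "E \<subseteq> (\<Union>x\<in>?C. ball x r)"
    proof
      fix y assume "y \<in> E"
      then obtain j where j: "j \<in> J" "dist (p j) y < \<kappa> * r" using a by force
      have "norm ((y - p j) /\<^sub>R r) = dist (p j) y / r"
        using a by (simp add: dist_norm norm_minus_commute divide_inverse_commute)
      also have "\<dots> \<le> \<kappa>" using j a by (simp add: field_simps)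
      finally have "norm ((y - p j) /\<^sub>R r) \<le> \<kappa>" .
      then obtain x where x: "x \<in> K" "dist x ((y - p j) /\<^sub>R r) < 1" using K by force
      have "y - (p j + r *\<^sub>R x) = r *\<^sub>R ((y - p j) /\<^sub>R r - x)"
        using a by (simp add: algebra_simps)
      hence "dist (p j + r *\<^sub>R x) y = r * dist x ((y - p j) /\<^sub>R r)"
        using a by (simp only: dist_norm norm_minus_commute[of _ y] norm_scaleR) (simp add: norm_minus_commute)
      also have "\<dots> < r" using x a by simp
      finally show "y \<in> (\<Union>x\<in>?C. ball x r)" using j x by auto
    qed
    hence "covering_number r E \<le> card ?C" using a K by (intro covering_number_le) auto
    also have "\<dots> \<le> card (J \<times> K)" using a K by (intro card_image_le) auto
    also have "\<dots> \<le> (card K + 1) * card J" by (simp add: card_cartesian_product)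
    finally show "covering_number r E \<le> (card K + 1) * card J" .
  qed simp
qed

text \<open>Volume comparison. Disjointness is asked of sets \<open>G j\<close> around the balls,
  because these will be the images of \<open>U\<close> under words.\<close>

lemma sum_disjoint_balls_le:
  fixes z :: "'i \<Rightarrow> 'a::euclidean_space"
  assumes "finite J" "0 \<le> R" "\<And>j. j \<in> J \<Longrightarrow> 0 \<le> \<beta> j"
    and "\<And>j. j \<in> J \<Longrightarrow> ball (z j) (\<beta> j) \<subseteq> G j" "\<And>j. j \<in> J \<Longrightarrow> G j \<subseteq> cball p R"
    and disj: "\<And>j k. \<lbrakk>j \<in> J; k \<in> J; j \<noteq> k\<rbrakk> \<Longrightarrow> G j \<inter> G k = {}"
  shows "(\<Sum>j\<in>J. \<beta> j ^ DIM('a)) \<le> R ^ DIM('a)"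
proof -
  let ?u = "unit_ball_vol (real DIM('a))"
  have u: "?u > 0" by (simp add: unit_ball_vol_pos)
  have "?u * (\<Sum>j\<in>J. \<beta> j ^ DIM('a)) = (\<Sum>j\<in>J. measure lebesgue (ball (z j) (\<beta> j)))"
    using assms by (simp add: sum_distrib_left content_ball)
  also have "\<dots> = measure lebesgue (\<Union>j\<in>J. ball (z j) (\<beta> j))"
  proof (rule measure_UNION'[symmetric])
    show "pairwise (\<lambda>i j. disjnt (ball (z i) (\<beta> i)) (ball (z j) (\<beta> j))) J"
      using assms(4) disj unfolding pairwise_def disjnt_def by blast
  qed (use assms in auto)
  also have "\<dots> \<le> measure lebesgue (cball p R)"
  proof (rule measure_mono_fmeasurable)
    show "(\<Union>j\<in>J. ball (z j) (\<beta> j)) \<subseteq> cball p R" using assms(4,5) by blast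
  qed (use assms in \<open>auto intro!: sets.finite_UN\<close>)
  also have "\<dots> = ?u * R ^ DIM('a)" using assms by (simp add: content_cball)
  finally show ?thesis using u by simp
qed

lemma card_disjoint_balls_le:
  fixes z :: "'i \<Rightarrow> 'a::euclidean_space"
  assumes "finite J" "0 \<le> \<kappa>" "0 < \<beta>"
    and "\<And>j. j \<in> J \<Longrightarrow> ball (z j) \<beta> \<subseteq> G j" "\<And>j. j \<in> J \<Longrightarrow> G j \<subseteq> cball p (\<kappa> * \<beta>)"
    and "\<And>j k. \<lbrakk>j \<in> J; k \<in> J; j \<noteq> k\<rbrakk> \<Longrightarrow> G j \<inter> G k = {}"
  shows "real (card J) \<le> \<kappa> ^ DIM('a)"
  using sum_disjoint_balls_le[of J "\<kappa> * \<beta>" "\<lambda>_. \<beta>" z G p] assms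
  by (simp add: power_mult_distrib)

section \<open>Conformal systems\<close>

lemma word_map_simps [simp]:
  "word_map S [] = id" "word_map S (i # w) = S i \<circ> word_map S w"
  "word_map S (u @ v) = word_map S u \<circ> word_map S v"
proof -
  show "word_map S (u @ v) = word_map S u \<circ> word_map S v"
    by (induction u) (auto simp: word_map_def)
qed (auto simp: word_map_def)

lemma word_map_into:
  assumes "\<And>i. i \<in> I \<Longrightarrow> S i ` Y \<subseteq> Y" "w \<in> lists I"
  shows "word_map S w ` Y \<subseteq> Y"
  using assms(2) by induction (use assms(1) in \<open>fastforce+\<close>)

lemma word_map_inj_on:
  assumes "\<And>i. i \<in> I \<Longrightarrow> S i ` Y \<subseteq> Y" "\<And>i. i \<in> I \<Longrightarrow> inj_on (S i) Y" "w \<in> lists I"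
  shows "inj_on (word_map S w) Y"
  using assms(3)
proof induction
  case (Cons i w)
  have "word_map S w ` Y \<subseteq> Y" using assms(1) Cons(2) by (rule word_map_into)
  moreover have "inj_on (S i) Y" using assms(2) Cons(1) .
  ultimately show ?case using Cons(3) unfolding word_map_simps
    by (intro comp_inj_on) (auto intro: inj_on_subset)
qed simp

lemma word_map_cong_on:
  assumes "\<And>i. i \<in> I \<Longrightarrow> S i ` Y \<subseteq> Y" "\<And>i x. \<lbrakk>i \<in> I; x \<in> Y\<rbrakk> \<Longrightarrow> T i x = S i x" "w \<in> lists I" "x \<in> Y"
  shows "word_map T w x = word_map S w x"
  using assms(3)
proof induction
  case (Cons i w)
  have "word_map S w ` Y \<subseteq> Y" using assms(1) Cons(2) by (rule word_map_into)
  hence "word_map S w x \<in> Y" using assms(4) by auto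
  thus ?case using Cons assms(2) by simp
qed simp

text \<open>The metric data of a conformal system: \<open>m w\<close> stands for the contraction ratio of the word
  \<open>w\<close> up to the factor \<open>L\<close>. Only super-multiplicativity of \<open>m\<close> is ever used.\<close>

locale ifs_geometry =
  fixes X U :: "'a::euclidean_space set" and I :: "'i set" and S :: "'i \<Rightarrow> 'a \<Rightarrow> 'a"
    and m :: "'i list \<Rightarrow> real" and L c :: real
  assumes compact_X: "compact X" and U_subset: "U \<subseteq> X" and countable_I: "countable I"
    and S_into: "i \<in> I \<Longrightarrow> S i ` X \<subseteq> X" and S_into_U: "i \<in> I \<Longrightarrow> S i ` U \<subseteq> U"
    and S_disjoint: "\<lbrakk>i \<in> I; j \<in> I; i \<noteq> j\<rbrakk> \<Longrightarrow> S i ` U \<inter> S j ` U = {}"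
    and c: "0 < c" "c < 1"
    and contraction: "\<lbrakk>i \<in> I; x \<in> X; y \<in> X\<rbrakk> \<Longrightarrow> dist (S i x) (S i y) \<le> c * dist x y"
    and L: "1 \<le> L"
    and m_pos: "w \<in> lists I \<Longrightarrow> 0 < m w" and m_Nil: "m [] = 1"
    and m_append: "\<lbrakk>u \<in> lists I; v \<in> lists I\<rbrakk> \<Longrightarrow> m u * m v \<le> m (u @ v)"
    and upper: "\<lbrakk>w \<in> lists I; x \<in> X; y \<in> X\<rbrakk> \<Longrightarrow>
      dist (word_map S w x) (word_map S w y) \<le> L * m w * dist x y"
    and lower: "\<lbrakk>w \<in> lists I; x \<in> X; y \<in> X\<rbrakk> \<Longrightarrow>
      m w * dist x y \<le> L * dist (word_map S w x) (word_map S w y)"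
    and inner_ball: "w \<in> lists I \<Longrightarrow> \<exists>z. ball z (m w / L) \<subseteq> word_map S w ` U"

section \<open>Maps whose derivative is a similarity\<close>

definition similar_at :: "real \<Rightarrow> (real ^ 'n \<Rightarrow> real ^ 'n) \<Rightarrow> real ^ 'n \<Rightarrow> bool" where
  "similar_at k f x \<longleftrightarrow> 0 < k \<and>
     (\<exists>Q. orthogonal_matrix Q \<and> (f has_derivative (\<lambda>h. k *\<^sub>R (Q *v h))) (at x))"

lemma norm_orthogonal_matrix_mult:
  fixes Q :: "real ^ 'n ^ 'n"
  assumes "orthogonal_matrix Q"
  shows "norm (Q *v h) = norm h"
  using assms orthogonal_transformation_matrix[of "(*v) Q"]
  by (auto simp: matrix_vector_mul_linear orthogonal_transformation)

lemma similar_at_has_derivative: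
  assumes "similar_at k f x"
  obtains f' where "(f has_derivative f') (at x)" "\<And>h. norm (f' h) = k * norm h"
  using assms by (auto simp: similar_at_def norm_orthogonal_matrix_mult)

lemma similar_at_comp:
  assumes "similar_at k g x" "similar_at l f (g x)"
  shows "similar_at (l * k) (f \<circ> g) x"
proof -
  obtain Q where Q: "k > 0" "orthogonal_matrix Q" "(g has_derivative (\<lambda>h. k *\<^sub>R (Q *v h))) (at x)"
    using assms by (auto simp: similar_at_def)
  obtain R where R: "l > 0" "orthogonal_matrix R" "(f has_derivative (\<lambda>h. l *\<^sub>R (R *v h))) (at (g x))"
    using assms by (auto simp: similar_at_def)
  have "(f \<circ> g has_derivative (\<lambda>h. l *\<^sub>R (R *v h)) \<circ> (\<lambda>h. k *\<^sub>R (Q *v h))) (at x)"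
    using Q R by (intro diff_chain_at)
  also have "(\<lambda>h. l *\<^sub>R (R *v h)) \<circ> (\<lambda>h. k *\<^sub>R (Q *v h)) = (\<lambda>h. (l * k) *\<^sub>R ((R ** Q) *v h))"
    by (auto simp: fun_eq_iff matrix_vector_mul_assoc[symmetric] matrix_vector_mult_scaleR)
  finally show ?thesis using Q R unfolding similar_at_def by (blast intro: orthogonal_matrix_mul mult_pos_pos)
qed

lemma similar_at_spectral_norm:
  fixes f :: "real ^ 'n \<Rightarrow> real ^ 'n"
  assumes "similar_at k f x"
  shows "spectral_norm (jacobian f (at x)) = k"
proof -
  obtain f' where f': "(f has_derivative f') (at x)" "\<And>h. norm (f' h) = k * norm h"
    using similar_at_has_derivative[OF assms] by blast
  have lin: "bounded_linear f'" using f' by (rule_tac has_derivative_bounded_linear)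
  have "(f has_derivative (*v) (jacobian f (at x))) (at x)"
    using f' jacobian_works[of f "at x"] by (auto simp: differentiable_def)
  hence "(*v) (jacobian f (at x)) = f'" using f' by (rule_tac has_derivative_unique)
  moreover have "onorm f' = k"
  proof (rule antisym)
    show "onorm f' \<le> k" using f' by (intro onorm_le) simp
    have "norm (f' (axis undefined 1)) \<le> onorm f' * norm (axis undefined (1::real) :: real ^ 'n)"
      by (rule onorm[OF lin])
    thus "k \<le> onorm f'" using f' by (simp add: norm_axis_1)
  qed
  ultimately show ?thesis by (simp add: spectral_norm_def)
qed

lemma similar_at_continuous_on:
  assumes "\<And>x. x \<in> A \<Longrightarrow> \<exists>k. similar_at k f x"
  shows "continuous_on A f"
proof (rule continuous_at_imp_continuous_on, rule ballI)
  fix x assume "x \<in> A"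
  thus "continuous (at x) f" using assms similar_at_has_derivative has_derivative_continuous by metis
qed

text \<open>The mean value inequality for \<open>f\<close> bounds distances only from above, so it
  is applied to the inverse, on the largest ball around \<open>f x\<close> inside the image, which
  is convex. If its radius \<open>R\<close> were less than \<open>\<mu> * r\<close>, this ball would
  lie in the image of a smaller closed ball; that image is compact, so it would also contain the
  boundary point \<open>y1\<close>, which is outside the image.\<close>

lemma conformal_ball_subset_image:
  fixes f :: "real ^ 'n \<Rightarrow> real ^ 'n"
  assumes sim: "\<And>y. y \<in> ball x r \<Longrightarrow> \<exists>k\<ge>\<mu>. similar_at k f y"
    and inj: "inj_on f (ball x r)" and "0 < \<mu>" "0 < r"
  shows "ball (f x) (\<mu> * r) \<subseteq> f ` ball x r"
proof (rule ccontr)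
  assume n: "\<not> ball (f x) (\<mu> * r) \<subseteq> f ` ball x r"
  let ?G = "f ` ball x r" and ?p = "f x"
  have cont: "continuous_on (ball x r) f" using sim by (intro similar_at_continuous_on) blast
  have G: "open ?G" using cont inj by (intro invariance_of_domain) auto
  obtain y0 where "y0 \<in> ball ?p (\<mu> * r)" "y0 \<notin> ?G" using n by blast
  hence y0: "dist ?p y0 < \<mu> * r" "y0 \<in> - ?G" by auto
  define R where "R = infdist ?p (- ?G)"
  obtain y1 where y1: "y1 \<in> - ?G" "R = dist ?p y1"
    unfolding R_def using infdist_attains_inf[of "- ?G" ?p] G y0 by (auto simp: closed_Compl)
  have R_less: "R < \<mu> * r" using infdist_le[OF y0(2), of ?p] y0 by (simp add: R_def)
  have p: "?p \<in> ?G" using \<open>0 < r\<close> by simp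
  have R_pos: "R > 0" using y1 p by (metis ComplD zero_less_dist_iff)
  have sub: "ball ?p R \<subseteq> ?G"
  proof
    fix y assume "y \<in> ball ?p R"
    thus "y \<in> ?G" using infdist_le[of y "- ?G" ?p] by (force simp: R_def)
  qed
  define \<psi> where "\<psi> = inv_into (ball x r) f"
  have \<psi>: "\<psi> (f z) = z" if "z \<in> ball x r" for z
    using inj that by (simp add: \<psi>_def)
  have der: "\<exists>D. (\<psi> has_derivative D) (at y within ball ?p R) \<and> onorm D \<le> 1 / \<mu>" if y: "y \<in> ball ?p R" for y
  proof -
    obtain z where z: "y = f z" "z \<in> ball x r" using sub y by blast
    have "\<forall>w\<in>ball x r. \<exists>k Q. k \<ge> \<mu> \<and> orthogonal_matrix Q \<and> (f has_derivative (\<lambda>h. k *\<^sub>R (Q *v h))) (at w)"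
      using sim by (fastforce simp: similar_at_def)
    then obtain k Q where kQ: "\<And>w. w \<in> ball x r \<Longrightarrow> k w \<ge> \<mu>" "\<And>w. w \<in> ball x r \<Longrightarrow> orthogonal_matrix (Q w)"
      "\<And>w. w \<in> ball x r \<Longrightarrow> (f has_derivative (\<lambda>h. k w *\<^sub>R (Q w *v h))) (at w)"
      by metis
    have kp: "k w > 0" if "w \<in> ball x r" for w using kQ(1)[OF that] \<open>0 < \<mu>\<close> by simp
    have "(\<psi> has_derivative (\<lambda>h. (1 / k z) *\<^sub>R (transpose (Q z) *v h))) (at (f z))"
    proof (rule has_derivative_inverse_on[of "ball x r" f "\<lambda>w h. k w *\<^sub>R (Q w *v h)"])
      show "(\<lambda>h. k z *\<^sub>R (Q z *v h)) \<circ> (\<lambda>h. (1 / k z) *\<^sub>R (transpose (Q z) *v h)) = id"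
        using kp[OF z(2)] kQ(2)[OF z(2)]
        by (auto simp: fun_eq_iff matrix_vector_mult_scaleR matrix_vector_mul_assoc orthogonal_matrix_def
            simp del: transpose_matrix_vector)
    qed (use kQ \<psi> z in auto)
    moreover have "onorm (\<lambda>h. (1 / k z) *\<^sub>R (transpose (Q z) *v h)) \<le> 1 / \<mu>"
    proof (rule onorm_le)
      fix h
      have "norm ((1 / k z) *\<^sub>R (transpose (Q z) *v h)) = 1 / k z * norm h"
        using kp[OF z(2)] kQ(2)[OF z(2)]
        by (simp add: norm_orthogonal_matrix_mult del: transpose_matrix_vector)
      also have "\<dots> \<le> 1 / \<mu> * norm h"
        using kQ(1)[OF z(2)] \<open>0 < \<mu>\<close> by (intro mult_right_mono divide_left_mono) auto
      finally show "norm ((1 / k z) *\<^sub>R (transpose (Q z) *v h)) \<le> 1 / \<mu> * norm h" .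
    qed
    ultimately show ?thesis using z has_derivative_at_withinI by blast
  qed
  then obtain D where D: "\<And>y. y \<in> ball ?p R \<Longrightarrow> (\<psi> has_derivative D y) (at y within ball ?p R)"
     "\<And>y. y \<in> ball ?p R \<Longrightarrow> onorm (D y) \<le> 1 / \<mu>" by metis
  have "ball ?p R \<subseteq> f ` cball x (R / \<mu>)"
  proof
    fix y assume y: "y \<in> ball ?p R"
    have "norm (\<psi> y - \<psi> ?p) \<le> 1 / \<mu> * norm (y - ?p)"
      using differentiable_bound[OF convex_ball D] y R_pos by simp
    also have "\<dots> \<le> 1 / \<mu> * R" using y \<open>0 < \<mu>\<close> by (intro mult_left_mono) (auto simp: dist_norm norm_minus_commute)
    finally have "\<psi> y \<in> cball x (R / \<mu>)"
      using \<psi>[of x] \<open>0 < r\<close> by (simp add: dist_norm norm_minus_commute)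
    moreover have "f (\<psi> y) = y" using sub y by (auto simp: \<psi>_def f_inv_into_f)
    ultimately show "y \<in> f ` cball x (R / \<mu>)" by force
  qed
  moreover have small: "cball x (R / \<mu>) \<subseteq> ball x r"
    using R_less \<open>0 < \<mu>\<close> by (auto simp: field_simps) (smt (verit) divide_less_eq mult.commute)
  have "compact (f ` cball x (R / \<mu>))"
    using continuous_on_subset[OF cont small] by (intro compact_continuous_image) auto
  hence "closed (f ` cball x (R / \<mu>))" by (rule compact_imp_closed)
  ultimately have "closure (ball ?p R) \<subseteq> f ` cball x (R / \<mu>)" by (intro closure_minimal)
  hence "y1 \<in> f ` cball x (R / \<mu>)" using R_pos y1 by auto
  thus False using small y1 by blast
qed

lemma conformal_dist_image_le:
  fixes f :: "real ^ 'n \<Rightarrow> real ^ 'n"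
  assumes sim: "\<And>y. y \<in> cball x r \<Longrightarrow> \<exists>k\<le>B. similar_at k f y"
    and y: "y \<in> cball x r"
  shows "dist (f x) (f y) \<le> B * dist x y"
proof -
  have "\<exists>D. (f has_derivative D) (at z within cball x r) \<and> onorm D \<le> B" if z: "z \<in> cball x r" for z
  proof -
    obtain k where k: "k \<le> B" "similar_at k f z" using sim z by blast
    then obtain D where D: "(f has_derivative D) (at z)" "\<And>h. norm (D h) = k * norm h"
      using similar_at_has_derivative by blast
    have "onorm D \<le> B" using k D by (intro onorm_le) (auto intro: mult_right_mono)
    thus ?thesis using D has_derivative_at_withinI by blast
  qed
  then obtain D where D: "\<And>z. z \<in> cball x r \<Longrightarrow> (f has_derivative D z) (at z within cball x r)"
     "\<And>z. z \<in> cball x r \<Longrightarrow> onorm (D z) \<le> B" by metis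
  have "x \<in> cball x r" using y order_trans[OF zero_le_dist, of x y r] by simp
  thus ?thesis using differentiable_bound[OF convex_cball D, of x y] y by (simp add: dist_norm)
qed

text \<open>The values of the distance to \<open>f x\<close> on the connected set \<open>X\<close> form an interval, which is covered
  by boundedly many intervals of length \<open>2 * D\<close>.\<close>

lemma connected_dist_image_le:
  fixes X :: "'a::metric_space set"
  assumes "compact X" "connected X" "0 < \<delta>"
  obtains N :: nat where
    "\<And>(f :: 'a \<Rightarrow> 'b::metric_space) D x y. \<lbrakk>continuous_on X f; 0 \<le> D;
        \<And>x y. \<lbrakk>x \<in> X; y \<in> X; dist x y < \<delta>\<rbrakk> \<Longrightarrow> dist (f x) (f y) \<le> D; x \<in> X; y \<in> X\<rbrakk>
      \<Longrightarrow> dist (f x) (f y) \<le> real N * D"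
proof -
  obtain C where C: "finite C" "C \<subseteq> X" "X \<subseteq> (\<Union>z\<in>C. ball z \<delta>)"
  proof (rule compactE_image[OF assms(1)])
    show "X \<subseteq> (\<Union>z\<in>X. ball z \<delta>)" using assms(3) by auto
  qed auto
  show ?thesis
  proof (rule that[of "2 * card C"])
    fix f :: "'a \<Rightarrow> 'b" and D x y
    assume f: "continuous_on X f" "0 \<le> D" and x: "x \<in> X" and y: "y \<in> X"
      and loc: "\<And>x y. \<lbrakk>x \<in> X; y \<in> X; dist x y < \<delta>\<rbrakk> \<Longrightarrow> dist (f x) (f y) \<le> D"
    let ?\<phi> = "\<lambda>z. dist (f x) (f z)"
    have "connected (?\<phi> ` X)"
      using f assms(2) by (intro connected_continuous_image continuous_intros)
    hence "{?\<phi> x..?\<phi> y} \<subseteq> ?\<phi> ` X"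
      using x y by (intro connected_contains_Icc) auto
    also have "\<dots> \<subseteq> (\<Union>z\<in>C. {?\<phi> z - D..?\<phi> z + D})" (is "_ \<subseteq> ?W")
    proof safe
      fix u assume u: "u \<in> X"
      then obtain z where z: "z \<in> C" "dist z u < \<delta>" using C by auto
      have "dist (f z) (f u) \<le> D" using loc z u C by auto
      hence "?\<phi> u \<in> {?\<phi> z - D..?\<phi> z + D}"
        using dist_triangle[of "f x" "f u" "f z"] dist_triangle[of "f x" "f z" "f u"]
        by (simp add: dist_commute)
      thus "?\<phi> u \<in> (\<Union>z\<in>C. {?\<phi> z - D..?\<phi> z + D})" using z by blast
    qed
    finally have "{?\<phi> x..?\<phi> y} \<subseteq> ?W" .
    moreover have Icc: "{a..b} \<in> fmeasurable lborel" for a b :: real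
      by (simp add: fmeasurable_def emeasure_lborel_Icc_eq)
    ultimately have "measure lborel {?\<phi> x..?\<phi> y} \<le> measure lborel (\<Union>z\<in>C. {?\<phi> z - D..?\<phi> z + D})"
      using C by (intro measure_mono_fmeasurable) (auto intro!: fmeasurable.finite_UN)
    also have "\<dots> \<le> (\<Sum>z\<in>C. measure lborel {?\<phi> z - D..?\<phi> z + D})"
      using C by (intro measure_UNION_le) auto
    also have "\<dots> = real (2 * card C) * D" using f by simp
    finally show "dist (f x) (f y) \<le> real (2 * card C) * D" by simp
  qed
qed

text \<open>Derivatives are taken of the extensions \<open>T i\<close> on \<open>V\<close>. Bounded
  distortion makes all derivative norms of a word agree with \<open>m w\<close> up to
  \<open>K\<close>; the mean value inequality works on balls of radius \<delta> inside
  \<open>V\<close>, and connectedness of \<open>X\<close> carries the upper bound to distant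
  points.\<close>

lemma CIFS_ifs_geometry:
  fixes X :: "(real ^ 'n) set"
  assumes "CIFS X I S"
  obtains m L c where "ifs_geometry X (interior X) I S m L c"
proof -
  obtain c where c: "0 < c" "c < 1" and
    contr: "\<And>i x y. \<lbrakk>i \<in> I; x \<in> X; y \<in> X\<rbrakk> \<Longrightarrow> dist (S i x) (S i y) \<le> c * dist x y"
  proof -
    obtain c where c: "0 < c" "c < 1" "\<forall>i\<in>I. \<forall>x\<in>X. \<forall>y\<in>X. x \<noteq> y \<longrightarrow>
           0 < norm (S i x - S i y) \<and> norm (S i x - S i y) \<le> c * norm (x - y)"
      using assms by (auto simp: CIFS_def contractive_system_def)
    moreover have "dist (S i x) (S i y) \<le> c * dist x y" if "i \<in> I" "x \<in> X" "y \<in> X" for i x y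
      using c that by (cases "x = y") (auto simp: dist_norm)
    ultimately show ?thesis using that by blast
  qed
  have X: "compact X" "connected X" "countable I" and S_into: "\<And>i. i \<in> I \<Longrightarrow> S i ` X \<subseteq> X"
    using assms by (auto simp: CIFS_def contractive_system_def)
  have osc: "interior X \<noteq> {}" "\<And>i. i \<in> I \<Longrightarrow> S i ` interior X \<subseteq> interior X"
    "\<And>i j. \<lbrakk>i \<in> I; j \<in> I; i \<noteq> j\<rbrakk> \<Longrightarrow> S i ` interior X \<inter> S j ` interior X = {}"
    using assms by (auto simp: CIFS_def open_set_condition_def)
  obtain V T where ce: "conformal_extension X I S V T" and bd: "bounded_distortion I V T"
    using assms by (auto simp: CIFS_def)
  have V: "open V" "X \<subseteq> V" using ce by (auto simp: conformal_extension_def)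
  have T_into: "T i ` V \<subseteq> V" and T_conf: "conformal_on V (T i)" and T_eq: "x \<in> X \<Longrightarrow> T i x = S i x"
    and T_inj: "inj_on (T i) V" and T_diff: "y \<in> V \<Longrightarrow> T i differentiable (at y)" if "i \<in> I" for i x y
    using ce that by (auto simp: conformal_extension_def C1_Hoelder_diffeo_on_def C1_Hoelder_on_def)
  obtain x0 where x0: "x0 \<in> interior X" using osc by auto
  hence x0': "x0 \<in> X" "x0 \<in> V" using interior_subset V by auto

  define \<nu> where "\<nu> w x = spectral_norm (jacobian (word_map T w) (at x))" for w x
  have sim1: "\<exists>k. similar_at k (T i) x" if i: "i \<in> I" and x: "x \<in> V" for i x
  proof -
    obtain k Q where "k > 0" "orthogonal_matrix Q" "jacobian (T i) (at x) = k *\<^sub>R Q"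
      using T_conf[OF i] x by (auto simp: conformal_on_def)
    moreover have "(T i has_derivative (\<lambda>h. jacobian (T i) (at x) *v h)) (at x)"
      using T_diff[OF i x] jacobian_works by blast
    ultimately show ?thesis
      by (auto simp: similar_at_def scaleR_matrix_vector_assoc)
  qed
  have sim_ex: "\<exists>k. similar_at k (word_map T w) x" if "w \<in> lists I" "x \<in> V" for w x
    using that(1)
  proof induction
    case Nil
    have "similar_at 1 (id :: real ^ 'n \<Rightarrow> real ^ 'n) x"
      unfolding similar_at_def
      by (intro conjI exI[of _ "mat 1"]) (auto simp: orthogonal_matrix_id id_def)
    thus ?case unfolding word_map_simps by blast
  next
    case (Cons i w)
    have "word_map T w ` V \<subseteq> V" using T_into Cons(2) by (rule word_map_into)
    hence "word_map T w x \<in> V" using that(2) by auto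
    thus ?case using sim1[OF Cons(1)] Cons(3) similar_at_comp unfolding word_map_simps by blast
  qed
  have sim: "similar_at (\<nu> w x) (word_map T w) x" if "w \<in> lists I" "x \<in> V" for w x
    using sim_ex[OF that] similar_at_spectral_norm unfolding \<nu>_def by metis
  have \<nu>_pos: "0 < \<nu> w x" if "w \<in> lists I" "x \<in> V" for w x
    using sim[OF that] by (simp add: similar_at_def)
  have \<nu>_Nil: "\<nu> [] x = 1" for x
  proof -
    have "similar_at 1 (id :: real ^ 'n \<Rightarrow> real ^ 'n) x"
      unfolding similar_at_def
      by (intro conjI exI[of _ "mat 1"]) (auto simp: orthogonal_matrix_id id_def)
    thus ?thesis unfolding \<nu>_def word_map_simps by (rule similar_at_spectral_norm)
  qed
  have T_into_w: "word_map T w ` V \<subseteq> V" if "w \<in> lists I" for w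
    using T_into that by (rule word_map_into)
  have \<nu>_append: "\<nu> (u @ v) x = \<nu> u (word_map T v x) * \<nu> v x"
    if "u \<in> lists I" "v \<in> lists I" "x \<in> V" for u v x
    using similar_at_spectral_norm[OF similar_at_comp[OF sim[OF that(2,3)] sim[OF that(1)]]]
      T_into_w[OF that(2)] that(3) unfolding \<nu>_def[of "u @ v"] word_map_simps by blast
  obtain K where K: "K \<ge> 1" and dist: "\<And>w x y. \<lbrakk>w \<in> lists I; x \<in> V; y \<in> V\<rbrakk> \<Longrightarrow> \<nu> w x \<le> K * \<nu> w y"
    using bd unfolding bounded_distortion_def \<nu>_def by blast

  \<comment> \<open>With the infimum, the chain rule gives super-multiplicativity without a
    constant; bounded distortion enters only through \<open>\<nu>_le\<close>.\<close>
  define m where "m w = (INF x\<in>V. \<nu> w x)" for w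
  have m_le: "m w \<le> \<nu> w x" if "w \<in> lists I" "x \<in> V" for w x
    unfolding m_def using that \<nu>_pos by (intro cINF_lower bdd_belowI2[of _ 0]) (auto intro: less_imp_le)
  have m_ge: "a \<le> m w" if "\<And>x. x \<in> V \<Longrightarrow> a \<le> \<nu> w x" for a w
    unfolding m_def using that x0' by (intro cINF_greatest) auto
  have \<nu>_le: "\<nu> w x \<le> K * m w" if "w \<in> lists I" "x \<in> V" for w x
  proof -
    have "\<nu> w x / K \<le> m w" using dist that K by (intro m_ge) (auto simp: field_simps)
    thus ?thesis using K by (simp add: field_simps)
  qed
  have m_pos: "0 < m w" if "w \<in> lists I" for w
  proof -
    have "0 < K * m w" using \<nu>_le[OF that x0'(2)] \<nu>_pos[OF that x0'(2)] by simp
    thus ?thesis using K by (simp add: zero_less_mult_iff)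
  qed
  have "V \<noteq> {}" using x0' by auto
  hence m_Nil: "m [] = 1" by (simp add: m_def \<nu>_Nil)
  have m_append: "m u * m v \<le> m (u @ v)" if "u \<in> lists I" "v \<in> lists I" for u v
  proof (rule m_ge)
    fix x assume "x \<in> V"
    hence "word_map T v x \<in> V" using T_into_w[OF that(2)] by auto
    thus "m u * m v \<le> \<nu> (u @ v) x"
      unfolding \<nu>_append[OF that \<open>x \<in> V\<close>]
      using m_le[OF that(1) \<open>word_map T v x \<in> V\<close>] m_le[OF that(2) \<open>x \<in> V\<close>]
        m_pos[OF that(2)] \<nu>_pos[OF that(1) \<open>word_map T v x \<in> V\<close>]
      by (intro mult_mono) simp_all
  qed

  \<comment> \<open>A uniform scale on which balls around points of \<open>X\<close> stay in
    \<open>V\<close>; neither \<open>X\<close> nor \<open>V\<close> need be convex.\<close>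
  obtain \<delta> where \<delta>: "0 < \<delta>" "\<And>x. x \<in> X \<Longrightarrow> cball x \<delta> \<subseteq> V"
  proof -
    obtain e where "e > 0" "(\<Union>x\<in>X. cball x e) \<subseteq> V"
      using compact_subset_open_imp_cball_epsilon_subset[OF X(1) V] by auto
    thus ?thesis using that by blast
  qed
  obtain r1 where r1: "r1 > 0" "ball x0 r1 \<subseteq> interior X"
    using openE[OF open_interior x0] by blast
  define r0 where "r0 = min r1 \<delta>"
  have r0: "0 < r0" "r0 \<le> \<delta>" "ball x0 r0 \<subseteq> interior X"
    using r1 \<delta> by (auto simp: r0_def)
  obtain B0 where B0: "\<And>x y. \<lbrakk>x \<in> X; y \<in> X\<rbrakk> \<Longrightarrow> dist x y \<le> B0"
    using compact_imp_bounded[OF X(1), unfolded bounded_two_points] by blast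
  \<comment> \<open>The maximum makes \<open>B / \<delta>\<close> at least 1, as the case of close
    points in \<open>lower\<close> requires.\<close>
  define B where "B = max B0 \<delta>"
  have B: "B > 0" "\<delta> \<le> B" "\<And>x y. \<lbrakk>x \<in> X; y \<in> X\<rbrakk> \<Longrightarrow> dist x y \<le> B"
    using B0 \<delta>(1) by (auto simp: B_def intro: max.coboundedI1)
  obtain N :: nat where N: "\<And>(f :: real ^ 'n \<Rightarrow> real ^ 'n) D x y. \<lbrakk>continuous_on X f; 0 \<le> D;
        \<And>x y. \<lbrakk>x \<in> X; y \<in> X; dist x y < \<delta>\<rbrakk> \<Longrightarrow> dist (f x) (f y) \<le> D; x \<in> X; y \<in> X\<rbrakk>
      \<Longrightarrow> dist (f x) (f y) \<le> real N * D"
    using connected_dist_image_le[OF X(1,2) \<delta>(1)] by blast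
  have ball_image: "ball (word_map T w x) (m w * r) \<subseteq> word_map T w ` ball x r"
    if "w \<in> lists I" "x \<in> X" "0 < r" "r \<le> \<delta>" for w x r
  proof (rule conformal_ball_subset_image)
    have sub: "ball x r \<subseteq> V" using \<delta>(2)[OF that(2)] that(4) by force
    show "\<exists>k\<ge>m w. similar_at k (word_map T w) y" if "y \<in> ball x r" for y
      using sim m_le \<open>w \<in> lists I\<close> sub that by blast
    have "inj_on (word_map T w) V" using T_into T_inj that(1) by (rule word_map_inj_on)
    thus "inj_on (word_map T w) (ball x r)" using sub inj_on_subset by blast
  qed (use that m_pos in auto)
  have near: "dist (word_map T w x) (word_map T w y) \<le> K * m w * dist x y"
    if "w \<in> lists I" "x \<in> X" "dist x y \<le> \<delta>" for w x y
    using \<delta>(2)[OF that(2)] sim[OF that(1)] \<nu>_le[OF that(1)] that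
    by (intro conformal_dist_image_le[of x \<delta>]) (auto simp: subset_iff)
  have upper: "dist (word_map T w x) (word_map T w y) \<le> (real N + 1) * K * m w * dist x y"
    if "w \<in> lists I" "x \<in> X" "y \<in> X" for w x y
  proof (cases "dist x y \<le> \<delta>")
    case True
    have "K * m w * dist x y \<le> (real N + 1) * (K * m w * dist x y)"
      using K m_pos[OF that(1)] by (simp add: algebra_simps)
    thus ?thesis using near[OF that(1,2) True] by (simp add: mult.assoc)
  next
    case False
    have "dist (word_map T w x) (word_map T w y) \<le> real N * (K * m w * \<delta>)"
    proof (rule N[where f = "word_map T w" and x = x and y = y])
      show "continuous_on X (word_map T w)"
        using sim_ex[OF that(1)] V by (intro similar_at_continuous_on) auto
      show "0 \<le> K * m w * \<delta>" using K m_pos[OF that(1)] \<delta> by simp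
      show "dist (word_map T w x) (word_map T w y) \<le> K * m w * \<delta>"
        if "x \<in> X" "y \<in> X" "dist x y < \<delta>" for x y
      proof -
        have "K * m w * dist x y \<le> K * m w * \<delta>"
          using that K m_pos[OF \<open>w \<in> lists I\<close>] by (intro mult_left_mono) auto
        thus ?thesis using near[OF \<open>w \<in> lists I\<close> that(1) less_imp_le[OF that(3)]] by linarith
      qed
    qed (use that in auto)
    also have "\<dots> \<le> (real N + 1) * (K * m w * dist x y)"
      using False K m_pos[OF that(1)] \<delta> by (intro mult_mono) auto
    finally show ?thesis by (simp add: mult.assoc)
  qed
  have lower: "m w * dist x y \<le> B / \<delta> * dist (word_map T w x) (word_map T w y)"
    if w: "w \<in> lists I" and xy: "x \<in> X" "y \<in> X" for w x y
  proof (cases "x = y")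
    case False
    \<comment> \<open>The image of \<open>ball x r\<close> contains a ball of radius
      \<open>m w * r\<close> but, by injectivity, not the image of \<open>y\<close>. So the two
      images are at least \<open>m w * r\<close> apart, and \<open>r\<close> is at least
      \<open>\<delta> / B\<close> times the distance of \<open>x\<close> and
      \<open>y\<close>.\<close>
    define r where "r = min \<delta> (dist x y)"
    have r: "0 < r" "r \<le> \<delta>" "dist x y \<le> B / \<delta> * r"
    proof -
      show "dist x y \<le> B / \<delta> * r"
      proof (cases "\<delta> \<le> dist x y")
        case True thus ?thesis using B(3)[OF xy] \<delta> by (simp add: r_def)
      next
        case False
        have "1 * dist x y \<le> B / \<delta> * dist x y" using \<delta> B by (intro mult_right_mono) auto
        thus ?thesis using False by (simp add: r_def)
      qed
    qed (use False \<delta> in \<open>auto simp: r_def\<close>)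
    have "word_map T w y \<notin> word_map T w ` ball x r"
    proof
      assume "word_map T w y \<in> word_map T w ` ball x r"
      then obtain z where z: "z \<in> ball x r" "word_map T w y = word_map T w z" by auto
      have "z \<in> V" "y \<in> V" using \<delta>(2)[OF xy(1)] z r xy V by force+
      moreover have "inj_on (word_map T w) V" using T_into T_inj w by (rule word_map_inj_on)
      ultimately have "y = z" using z by (auto dest: inj_onD)
      thus False using z by (simp add: r_def)
    qed
    hence "m w * r \<le> dist (word_map T w x) (word_map T w y)"
      using ball_image[OF w xy(1) r(1,2)] by force
    hence "B / \<delta> * (m w * r) \<le> B / \<delta> * dist (word_map T w x) (word_map T w y)"
      using B \<delta> by (intro mult_left_mono) auto
    moreover have "m w * dist x y \<le> m w * (B / \<delta> * r)"
      using r m_pos[OF w] by (intro mult_left_mono) auto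
    ultimately show ?thesis by (simp add: mult_ac)
  qed simp
  \<comment> \<open>A sum in place of a maximum. The summand \<open>1 / r0\<close> makes
    \<open>m w / L\<close> at most \<open>m w * r0\<close>, the radius of a ball inside the image of
    the interior.\<close>
  define L where "L = 1 + (real N + 1) * K + B / \<delta> + 1 / r0"
  have L: "1 \<le> L" "(real N + 1) * K \<le> L" "B / \<delta> \<le> L" "1 / L \<le> r0" "L > 0"
  proof -
    have pos: "0 < (real N + 1) * K" "0 < B / \<delta>" "0 < 1 / r0" using K B \<delta> r0 by auto
    thus "1 \<le> L" "(real N + 1) * K \<le> L" "B / \<delta> \<le> L" unfolding L_def by linarith+
    have "1 / r0 \<le> L" using pos unfolding L_def by linarith
    thus "1 / L \<le> r0" "L > 0" using r0 \<open>1 \<le> L\<close> by (auto simp: field_simps)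
  qed
  have eq: "word_map T w x = word_map S w x" if "w \<in> lists I" "x \<in> X" for w x
    using S_into T_eq that by (rule word_map_cong_on)
  have "ifs_geometry X (interior X) I S m L c"
  proof
    fix w x y assume w: "w \<in> lists I" and xy: "x \<in> X" "y \<in> X"
    have "(real N + 1) * K * (m w * dist x y) \<le> L * (m w * dist x y)"
      using L m_pos[OF w] by (intro mult_right_mono) auto
    thus "dist (word_map S w x) (word_map S w y) \<le> L * m w * dist x y"
      using upper[OF w xy] eq[OF w] xy by (simp add: mult.assoc)
    have "B / \<delta> * dist (word_map S w x) (word_map S w y) \<le> L * dist (word_map S w x) (word_map S w y)"
      using L by (intro mult_right_mono) auto
    thus "m w * dist x y \<le> L * dist (word_map S w x) (word_map S w y)"
      using lower[OF w xy] eq[OF w] xy by simp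
  next
    fix w assume w: "w \<in> lists I"
    have "m w / L \<le> m w * r0" using L m_pos[OF w] mult_left_mono[of "1 / L" r0 "m w"] by simp
    hence "ball (word_map T w x0) (m w / L) \<subseteq> ball (word_map T w x0) (m w * r0)" by auto
    also have "\<dots> \<subseteq> word_map T w ` ball x0 r0" using ball_image w x0' r0 by blast
    also have "\<dots> \<subseteq> word_map T w ` interior X" using r0 by blast
    also have "\<dots> = word_map S w ` interior X"
      using eq[OF w] interior_subset by (intro image_cong) auto
    finally show "\<exists>z. ball z (m w / L) \<subseteq> word_map S w ` interior X" by blast
  next
    show "interior X \<subseteq> X" by (rule interior_subset)
  qed (use X c contr S_into osc L m_pos m_Nil m_append in auto)
  thus ?thesis by (rule that)
qed

section \<open>Words and the limit set\<close>

definition level :: "'i set \<Rightarrow> nat \<Rightarrow> 'i list set" where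
  "level I n = {w \<in> lists I. length w = n}"

lemma level_0 [simp]: "level I 0 = {[]}"
  by (auto simp: level_def)

lemma level_Suc: "level I (Suc n) = (\<lambda>(i, w). i # w) ` (I \<times> level I n)"
  by (force simp: level_def length_Suc_conv)

lemma level_subset_lists: "level I n \<subseteq> lists I"
  by (auto simp: level_def)

lemma finite_level [simp]: "finite I \<Longrightarrow> finite (level I n)"
  by (induction n) (auto simp: level_Suc)

context ifs_geometry
begin

lemma word_into: "w \<in> lists I \<Longrightarrow> word_map S w ` X \<subseteq> X"
  using S_into by (rule word_map_into)

lemma word_into_U: "w \<in> lists I \<Longrightarrow> word_map S w ` U \<subseteq> U"
  using S_into_U by (rule word_map_into)

lemma word_append_subset:
  assumes "u \<in> lists I" "v \<in> lists I"
  shows "word_map S (u @ v) ` X \<subseteq> word_map S u ` X"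
  using word_into[OF assms(2)] by (auto simp: image_comp[symmetric])

lemma word_inj: "w \<in> lists I \<Longrightarrow> inj_on (word_map S w) X"
proof (rule inj_onI)
  fix x y assume "w \<in> lists I" "x \<in> X" "y \<in> X" "word_map S w x = word_map S w y"
  thus "x = y" using lower[of w x y] m_pos[of w] by (simp add: mult_le_0_iff)
qed

lemma word_contraction:
  assumes "w \<in> lists I" "x \<in> X" "y \<in> X"
  shows "dist (word_map S w x) (word_map S w y) \<le> c ^ length w * dist x y"
  using assms(1)
proof induction
  case (Cons i w)
  have "word_map S w x \<in> X" "word_map S w y \<in> X" using word_into[OF Cons(2)] assms by auto
  hence "dist (S i (word_map S w x)) (S i (word_map S w y)) \<le> c * dist (word_map S w x) (word_map S w y)"
    using contraction Cons by blast
  also have "\<dots> \<le> c * (c ^ length w * dist x y)" using Cons c by (intro mult_left_mono) auto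
  finally show ?case by simp
qed simp

text \<open>At the first letter where the words differ, the open set condition separates them;
  injectivity carries this through the common prefix.\<close>

lemma words_disjoint:
  assumes "u \<in> lists I" "v \<in> lists I" "\<nexists>z. v = u @ z \<or> u = v @ z"
  shows "word_map S u ` U \<inter> word_map S v ` U = {}"
  using assms
proof (induction u arbitrary: v rule: list.induct)
  case Nil
  have "v = [] @ v" by simp
  thus ?case using Nil.prems(3) by blast
next
  case (Cons i u)
  then obtain j v' where v: "v = j # v'" by (cases v) auto
  have sub: "word_map S u ` U \<subseteq> U" "word_map S v' ` U \<subseteq> U"
    using Cons.prems v by (intro word_into_U; simp)+
  show ?case
  proof (cases "i = j")
    case True
    have "word_map S u ` U \<inter> word_map S v' ` U = {}"
    proof (rule Cons.IH)
      show "u \<in> lists I" "v' \<in> lists I" using Cons.prems v by simp_all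
      show "\<nexists>z. v' = u @ z \<or> u = v' @ z" using Cons.prems(3) v True by simp
    qed
    moreover have "inj_on (S i) X" using word_inj[of "[i]"] Cons.prems by simp
    hence "S i ` (word_map S u ` U \<inter> word_map S v' ` U) = S i ` word_map S u ` U \<inter> S i ` word_map S v' ` U"
      using sub U_subset by (intro inj_on_image_Int) (blast intro: order_trans)+
    ultimately have "S i ` word_map S u ` U \<inter> S i ` word_map S v' ` U = {}" by simp
    thus ?thesis by (simp only: v True word_map_simps image_comp)
  next
    case False
    hence "S i ` U \<inter> S j ` U = {}" using Cons.prems v S_disjoint by simp
    moreover have "S i ` word_map S u ` U \<subseteq> S i ` U" "S j ` word_map S v' ` U \<subseteq> S j ` U"
      using sub by (simp_all only: image_mono)
    ultimately have "S i ` word_map S u ` U \<inter> S j ` word_map S v' ` U = {}" by blast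
    thus ?thesis by (simp only: v word_map_simps image_comp)
  qed
qed

section \<open>Ratios of words and convergence of their powers\<close>

lemma X_two_points: obtains x y where "x \<in> X" "y \<in> X" "x \<noteq> y"
proof -
  obtain z where z: "ball z (1 / L) \<subseteq> X" using inner_ball[of "[]"] U_subset m_Nil by auto
  define b :: 'a where "b = (1 / (2 * L)) *\<^sub>R (SOME i. i \<in> Basis)"
  have norm_b: "norm b = 1 / (2 * L)" using L norm_Basis[OF SOME_Basis] by (simp add: b_def)
  hence "z \<in> ball z (1 / L)" "z + b \<in> ball z (1 / L)"
    using L by (auto simp: dist_norm field_simps)
  hence "z \<in> X" "z + b \<in> X" using z by blast+
  moreover have "b \<noteq> 0" using norm_b L by auto
  ultimately show ?thesis by (intro that[of z "z + b"]) auto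
qed

text \<open>The lower distance estimate and the contraction by \<open>c\<close> per letter bound the
  same distance from two sides; distinct points allow division by it.\<close>

lemma m_le: "w \<in> lists I \<Longrightarrow> m w \<le> L * c ^ length w"
proof -
  assume w: "w \<in> lists I"
  obtain x y where xy: "x \<in> X" "y \<in> X" "x \<noteq> y" by (rule X_two_points)
  have "m w * dist x y \<le> L * dist (word_map S w x) (word_map S w y)" using lower w xy by blast
  also have "\<dots> \<le> L * (c ^ length w * dist x y)"
    using L word_contraction[OF w xy(1,2)] by (intro mult_left_mono) auto
  finally show ?thesis using xy by (simp add: mult.assoc[symmetric])
qed

lemma m_small:
  assumes "0 < \<delta>" obtains N where "\<And>w. \<lbrakk>w \<in> lists I; N \<le> length w\<rbrakk> \<Longrightarrow> m w \<le> \<delta>"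
proof -
  obtain N where N: "c ^ N < \<delta> / L" using real_arch_pow_inv[of "\<delta> / L" c] c assms L by auto
  show ?thesis
  proof (rule that[of N])
    fix w assume w: "w \<in> lists I" "N \<le> length w"
    have "m w \<le> L * c ^ length w" by (rule m_le) fact
    also have "\<dots> \<le> L * c ^ N" using L c w by (intro mult_left_mono power_decreasing) auto
    also have "\<dots> \<le> \<delta>" using N L by (simp add: field_simps)
    finally show "m w \<le> \<delta>" .
  qed
qed

lemma X_bounded: obtains B where "0 < B" "\<And>x y. \<lbrakk>x \<in> X; y \<in> X\<rbrakk> \<Longrightarrow> dist x y \<le> B"
proof -
  obtain B where B: "\<And>x y. \<lbrakk>x \<in> X; y \<in> X\<rbrakk> \<Longrightarrow> dist x y \<le> B"
    using compact_imp_bounded[OF compact_X, unfolded bounded_two_points] by blast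
  show ?thesis by (rule that[of "max 1 B"]) (use B in \<open>auto intro: max.coboundedI2\<close>)
qed

text \<open>Distinct words of one length map \<open>U\<close> to disjoint subsets of
  \<open>X\<close>, each containing a ball of radius \<open>m w / L\<close>. Comparing volumes gives
  a bound that does not depend on the level.\<close>

lemma sum_m_power_le:
  obtains C where "\<And>n A. \<lbrakk>finite A; A \<subseteq> level I n\<rbrakk> \<Longrightarrow> (\<Sum>w\<in>A. m w ^ DIM('a)) \<le> C"
proof -
  obtain B where B: "0 < B" "\<And>x y. \<lbrakk>x \<in> X; y \<in> X\<rbrakk> \<Longrightarrow> dist x y \<le> B" using X_bounded by blast
  obtain p where p: "p \<in> X" by (rule X_two_points)
  show ?thesis
  proof (rule that[of "L ^ DIM('a) * B ^ DIM('a)"])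
    fix A n assume A: "finite A" "A \<subseteq> level I n"
    have AI: "w \<in> lists I" if "w \<in> A" for w using that A level_subset_lists by blast
    then obtain z where z: "\<And>w. w \<in> A \<Longrightarrow> ball (z w) (m w / L) \<subseteq> word_map S w ` U"
      using inner_ball by metis
    have "(\<Sum>w\<in>A. (m w / L) ^ DIM('a)) \<le> B ^ DIM('a)"
    proof (rule sum_disjoint_balls_le[where G = "\<lambda>w. word_map S w ` U" and p = p and z = z])
      fix w assume "w \<in> A"
      thus "word_map S w ` U \<subseteq> cball p B" "0 \<le> m w / L"
        using word_into_U[of w] AI[of w] U_subset B(2)[OF p] m_pos[of w] L by (auto simp: subset_iff simp del: in_lists_conv_set)
    next
      fix u v assume uv: "u \<in> A" "v \<in> A" "u \<noteq> v"
      hence "length u = n" "length v = n" using A by (auto simp: level_def)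
      hence "\<nexists>z. v = u @ z \<or> u = v @ z" using uv(3) by auto
      thus "word_map S u ` U \<inter> word_map S v ` U = {}"
        using words_disjoint[OF AI[OF uv(1)] AI[OF uv(2)]] by blast
    qed (use A B z in auto)
    thus "(\<Sum>w\<in>A. m w ^ DIM('a)) \<le> L ^ DIM('a) * B ^ DIM('a)"
      using L by (simp add: power_divide sum_divide_distrib[symmetric] field_simps)
  qed
qed

text \<open>Raising the exponent by \<open>e\<close> gains the factor
  \<open>m w powr e \<le> L powr e * q ^ n\<close> at level \<open>n\<close>, so uniformly bounded
  level sums turn into a geometric series.\<close>

lemma summable_if_level_sums_bounded:
  assumes bound: "\<And>n A. \<lbrakk>finite A; A \<subseteq> level I n\<rbrakk> \<Longrightarrow> (\<Sum>w\<in>A. m w powr s') \<le> C" and "s' < s"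
  shows "(\<lambda>w. m w powr s) summable_on lists I"
proof (rule nonneg_bdd_above_summable_on)
  define e where "e = s - s'"
  have e: "e > 0" using \<open>s' < s\<close> by (simp add: e_def)
  define q where "q = c powr e"
  have "c powr e < 1 powr e" by (rule powr_less_mono2) (use c e in auto)
  hence q: "0 \<le> q" "q < 1" by (simp_all add: q_def)
  have q_pow: "(c ^ n) powr e = q ^ n" for n
  proof -
    have "(c ^ n) powr e = c powr (real n * e)" using c by (simp add: powr_powr flip: powr_realpow)
    also have "\<dots> = c powr (e * real n)" by (simp only: mult.commute)
    also have "\<dots> = q powr real n" by (simp only: q_def powr_powr)
    also have "\<dots> = q ^ n" using c by (intro powr_realpow) (simp add: q_def)
    finally show ?thesis .
  qed
  have C: "0 \<le> C" using bound[of "{}" 0] by simp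
  show "bdd_above (sum (\<lambda>w. m w powr s) ` {F. F \<subseteq> lists I \<and> finite F})"
  proof (rule bdd_aboveI2)
    fix F assume "F \<in> {F. F \<subseteq> lists I \<and> finite F}"
    hence F: "F \<subseteq> lists I" "finite F" by auto
    define N where "N = Suc (Max (length ` F \<union> {0}))"
    have N: "length ` F \<subseteq> {..<N}" using F by (auto simp: N_def less_Suc_eq_le)
    have "(\<Sum>w\<in>F. m w powr s) = (\<Sum>n<N. \<Sum>w\<in>{w\<in>F. length w = n}. m w powr s)"
      using F N by (intro sum.group[symmetric]) auto
    also have "\<dots> \<le> (\<Sum>n<N. C * L powr e * q ^ n)"
    proof (rule sum_mono)
      fix n
      have "(\<Sum>w\<in>{w\<in>F. length w = n}. m w powr s) \<le> (\<Sum>w\<in>{w\<in>F. length w = n}. m w powr s' * (L powr e * q ^ n))"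
      proof (rule sum_mono)
        fix w assume w: "w \<in> {w\<in>F. length w = n}"
        hence wI: "w \<in> lists I" using F by auto
        have "m w powr s = m w powr s' * m w powr e" by (simp add: e_def powr_add[symmetric])
        also have "\<dots> \<le> m w powr s' * (L * c ^ n) powr e"
          using m_le[OF wI] m_pos[OF wI] w e by (intro mult_left_mono powr_mono2) auto
        also have "(L * c ^ n) powr e = L powr e * q ^ n"
          using L c by (simp add: powr_mult q_pow)
        finally show "m w powr s \<le> m w powr s' * (L powr e * q ^ n)" .
      qed
      also have "\<dots> = (\<Sum>w\<in>{w\<in>F. length w = n}. m w powr s') * (L powr e * q ^ n)"
        by (simp add: sum_distrib_right)
      also have "\<dots> \<le> C * (L powr e * q ^ n)"
        using F q by (intro mult_right_mono bound[of _ n]) (auto simp: level_def)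
      finally show "(\<Sum>w\<in>{w\<in>F. length w = n}. m w powr s) \<le> C * L powr e * q ^ n" by simp
    qed
    also have "\<dots> = C * L powr e * (\<Sum>n<N. q ^ n)" by (simp add: sum_distrib_left)
    also have "\<dots> \<le> C * L powr e * (1 / (1 - q))"
    proof (intro mult_left_mono)
      have "(\<Sum>n<N. q ^ n) = (1 - q ^ N) / (1 - q)" using q by (simp add: sum_gp_strict)
      also have "\<dots> \<le> 1 / (1 - q)" using q by (intro divide_right_mono) auto
      finally show "(\<Sum>n<N. q ^ n) \<le> 1 / (1 - q)" .
    qed (use C in auto)
    finally show "(\<Sum>w\<in>F. m w powr s) \<le> C * L powr e * (1 / (1 - q))" .
  qed
qed simp

section \<open>The limit set and the fixed points\<close>

lemma limit_set_subset_level: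
  assumes "1 \<le> n"
  shows "limit_set X I S \<subseteq> (\<Union>w\<in>level I n. word_map S w ` X)"
proof
  fix x assume "x \<in> limit_set X I S"
  then obtain \<gamma> where \<gamma>: "range \<gamma> \<subseteq> I" "x \<in> word_map S (map \<gamma> [0..<n]) ` X"
    using assms by (auto simp: limit_set_def)
  moreover have "map \<gamma> [0..<n] \<in> level I n" using \<gamma> by (auto simp: level_def image_subset_iff)
  ultimately show "x \<in> (\<Union>w\<in>level I n. word_map S w ` X)" by blast
qed

lemma limit_set_subset: "limit_set X I S \<subseteq> X"
  using limit_set_subset_level[of 1] word_into level_subset_lists by fast

lemma word_limit_set:
  assumes "w \<in> lists I"
  shows "word_map S w ` limit_set X I S \<subseteq> limit_set X I S"
  using _ assms
proof (rule word_map_into)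
  fix i assume i: "i \<in> I"
  show "S i ` limit_set X I S \<subseteq> limit_set X I S"
  proof safe
    fix y assume y: "y \<in> limit_set X I S"
    then obtain \<gamma> where \<gamma>: "range \<gamma> \<subseteq> I" "\<And>n. 1 \<le> n \<Longrightarrow> y \<in> word_map S (map \<gamma> [0..<n]) ` X"
      by (auto simp: limit_set_def)
    define \<gamma>' where "\<gamma>' n = (case n of 0 \<Rightarrow> i | Suc n \<Rightarrow> \<gamma> n)" for n
    have "S i y \<in> word_map S (map \<gamma>' [0..<n]) ` X" if n: "1 \<le> n" for n
    proof -
      obtain k where k: "n = Suc k" using n by (cases n) auto
      have "map \<gamma>' [0..<n] = i # map \<gamma> [0..<k]"
        unfolding k by (rule nth_equalityI) (auto simp: \<gamma>'_def nth_Cons simp del: upt_Suc split: nat.splits)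
      \<comment> \<open>The definition of the limit set starts at level 1; for \<open>k = 0\<close>
        membership in \<open>X\<close> is used instead.\<close>
      moreover have "y \<in> word_map S (map \<gamma> [0..<k]) ` X"
        using \<gamma>(2)[of k] y limit_set_subset by (cases k) auto
      ultimately show ?thesis by auto
    qed
    moreover have "range \<gamma>' \<subseteq> I" using \<gamma> i by (auto simp: \<gamma>'_def image_subset_iff split: nat.splits)
    ultimately show "S i y \<in> limit_set X I S" by (auto simp: limit_set_def)
  qed
qed

lemma fixed_points_subset_limit_set: "fixed_points X I S \<subseteq> limit_set X I S"
proof
  fix x assume "x \<in> fixed_points X I S"
  then obtain i where i: "x \<in> X" "i \<in> I" "S i x = x" by (auto simp: fixed_points_def)
  have "word_map S (map (\<lambda>_. i) [0..<n]) x = x" for n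
    by (induction n) (use i in auto)
  hence "x \<in> word_map S (map (\<lambda>_. i) [0..<n]) ` X" for n using i by (metis imageI)
  thus "x \<in> limit_set X I S" using i by (auto simp: limit_set_def intro!: exI[of _ "\<lambda>_. i"])
qed

lemma fixed_point_exists:
  assumes "i \<in> I" obtains x where "x \<in> fixed_points X I S" "x \<in> S i ` X"
proof -
  have "\<exists>!x\<in>X. S i x = x"
    using compact_X X_two_points c S_into[OF assms] contraction[OF assms]
    by (intro Banach_fix[of X c]) (auto intro: compact_imp_complete)
  then obtain z where z: "z \<in> X" "S i z = z" by blast
  show ?thesis
  proof (rule that)
    show "z \<in> fixed_points X I S" using z assms by (auto simp: fixed_points_def)
    show "z \<in> S i ` X" using z by force
  qed
qed

text \<open>A convergent series has small sums outside some finite set \<open>F0\<close> of words. A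
  level beyond all words of \<open>F0\<close> covers the limit set by cylinders that are small in
  diameter and in total power sum.\<close>

lemma hausdorff_measure_limit_set_eq_0:
  assumes sum: "(\<lambda>w. m w powr s) summable_on lists I" and "0 \<le> s"
  shows "hausdorff_measure s (limit_set X I S) = 0"
proof -
  obtain B where B: "0 < B" "\<And>x y. \<lbrakk>x \<in> X; y \<in> X\<rbrakk> \<Longrightarrow> dist x y \<le> B" using X_bounded by blast
  obtain p where p: "p \<in> X" by (rule X_two_points)
  have *: "hausdorff_premeasure \<delta> s (limit_set X I S) \<le> 0 + ennreal \<epsilon>" if "\<delta> > 0" "\<epsilon> > 0" for \<delta> \<epsilon>
  proof -
    define D where "D = (L * B) powr s"
    have D: "D > 0" using L B by (simp add: D_def)
    obtain F0 where F0: "finite F0" "F0 \<subseteq> lists I"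
      "\<And>F. \<lbrakk>finite F; F \<subseteq> lists I; F \<inter> F0 = {}\<rbrakk> \<Longrightarrow> (\<Sum>w\<in>F. m w powr s) < \<epsilon> / D"
    proof -
      obtain a where "((\<lambda>w. m w powr s) has_sum a) (lists I)" using sum by (auto simp: summable_on_def)
      moreover have e: "\<epsilon> / D / 2 > 0" using \<open>\<epsilon> > 0\<close> D by simp
      ultimately obtain F0 where F0: "finite F0" "F0 \<subseteq> lists I"
        "\<And>F. \<lbrakk>finite F; F0 \<subseteq> F; F \<subseteq> lists I\<rbrakk> \<Longrightarrow> dist (\<Sum>w\<in>F. m w powr s) a < \<epsilon> / D / 2"
        unfolding has_sum_def tendsto_iff eventually_finite_subsets_at_top by metis
      show ?thesis
      proof (rule that[OF F0(1,2)])
        fix F assume F: "finite F" "F \<subseteq> lists I" "F \<inter> F0 = {}"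
        have "(\<Sum>w\<in>F \<union> F0. m w powr s) = (\<Sum>w\<in>F. m w powr s) + (\<Sum>w\<in>F0. m w powr s)"
          using F F0 by (intro sum.union_disjoint) auto
        thus "(\<Sum>w\<in>F. m w powr s) < \<epsilon> / D"
          using F0(3)[of "F \<union> F0"] F0(3)[of F0] F F0(1,2) by (simp add: dist_real_def)
      qed
    qed
    obtain n0 where n0: "c ^ n0 < \<delta> / B" using real_arch_pow_inv[of "\<delta> / B" c] c B(1) \<open>\<delta> > 0\<close> by auto
    define n where "n = Suc (max n0 (Max (length ` F0 \<union> {0})))"
    have n: "1 \<le> n" "n0 \<le> n" "level I n \<inter> F0 = {}"
    proof -
      have "length w < n" if "w \<in> F0" for w
        unfolding n_def less_Suc_eq_le using that F0(1) by (intro max.coboundedI2 Max_ge) auto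
      thus "level I n \<inter> F0 = {}" by (force simp: level_def)
    qed (auto simp: n_def)
    let ?W = "level I n"
    have cnt: "countable ?W"
      by (rule countable_subset[OF level_subset_lists countable_lists[OF countable_I]])
    define e where "e = to_nat_on ?W"
    have inj: "inj_on e ?W" unfolding e_def using cnt by (rule inj_on_to_nat_on)
    define V where "V k = (if k \<in> e ` ?W then word_map S (inv_into ?W e k) ` X else {})" for k
    have V_e: "V (e w) = word_map S w ` X" if "w \<in> ?W" for w
      using that inj by (simp add: V_def)
    have V_cases: "V k = {} \<or> (\<exists>w\<in>?W. k = e w)" for k by (auto simp: V_def)
    have bdd: "bounded (V k)" for k
      using V_cases[of k] V_e word_into level_subset_lists compact_imp_bounded[OF compact_X]
      by (metis bounded_empty bounded_subset subsetD)
    have diam: "diameter (word_map S w ` X) \<le> \<delta>" "diameter (word_map S w ` X) \<le> L * B * m w"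
      if "w \<in> ?W" for w
    proof -
      have w: "w \<in> lists I" "length w = n" using that by (auto simp: level_def)
      show "diameter (word_map S w ` X) \<le> \<delta>"
      proof (rule diameter_le)
        fix x' y' assume "x' \<in> word_map S w ` X" "y' \<in> word_map S w ` X"
        then obtain x y where xy: "x \<in> X" "y \<in> X" "x' = word_map S w x" "y' = word_map S w y" by auto
        have "dist x' y' \<le> c ^ n * dist x y" using word_contraction[OF w(1) xy(1,2)] xy w by simp
        also have "\<dots> \<le> c ^ n0 * B"
          using B xy c n by (intro mult_mono power_decreasing) auto
        also have "\<dots> \<le> \<delta>" using n0 B by (simp add: field_simps)
        finally show "norm (x' - y') \<le> \<delta>" by (simp add: dist_norm)
      qed (use that \<open>\<delta> > 0\<close> in auto)
      show "diameter (word_map S w ` X) \<le> L * B * m w"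
      proof (rule diameter_le)
        fix x' y' assume "x' \<in> word_map S w ` X" "y' \<in> word_map S w ` X"
        then obtain x y where xy: "x \<in> X" "y \<in> X" "x' = word_map S w x" "y' = word_map S w y" by auto
        have "dist x' y' \<le> L * m w * dist x y" using upper[OF w(1) xy(1,2)] xy by simp
        also have "\<dots> \<le> L * m w * B"
          using B xy L m_pos[OF w(1)] by (intro mult_left_mono) auto
        finally show "norm (x' - y') \<le> L * B * m w" by (simp add: dist_norm mult_ac)
      qed (use B L m_pos[OF w(1)] in auto)
    qed
    have pow: "diameter_pow s (V (e w)) \<le> D * m w powr s" if "w \<in> ?W" for w
    proof -
      have w: "w \<in> lists I" using that by (simp add: level_def)
      have ne: "V (e w) = word_map S w ` X" "word_map S w ` X \<noteq> {}" using V_e[OF that] p by auto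
      show ?thesis
      proof (cases "s = 0")
        \<comment> \<open>At exponent 0 every cylinder contributes 1, and so does
          \<open>m w powr 0\<close>, as \<open>m w\<close> is positive.\<close>
        case True thus ?thesis using ne L B(1) m_pos[OF w] by (simp add: diameter_pow_def D_def)
      next
        case False
        have "bounded (word_map S w ` X)"
          using word_into[OF w] compact_imp_bounded[OF compact_X] bounded_subset by blast
        hence "diameter (word_map S w ` X) powr s \<le> (L * B * m w) powr s"
          using diam(2)[OF that] assms(2) by (intro powr_mono2 diameter_ge_0)
        also have "\<dots> = D * m w powr s" using L B(1) m_pos[OF w] by (simp add: D_def powr_mult)
        finally show ?thesis using False ne by (simp add: diameter_pow_def)
      qed
    qed
    have nonneg: "0 \<le> diameter_pow s A" for A :: "'a set" by (simp add: diameter_pow_def)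
    have "(\<Sum>k<N. ennreal (diameter_pow s (V k))) \<le> ennreal \<epsilon>" for N
    proof -
      let ?F = "{w\<in>?W. e w < N}"
      have fin: "finite ?F"
      proof (rule finite_imageD)
        show "finite (e ` ?F)" by (rule finite_subset[of _ "{..<N}"]) auto
        show "inj_on e ?F" using inj by (rule inj_on_subset) auto
      qed
      have "(\<Sum>k<N. diameter_pow s (V k)) = (\<Sum>k\<in>e ` ?F. diameter_pow s (V k))"
        using V_cases by (intro sum.mono_neutral_right) (auto simp: diameter_pow_def)
      also have "\<dots> = (\<Sum>w\<in>?F. diameter_pow s (V (e w)))"
        using inj by (intro sum.reindex_cong[of e]) (auto simp: inj_on_def)
      also have "\<dots> \<le> (\<Sum>w\<in>?F. D * m w powr s)" using pow by (intro sum_mono) auto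
      also have "\<dots> = D * (\<Sum>w\<in>?F. m w powr s)" by (simp add: sum_distrib_left)
      also have "\<dots> \<le> D * (\<epsilon> / D)"
      proof (intro mult_left_mono less_imp_le[OF F0(3)])
        show "?F \<subseteq> lists I" "?F \<inter> F0 = {}" using n(3) level_subset_lists[of I n] by blast+
      qed (use D fin in auto)
      also have "\<dots> = \<epsilon>" using D by simp
      finally show ?thesis using nonneg by (simp add: sum_ennreal ennreal_leI)
    qed
    hence "(\<Sum>k. ennreal (diameter_pow s (V k))) \<le> ennreal \<epsilon>"
      by (intro suminf_le_const) auto
    moreover have "hausdorff_premeasure \<delta> s (limit_set X I S) \<le> (\<Sum>k. ennreal (diameter_pow s (V k)))"
      unfolding hausdorff_premeasure_def
    proof (rule INF_lower, safe)
      fix x assume "x \<in> limit_set X I S"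
      then obtain w where "w \<in> ?W" "x \<in> word_map S w ` X" using limit_set_subset_level[OF n(1)] by blast
      thus "x \<in> (\<Union>k. V k)" using V_e by blast
    next
      fix k show "bounded (V k)" by (rule bdd)
      show "diameter (V k) \<le> \<delta>" using V_cases[of k] diam V_e \<open>\<delta> > 0\<close> by fastforce
    qed
    ultimately show ?thesis by simp
  qed
  have "hausdorff_premeasure \<delta> s (limit_set X I S) \<le> 0" if "\<delta> > 0" for \<delta>
  proof (rule ennreal_le_epsilon)
    fix e :: real assume "0 < e"
    thus "hausdorff_premeasure \<delta> s (limit_set X I S) \<le> 0 + ennreal e" using that * by blast
  qed
  hence "hausdorff_measure s (limit_set X I S) \<le> 0"
    unfolding hausdorff_measure_def by (intro SUP_least) simp
  thus ?thesis by simp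
qed

end

section \<open>Finite systems\<close>

lemma sum_UN_le:
  fixes f :: "'b \<Rightarrow> 'c::ordered_ab_group_add"
  assumes "finite J" "\<And>j. j \<in> J \<Longrightarrow> finite (A j)" "\<And>x. 0 \<le> f x"
  shows "sum f (\<Union>j\<in>J. A j) \<le> (\<Sum>j\<in>J. sum f (A j))"
  using assms(1,2)
proof (induction J)
  case (insert j J)
  have "0 \<le> sum f (A j \<inter> (\<Union>j\<in>J. A j))" using assms(3) by (rule sum_nonneg)
  moreover have "sum f (A j \<union> (\<Union>j\<in>J. A j)) + sum f (A j \<inter> (\<Union>j\<in>J. A j)) = sum f (A j) + sum f (\<Union>j\<in>J. A j)"
    using insert by (intro sum.union_inter) auto
  ultimately have "sum f (A j \<union> (\<Union>j\<in>J. A j)) \<le> sum f (A j) + sum f (\<Union>j\<in>J. A j)"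
    by (metis add_increasing2 order_refl)
  also have "\<dots> \<le> sum f (A j) + (\<Sum>j\<in>J. sum f (A j))"
    using insert by (intro add_left_mono) auto
  finally show ?case using insert by simp
qed simp

text \<open>The hypothesis on \<open>s\<close> makes the normalised weights \<open>m [i] powr s / \<sigma>\<close> at most
  \<open>m [i] powr s\<close>; their products are the cylinder masses of a Bernoulli measure, which is only
  used on words of a fixed long length.\<close>

locale finite_ifs_geometry = ifs_geometry +
  fixes s :: real
  assumes finite_I: "finite I" and s_nonneg: "0 \<le> s" and sum_ge_1: "1 \<le> (\<Sum>i\<in>I. m [i] powr s)"
begin

definition \<sigma> :: real where "\<sigma> = (\<Sum>i\<in>I. m [i] powr s)"

definition mass :: "'b list \<Rightarrow> real" where "mass w = (\<Prod>i\<leftarrow>w. m [i] powr s / \<sigma>)"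

lemma I_nonempty: "I \<noteq> {}"
  using sum_ge_1 by auto

lemma \<sigma>: "1 \<le> \<sigma>"
  using sum_ge_1 by (simp add: \<sigma>_def)

lemma mass_nonneg: "0 \<le> mass w"
  using \<sigma> by (auto simp: mass_def intro!: prod_list_nonneg)

lemma mass_append: "mass (u @ v) = mass u * mass v"
  by (simp add: mass_def)

text \<open>Super-multiplicativity has the right direction: the product of the letter ratios is at
  most the ratio of the word.\<close>

lemma mass_le:
  assumes "w \<in> lists I" shows "mass w \<le> m w powr s"
  using assms
proof induction
  case (Cons i w)
  have pos: "0 < m [i]" "0 < m w" using Cons m_pos by auto
  have "mass (i # w) = m [i] powr s / \<sigma> * mass w" by (simp add: mass_def)
  also have "\<dots> \<le> m [i] powr s * m w powr s"
  proof (rule mult_mono)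
    have "m [i] powr s * 1 \<le> m [i] powr s * \<sigma>" using \<sigma> by (intro mult_left_mono) auto
    thus "m [i] powr s / \<sigma> \<le> m [i] powr s" using \<sigma> by (simp add: divide_le_eq)
  qed (use Cons mass_nonneg in auto)
  also have "\<dots> = (m [i] * m w) powr s" using pos by (simp add: powr_mult)
  also have "\<dots> \<le> m (i # w) powr s"
    using m_append[of "[i]" w] Cons pos s_nonneg by (intro powr_mono2) auto
  finally show ?case .
qed (simp add: mass_def m_Nil)

lemma sum_mass_level: "(\<Sum>w\<in>level I n. mass w) = 1"
proof (induction n)
  case (Suc n)
  have "(\<Sum>w\<in>level I (Suc n). mass w) = (\<Sum>(i, w)\<in>I \<times> level I n. mass (i # w))"
    unfolding level_Suc by (subst sum.reindex) (auto simp: inj_on_def case_prod_unfold)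
  also have "\<dots> = (\<Sum>(i, w)\<in>I \<times> level I n. m [i] powr s / \<sigma> * mass w)"
    by (simp add: mass_def)
  also have "\<dots> = (\<Sum>i\<in>I. m [i] powr s / \<sigma>) * (\<Sum>w\<in>level I n. mass w)"
    by (simp add: sum_product sum.cartesian_product)
  also have "(\<Sum>i\<in>I. m [i] powr s / \<sigma>) = 1"
    using \<sigma> by (simp add: sum_divide_distrib[symmetric] \<sigma>_def)
  finally show ?case using Suc by simp
qed (simp add: mass_def)

text \<open>The product structure distributes the mass of \<open>u\<close> among its extensions. A
  word longer than \<open>N\<close> has none in the level, which is why this is an
  inequality.\<close>

lemma sum_mass_extensions:
  assumes "u \<in> lists I"
  shows "(\<Sum>w\<in>{w\<in>level I N. take (length u) w = u}. mass w) \<le> mass u"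
proof (cases "length u \<le> N")
  case True
  have "{w\<in>level I N. take (length u) w = u} = (@) u ` level I (N - length u)"
  proof (intro equalityI subsetI)
    fix w assume w: "w \<in> {w\<in>level I N. take (length u) w = u}"
    hence "w = u @ drop (length u) w" using append_take_drop_id[of "length u" w] by simp
    moreover have "drop (length u) w \<in> level I (N - length u)"
      using w by (auto simp: level_def dest: in_set_dropD)
    ultimately show "w \<in> (@) u ` level I (N - length u)" by blast
  qed (use assms True in \<open>auto simp: level_def\<close>)
  hence "(\<Sum>w\<in>{w\<in>level I N. take (length u) w = u}. mass w) = (\<Sum>v\<in>level I (N - length u). mass u * mass v)"
    by (simp add: sum.reindex inj_on_def mass_append)
  also have "\<dots> = mass u" by (simp add: sum_distrib_left[symmetric] sum_mass_level)
  finally show ?thesis by simp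
next
  case False
  have "length w \<noteq> N" if "take (length u) w = u" for w
    using False arg_cong[OF that, of length] by auto
  hence "{w\<in>level I N. take (length u) w = u} = {}" by (auto simp: level_def)
  thus ?thesis using mass_nonneg by (simp only: sum.empty)
qed

section \<open>Stopping words of ratio about \<delta>\<close>

definition cut_length :: "real \<Rightarrow> 'b list \<Rightarrow> nat" where
  "cut_length \<delta> w = (LEAST k. m (take k w) \<le> \<delta>)"

definition cut :: "real \<Rightarrow> 'b list \<Rightarrow> 'b list" where
  "cut \<delta> w = take (cut_length \<delta> w) w"

text \<open>Inserting 1 keeps the value at most 1, which the empty word needs in
  \<open>cut_properties\<close>.\<close>

definition m_min :: real where "m_min = Min (insert 1 ((\<lambda>i. m [i]) ` I))"

lemma m_min: "0 < m_min" "m_min \<le> 1" "i \<in> I \<Longrightarrow> m_min \<le> m [i]"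
  using finite_I m_pos by (auto simp: m_min_def)

context
  fixes \<delta> N
  assumes \<delta>: "0 < \<delta>" "\<delta> \<le> 1" and deep: "\<forall>w\<in>level I N. m w \<le> \<delta>"
begin

text \<open>Before its last letter the cut still has ratio above \<delta>, and by
  super-multiplicativity that letter costs at most the factor \<open>m_min\<close>. This lower bound
  is where the finite alphabet matters.\<close>

lemma cut_properties:
  assumes w: "w \<in> level I N"
  shows "cut \<delta> w \<in> lists I" "length (cut \<delta> w) = cut_length \<delta> w" "cut_length \<delta> w \<le> N"
    "m (cut \<delta> w) \<le> \<delta>" "\<delta> * m_min \<le> m (cut \<delta> w)"
proof -
  have wl: "w \<in> lists I" "length w = N" using w by (auto simp: level_def)
  have takeI: "take k w \<in> lists I" for k using wl by (auto dest: in_set_takeD)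
  have N: "m (take N w) \<le> \<delta>" using bspec[OF deep w] wl by simp
  show "cut \<delta> w \<in> lists I" by (simp add: cut_def takeI)
  show le: "cut_length \<delta> w \<le> N" unfolding cut_length_def using N by (rule Least_le)
  show "length (cut \<delta> w) = cut_length \<delta> w" using le wl by (simp add: cut_def)
  show "m (cut \<delta> w) \<le> \<delta>" unfolding cut_def cut_length_def using N by (rule LeastI)
  show "\<delta> * m_min \<le> m (cut \<delta> w)"
  proof (cases "cut_length \<delta> w")
    case 0
    have "\<delta> * m_min \<le> 1 * 1" using \<delta> m_min by (intro mult_mono) auto
    thus ?thesis using 0 by (simp add: cut_def m_Nil)
  next
    case (Suc k)
    hence k: "k < length w" using le wl by simp
    have "\<not> m (take k w) \<le> \<delta>" using Suc not_less_Least[of k "\<lambda>k. m (take k w) \<le> \<delta>"]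
      by (simp add: cut_length_def)
    moreover have wk: "w ! k \<in> I" using k wl by auto
    ultimately have "\<delta> * m_min \<le> m (take k w) * m [w ! k]"
      using \<delta> m_min by (intro mult_mono) auto
    also have "\<dots> \<le> m (take k w @ [w ! k])" using takeI wk by (intro m_append) auto
    also have "take k w @ [w ! k] = cut \<delta> w" using k by (simp add: cut_def Suc take_Suc_conv_app_nth)
    finally show ?thesis .
  qed
qed

text \<open>A proper extension would pass through a prefix whose ratio is already at most \<delta>,
  against the minimality of its own cut.\<close>

lemma cut_incomparable:
  assumes w: "w \<in> level I N" "w' \<in> level I N" "cut \<delta> w' = cut \<delta> w @ z"
  shows "z = []"
proof (rule ccontr)
  assume z: "z \<noteq> []"
  let ?k = "cut_length \<delta> w"
  have len: "cut_length \<delta> w' = ?k + length z"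
    using assms(3) cut_properties(2)[OF w(1)] cut_properties(2)[OF w(2)] by (metis length_append)
  have "take ?k w' = take ?k (cut \<delta> w')" by (simp add: cut_def len)
  also have "\<dots> = cut \<delta> w" using assms(3) cut_properties(2)[OF w(1)] by simp
  finally have "m (take ?k w') \<le> \<delta>" using cut_properties(4)[OF w(1)] by simp
  hence "cut_length \<delta> w' \<le> ?k" unfolding cut_length_def[of \<delta> w'] by (rule Least_le)
  thus False using len z by simp
qed

lemma cuts_disjoint:
  assumes "u \<in> cut \<delta> ` level I N" "v \<in> cut \<delta> ` level I N" "u \<noteq> v"
  shows "word_map S u ` U \<inter> word_map S v ` U = {}"
proof -
  obtain w w' where w: "w \<in> level I N" "u = cut \<delta> w" "w' \<in> level I N" "v = cut \<delta> w'"
    using assms(1,2) by auto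
  have "\<nexists>z. v = u @ z \<or> u = v @ z"
  proof
    assume "\<exists>z. v = u @ z \<or> u = v @ z"
    then obtain z where z: "v = u @ z \<or> u = v @ z" by blast
    have "z = []" using z unfolding w(2,4)
      by (elim disjE) (rule cut_incomparable[OF w(1,3)] cut_incomparable[OF w(3,1)]; assumption)+
    thus False using z assms(3) by simp
  qed
  moreover have "u \<in> lists I" "v \<in> lists I" unfolding w using w cut_properties(1) by simp_all
  ultimately show ?thesis by (intro words_disjoint)
qed

text \<open>Words with cut \<open>u\<close> extend \<open>u\<close>, so together they carry at most
  \<open>mass u\<close>, and \<open>mass u \<le> m u powr s \<le> \<delta> powr s\<close>.\<close>

lemma sum_mass_cut_le:
  assumes "Z \<subseteq> cut \<delta> ` level I N"
  shows "(\<Sum>w\<in>{w\<in>level I N. cut \<delta> w \<in> Z}. mass w) \<le> real (card Z) * \<delta> powr s"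
proof -
  let ?W = "{w\<in>level I N. cut \<delta> w \<in> Z}"
  have fin: "finite Z" "finite ?W"
    using finite_subset[OF assms] finite_I by simp_all
  have ZI: "u \<in> lists I" "m u \<le> \<delta>" if u: "u \<in> Z" for u
  proof -
    obtain w where "w \<in> level I N" "u = cut \<delta> w" using u assms by auto
    thus "u \<in> lists I" "m u \<le> \<delta>" using cut_properties(1,4) by simp_all
  qed
  have "(\<Sum>w\<in>?W. mass w) = (\<Sum>u\<in>Z. \<Sum>w\<in>{w\<in>?W. cut \<delta> w = u}. mass w)"
    using fin by (intro sum.group[symmetric]) auto
  also have "\<dots> \<le> (\<Sum>u\<in>Z. \<Sum>w\<in>{w\<in>level I N. take (length u) w = u}. mass w)"
  proof (intro sum_mono sum_mono2)
    fix u
    show "{w\<in>?W. cut \<delta> w = u} \<subseteq> {w\<in>level I N. take (length u) w = u}"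
      using cut_properties(2) by (auto simp: cut_def)
  qed (use finite_I mass_nonneg in auto)
  also have "\<dots> \<le> (\<Sum>u\<in>Z. mass u)" using ZI sum_mass_extensions by (intro sum_mono) auto
  also have "\<dots> \<le> (\<Sum>u\<in>Z. \<delta> powr s)"
  proof (rule sum_mono)
    fix u assume u: "u \<in> Z"
    have "mass u \<le> m u powr s" using mass_le ZI u by blast
    also have "\<dots> \<le> \<delta> powr s" using ZI[OF u] s_nonneg m_pos[of u] by (intro powr_mono2) auto
    finally show "mass u \<le> \<delta> powr s" .
  qed
  finally show ?thesis by simp
qed

lemma card_cuts_ge: "1 \<le> real (card (cut \<delta> ` level I N)) * \<delta> powr s"
  using sum_mass_cut_le[OF order_refl] sum_mass_level[of N]
  by (simp add: Collect_mem_eq[of "level I N"] cong: conj_cong)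

end

text \<open>Stopping words map \<open>U\<close> to disjoint sets that each contain a ball of radius
  \<open>\<delta> * m_min / L\<close>. Those whose cylinder meets \<open>ball p \<delta>\<close> lie
  within \<open>(1 + L * B) * \<delta>\<close> of \<open>p\<close>, so \<kappa> is the quotient of
  the two radii and depends on neither \<delta>, the level nor the ball.\<close>

lemma card_cuts_meeting_ball_le:
  "\<exists>M::real. 1 \<le> M \<and> (\<forall>\<delta> N p. 0 < \<delta> \<longrightarrow> \<delta> \<le> 1 \<longrightarrow> (\<forall>w\<in>level I N. m w \<le> \<delta>) \<longrightarrow>
      real (card {u \<in> cut \<delta> ` level I N. word_map S u ` X \<inter> ball p \<delta> \<noteq> {}}) \<le> M)"
proof -
  obtain B where B: "0 < B" "\<And>x y. \<lbrakk>x \<in> X; y \<in> X\<rbrakk> \<Longrightarrow> dist x y \<le> B" using X_bounded by blast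
  define \<kappa> where "\<kappa> = (1 + L * B) * L / m_min"
  have \<kappa>: "0 \<le> \<kappa>" "\<And>\<delta>. \<kappa> * (\<delta> * m_min / L) = (1 + L * B) * \<delta>"
    using L B m_min by (auto simp: \<kappa>_def)
  show ?thesis
  proof (intro exI[of _ "max 1 (\<kappa> ^ DIM('a))"] conjI allI impI)
    fix \<delta> N p
    assume \<delta>: "0 < \<delta>" "\<delta> \<le> 1" and deep: "\<forall>w\<in>level I N. m w \<le> \<delta>"
    note cp = cut_properties[OF \<delta> deep]
    let ?Z = "{u \<in> cut \<delta> ` level I N. word_map S u ` X \<inter> ball p \<delta> \<noteq> {}}"
    have Z: "u \<in> lists I" "m u \<le> \<delta>" "\<delta> * m_min \<le> m u" if u: "u \<in> ?Z" for u
    proof -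
      obtain w where "w \<in> level I N" "u = cut \<delta> w" using u by auto
      thus "u \<in> lists I" "m u \<le> \<delta>" "\<delta> * m_min \<le> m u" using cp(1,4,5) by simp_all
    qed
    have "\<forall>u\<in>?Z. \<exists>z. ball z (m u / L) \<subseteq> word_map S u ` U"
    proof
      fix u assume "u \<in> ?Z"
      thus "\<exists>z. ball z (m u / L) \<subseteq> word_map S u ` U" by (intro inner_ball Z(1))
    qed
    from bchoice[OF this] obtain z where
      z: "\<And>u. u \<in> ?Z \<Longrightarrow> ball (z u) (m u / L) \<subseteq> word_map S u ` U" by blast
    have "real (card ?Z) \<le> \<kappa> ^ DIM('a)"
    proof (rule card_disjoint_balls_le[where \<beta> = "\<delta> * m_min / L" and G = "\<lambda>u. word_map S u ` U" and z = z and p = p])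
      show "finite ?Z" using finite_I by simp
      show "0 \<le> \<kappa>" "0 < \<delta> * m_min / L" using \<kappa> \<delta> m_min L by auto
    next
      fix u assume u: "u \<in> ?Z"
      have "\<delta> * m_min / L \<le> m u / L" using Z[OF u] L by (intro divide_right_mono) auto
      thus "ball (z u) (\<delta> * m_min / L) \<subseteq> word_map S u ` U" using z[OF u] by force
      obtain y where y: "y \<in> X" "dist p (word_map S u y) < \<delta>" using u by auto
      show "word_map S u ` U \<subseteq> cball p (\<kappa> * (\<delta> * m_min / L))"
      proof
        fix x' assume "x' \<in> word_map S u ` U"
        then obtain x where x: "x \<in> X" "x' = word_map S u x" using U_subset by auto
        have "dist (word_map S u y) x' \<le> L * m u * dist y x" using upper Z(1)[OF u] x y by simp
        also have "\<dots> \<le> L * \<delta> * B"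
          using Z[OF u] B x y L m_pos[OF Z(1)[OF u]] \<delta> by (intro mult_mono) auto
        finally have "dist p x' \<le> \<delta> + L * \<delta> * B"
          using y dist_triangle[of p x' "word_map S u y"] by simp
        thus "x' \<in> cball p (\<kappa> * (\<delta> * m_min / L))"
          unfolding \<kappa>(2) mem_cball by (simp add: algebra_simps)
      qed
    next
      fix u v assume uv: "u \<in> ?Z" "v \<in> ?Z" "u \<noteq> v"
      hence "u \<in> cut \<delta> ` level I N" "v \<in> cut \<delta> ` level I N" by simp_all
      thus "word_map S u ` U \<inter> word_map S v ` U = {}"
        using uv(3) by (rule cuts_disjoint[OF \<delta> deep])
    qed
    thus "real (card ?Z) \<le> max 1 (\<kappa> ^ DIM('a))" by simp
  qed simp
qed

text \<open>The mass distribution principle: the total mass 1 is spread over the balls, and a ball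
  of radius \<open>r j\<close> meets at most \<open>M\<close> stopping words of that scale, each of
  mass at most \<open>r j powr s\<close>.\<close>

lemma sum_radii_of_finite_cover_ge:
  "\<exists>M\<ge>1. \<forall>N (J :: 'j set) p r. finite J \<longrightarrow> (\<forall>j\<in>J. 0 < r j) \<longrightarrow>
      (\<forall>w\<in>level I N. word_map S w ` X \<subseteq> (\<Union>j\<in>J. ball (p j) (r j))) \<longrightarrow>
      1 \<le> M * (\<Sum>j\<in>J. r j powr s)"
proof -
  from card_cuts_meeting_ball_le obtain M :: real where
    "1 \<le> M \<and> (\<forall>\<delta> N p. 0 < \<delta> \<longrightarrow> \<delta> \<le> 1 \<longrightarrow> (\<forall>w\<in>level I N. m w \<le> \<delta>) \<longrightarrow>
      real (card {u \<in> cut \<delta> ` level I N. word_map S u ` X \<inter> ball p \<delta> \<noteq> {}}) \<le> M)" ..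
  note M = conjunct1[OF this] conjunct2[OF this]
  obtain x0 where x0: "x0 \<in> X" by (rule X_two_points)
  show ?thesis
  proof (intro exI[of _ M] conjI allI impI M(1))
    fix N and J :: "'j set" and p r
    assume J: "finite J" and r: "\<forall>j\<in>J. 0 < r j"
      and cover: "\<forall>w\<in>level I N. word_map S w ` X \<subseteq> (\<Union>j\<in>J. ball (p j) (r j))"
    show "1 \<le> M * (\<Sum>j\<in>J. r j powr s)"
    proof (cases "\<exists>j\<in>J. 1 < r j")
      \<comment> \<open>A radius above 1 settles the claim alone, so stopping words are only needed
        at scales up to 1.\<close>
      case True
      then obtain j where j: "j \<in> J" "1 < r j" by auto
      have "1 \<le> r j powr s" using j s_nonneg by (intro ge_one_powr_ge_zero) auto
      also have "\<dots> \<le> (\<Sum>j\<in>J. r j powr s)" using j J by (intro member_le_sum) auto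
      finally have "1 * 1 \<le> M * (\<Sum>j\<in>J. r j powr s)" using M by (intro mult_mono) auto
      thus ?thesis by simp
    next
      case False
      \<comment> \<open>All balls are tested on one level, deep enough for the smallest radius,
        although each ball cuts the words at its own scale.\<close>
      define \<delta> where "\<delta> = Min (insert 1 (r ` J))"
      have "0 < \<delta>" using J r by (auto simp: \<delta>_def)
      then obtain N1 where N1: "\<And>w. \<lbrakk>w \<in> lists I; N1 \<le> length w\<rbrakk> \<Longrightarrow> m w \<le> \<delta>" using m_small by blast
      define N' where "N' = max N N1"
      have \<delta>_le: "\<delta> \<le> r j" if "j \<in> J" for j using J that by (simp add: \<delta>_def)
      have deep: "\<forall>w\<in>level I N'. m w \<le> r j" if "j \<in> J" for j
      proof
        fix w assume "w \<in> level I N'"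
        hence "m w \<le> \<delta>" using N1[of w] by (simp add: level_def N'_def)
        thus "m w \<le> r j" using \<delta>_le[OF that] by simp
      qed
      have W: "w \<in> lists I" "take N w \<in> level I N" if "w \<in> level I N'" for w
        using that by (auto simp: level_def N'_def dest: in_set_takeD)
      let ?Q = "\<lambda>j. {w\<in>level I N'. word_map S w ` X \<inter> ball (p j) (r j) \<noteq> {}}"
      have "level I N' \<subseteq> (\<Union>j\<in>J. ?Q j)"
      proof
        fix w assume w: "w \<in> level I N'"
        have "word_map S w ` X = word_map S (take N w @ drop N w) ` X" by simp
        also have "\<dots> \<subseteq> word_map S (take N w) ` X"
          using W[OF w] by (intro word_append_subset) (auto dest: in_set_dropD in_set_takeD)
        also have "\<dots> \<subseteq> (\<Union>j\<in>J. ball (p j) (r j))" by (rule bspec[OF cover W(2)[OF w]])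
        finally have "word_map S w x0 \<in> (\<Union>j\<in>J. ball (p j) (r j))" using x0 by blast
        thus "w \<in> (\<Union>j\<in>J. ?Q j)" using x0 w by blast
      qed
      hence "(\<Sum>w\<in>level I N'. mass w) \<le> (\<Sum>w\<in>(\<Union>j\<in>J. ?Q j). mass w)"
        using finite_I J mass_nonneg by (intro sum_mono2) auto
      also have "\<dots> \<le> (\<Sum>j\<in>J. \<Sum>w\<in>?Q j. mass w)"
        using finite_I J mass_nonneg by (intro sum_UN_le) auto
      also have "\<dots> \<le> (\<Sum>j\<in>J. M * r j powr s)"
      proof (rule sum_mono)
        fix j assume j: "j \<in> J"
        have rj: "0 < r j" "r j \<le> 1" using r False j by auto
        note dj = deep[OF j]
        let ?Z = "{u \<in> cut (r j) ` level I N'. word_map S u ` X \<inter> ball (p j) (r j) \<noteq> {}}"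
        have "(\<Sum>w\<in>?Q j. mass w) \<le> (\<Sum>w\<in>{w\<in>level I N'. cut (r j) w \<in> ?Z}. mass w)"
        proof (rule sum_mono2)
          show "?Q j \<subseteq> {w\<in>level I N'. cut (r j) w \<in> ?Z}"
          proof
            fix w assume w: "w \<in> ?Q j"
            let ?k = "cut_length (r j) w"
            have "word_map S w ` X = word_map S (take ?k w @ drop ?k w) ` X" by simp
            also have "\<dots> \<subseteq> word_map S (cut (r j) w) ` X"
              unfolding cut_def using W(1)[of w] w
              by (intro word_append_subset) (auto dest: in_set_dropD in_set_takeD)
            finally show "w \<in> {w\<in>level I N'. cut (r j) w \<in> ?Z}" using w by blast
          qed
        qed (use finite_I mass_nonneg in auto)
        also have "\<dots> \<le> real (card ?Z) * r j powr s"
          by (rule sum_mass_cut_le[OF rj dj]) auto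
        also have "\<dots> \<le> M * r j powr s" using M(2)[rule_format, OF rj bspec[OF dj]] by (intro mult_right_mono) auto
        finally show "(\<Sum>w\<in>?Q j. mass w) \<le> M * r j powr s" .
      qed
      finally show ?thesis by (simp add: sum_mass_level sum_distrib_left)
    qed
  qed
qed

text \<open>A Koenig type argument: if no level is finitely covered, then descending through children
  with the same property leads to a point of the limit set that is not covered.\<close>

lemma open_cover_level_finite:
  assumes op: "\<And>k. open (W k)" and cover: "limit_set X I S \<subseteq> (\<Union>k. W k)"
  shows "\<exists>J N. finite J \<and> (\<forall>w\<in>level I N. word_map S w ` X \<subseteq> (\<Union>k\<in>J. W k))"
proof (rule ccontr)
  assume n: "\<not> ?thesis"
  define covers where "covers v J N \<longleftrightarrow>
    (\<forall>w\<in>level I N. word_map S (v @ w) ` X \<subseteq> (\<Union>k\<in>J. W k))" for v J N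
  define bad where "bad v \<longleftrightarrow> (\<forall>J N. finite J \<longrightarrow> \<not> covers v J N)" for v
  have "bad []"
    unfolding bad_def
  proof (intro allI impI notI)
    fix J N assume "finite J" "covers [] J N"
    thus False using n unfolding covers_def append_Nil by blast
  qed
  have step: "\<exists>i\<in>I. bad (v @ [i])" if v: "v \<in> lists I" "bad v" for v
  proof (rule ccontr)
    assume "\<not> ?thesis"
    hence "\<forall>i\<in>I. \<exists>J N. finite J \<and> covers (v @ [i]) J N"
      unfolding bad_def by blast
    then obtain J N where JN: "\<And>i. i \<in> I \<Longrightarrow> finite (J i)" "\<And>i. i \<in> I \<Longrightarrow> covers (v @ [i]) (J i) (N i)"
      by metis
    \<comment> \<open>Finitely many letters have a common depth \<open>K\<close>; the letter itself
      adds one level below \<open>v\<close>.\<close>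
    define K where "K = Max (N ` I)"
    have K: "N i \<le> K" if "i \<in> I" for i using that finite_I by (simp add: K_def)
    have "word_map S (v @ w) ` X \<subseteq> (\<Union>k\<in>(\<Union>i\<in>I. J i). W k)" if w: "w \<in> level I (Suc K)" for w
    proof -
      obtain i w' where w': "w = i # w'" "i \<in> I" "w' \<in> level I K" using w by (auto simp: level_Suc)
      let ?u = "(v @ [i]) @ take (N i) w'"
      have t: "take (N i) w' \<in> level I (N i)" "take (N i) w' \<in> lists I" "drop (N i) w' \<in> lists I"
        using w' K[OF w'(2)] by (auto simp: level_def dest: in_set_takeD in_set_dropD)
      have "word_map S (v @ w) ` X = word_map S (?u @ drop (N i) w') ` X"
        using w' by (metis append.assoc append_Cons append_Nil append_take_drop_id)
      also have "\<dots> \<subseteq> word_map S ?u ` X" using v w' t by (intro word_append_subset) auto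
      also have "\<dots> \<subseteq> (\<Union>k\<in>J i. W k)" using JN(2)[OF w'(2)] t(1) unfolding covers_def by blast
      finally show ?thesis using w' by blast
    qed
    moreover have "finite (\<Union>i\<in>I. J i)" using finite_I JN by blast
    ultimately have "finite (\<Union>i\<in>I. J i)" "covers v (\<Union>i\<in>I. J i) (Suc K)"
      unfolding covers_def by blast+
    thus False using v(2) unfolding bad_def by blast
  qed
  then obtain nxt where nxt: "\<And>v. \<lbrakk>v \<in> lists I; bad v\<rbrakk> \<Longrightarrow> nxt v \<in> I \<and> bad (v @ [nxt v])" by metis
  define v where "v n = ((\<lambda>v. v @ [nxt v]) ^^ n) []" for n
  have v_Suc: "v (Suc n) = v n @ [nxt (v n)]" for n by (simp add: v_def)
  have v: "v n \<in> lists I \<and> bad (v n)" for n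
    by (induction n) (use \<open>bad []\<close> nxt in \<open>auto simp: v_def\<close>)
  define \<gamma> where "\<gamma> n = nxt (v n)" for n
  have v_eq: "v n = map \<gamma> [0..<n]" for n
    by (induction n) (simp_all add: v_Suc \<gamma>_def, simp add: v_def)
  have \<gamma>: "range \<gamma> \<subseteq> I" using nxt v by (auto simp: \<gamma>_def)
  have "(\<Inter>n. word_map S (v n) ` X) \<noteq> {}"
  proof (rule compact_nest)
    fix n
    have lip: "dist (word_map S (v n) x) (word_map S (v n) y) \<le> c ^ length (v n) * dist x y"
      if "x \<in> X" "y \<in> X" for x y using word_contraction v that by blast
    have "(c ^ length (v n))-lipschitz_on X (word_map S (v n))"
      by (rule lipschitz_onI) (use lip c in auto)
    thus "compact (word_map S (v n) ` X)"
      using compact_X by (intro compact_continuous_image lipschitz_on_continuous_on)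
    show "word_map S (v n) ` X \<noteq> {}" using X_two_points by auto
  next
    fix k n :: nat assume "k \<le> n"
    thus "word_map S (v n) ` X \<subseteq> word_map S (v k) ` X"
    proof (induction rule: dec_induct)
      case (step n)
      have "word_map S (v (Suc n)) ` X \<subseteq> word_map S (v n) ` X"
        unfolding v_Suc using v nxt by (intro word_append_subset) auto
      thus ?case using step by blast
    qed simp
  qed
  then obtain x where x: "\<And>n. x \<in> word_map S (v n) ` X" by auto
  hence "x \<in> limit_set X I S" using \<gamma> unfolding limit_set_def v_eq by blast
  then obtain k where k: "x \<in> W k" using cover by auto
  then obtain e where e: "e > 0" "ball x e \<subseteq> W k" using op openE by blast
  obtain B where B: "0 < B" "\<And>x y. \<lbrakk>x \<in> X; y \<in> X\<rbrakk> \<Longrightarrow> dist x y \<le> B" using X_bounded by blast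
  obtain n0 where n0: "c ^ n0 < e / B" using real_arch_pow_inv[of "e / B" c] c B(1) e(1) by auto
  have "word_map S (v n0) ` X \<subseteq> W k"
  proof safe
    fix y assume y: "y \<in> X"
    obtain y' where y': "y' \<in> X" "x = word_map S (v n0) y'" using x by auto
    have "dist x (word_map S (v n0) y) \<le> c ^ n0 * dist y' y"
      using word_contraction[of "v n0" y' y] v y y' by (simp add: v_eq)
    also have "\<dots> \<le> c ^ n0 * B" using B y y' c by (intro mult_left_mono) auto
    also have "\<dots> < e" using n0 B by (simp add: field_simps)
    finally show "word_map S (v n0) y \<in> W k" using e by auto
  qed
  \<comment> \<open>Level 0 below \<open>v n0\<close> is the empty word alone, so a single set of
    the cover refutes badness.\<close>
  hence "covers (v n0) {k} 0" by (simp add: covers_def)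
  thus False using v[of n0] unfolding bad_def by blast
qed

lemma limit_set_nonempty: "limit_set X I S \<noteq> {}"
proof -
  obtain i where "i \<in> I" using I_nonempty by blast
  then obtain x where "x \<in> fixed_points X I S" by (rule fixed_point_exists)
  thus ?thesis using fixed_points_subset_limit_set by blast
qed

text \<open>A cover with small power sum is enlarged to open balls; finitely many of them cover a
  whole level, and their sum is too small for the mass 1.\<close>

lemma hausdorff_measure_limit_set_neq_0: "hausdorff_measure s (limit_set X I S) \<noteq> 0"
proof
  assume H: "hausdorff_measure s (limit_set X I S) = 0"
  from sum_radii_of_finite_cover_ge obtain M :: real where
    "1 \<le> M \<and> (\<forall>N (J :: nat set) p r. finite J \<longrightarrow> (\<forall>j\<in>J. 0 < r j) \<longrightarrow>
      (\<forall>w\<in>level I N. word_map S w ` X \<subseteq> (\<Union>j\<in>J. ball (p j) (r j))) \<longrightarrow>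
      1 \<le> M * (\<Sum>j\<in>J. r j powr s))" ..
  note M = conjunct1[OF this] conjunct2[OF this]
  \<comment> \<open>Enlarging the sets costs another \<open>e\<close>, and
    \<open>M * (2 * e) = 1 / 2\<close>. The bound \<open>e < 1\<close> is for exponent 0, where each
    non-empty set contributes 1.\<close>
  define e where "e = 1 / (4 * M)"
  have e: "0 < e" "M * (2 * e) < 1" "e < 1" using M by (auto simp: e_def)
  have "hausdorff_premeasure 1 s (limit_set X I S) \<le> hausdorff_measure s (limit_set X I S)"
    unfolding hausdorff_measure_def by (rule SUP_upper) simp
  also have "\<dots> < ennreal e" using H e by simp
  finally obtain V :: "nat \<Rightarrow> 'a set" where V: "limit_set X I S \<subseteq> (\<Union>n. V n)" "\<And>n. bounded (V n)"
    "(\<Sum>n. ennreal (diameter_pow s (V n))) < ennreal e"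
    unfolding hausdorff_premeasure_def INF_less_iff by blast
  have nonneg: "0 \<le> diameter_pow s A" for A :: "'a set" by (simp add: diameter_pow_def)
  have part: "(\<Sum>n\<in>J. diameter_pow s (V n)) < e" if "finite J" for J
  proof -
    have "ennreal (\<Sum>n\<in>J. diameter_pow s (V n)) = (\<Sum>n\<in>J. ennreal (diameter_pow s (V n)))"
      using nonneg by (simp add: sum_ennreal)
    also have "\<dots> \<le> (\<Sum>n. ennreal (diameter_pow s (V n)))" using that by (intro sum_le_suminf) auto
    also have "\<dots> < ennreal e" by (rule V)
    finally show ?thesis using e by (simp add: ennreal_less_iff sum_nonneg nonneg)
  qed
  show False
  proof (cases "s = 0")
    case True
    have "V n = {}" for n using part[of "{n}"] e True by (auto simp: diameter_pow_def split: if_splits)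
    thus False using V limit_set_nonempty by auto
  next
    case False
    hence s: "s > 0" using s_nonneg by simp
    \<comment> \<open>The extra terms sum to at most \<open>e\<close> and make \<open>r n\<close>
      strictly larger than the diameter, also when the diameter is 0.\<close>
    define r where "r n = (diameter (V n) powr s + e * (1 / 2) ^ Suc n) powr (1 / s)" for n
    have pos: "0 < diameter (V n) powr s + e * (1 / 2) ^ Suc n" for n
      using e by (intro add_nonneg_pos) simp_all
    have r_pow: "r n powr s = diameter (V n) powr s + e * (1 / 2) ^ Suc n" for n
      unfolding r_def powr_powr using s less_imp_le[OF pos] by simp
    have r_pos: "0 < r n" for n unfolding r_def using pos[of n] by simp
    have r_gt: "diameter (V n) < r n" for n
    proof (rule ccontr)
      assume "\<not> ?thesis"
      hence "r n powr s \<le> diameter (V n) powr s" using r_pos[of n] s by (intro powr_mono2) auto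
      moreover have "0 < e * (1 / 2) ^ Suc n" using e by simp
      ultimately show False using r_pow[of n] by linarith
    qed
    define p where "p n = (SOME x. V n = {} \<or> x \<in> V n)" for n
    have p: "V n = {} \<or> p n \<in> V n" for n
      unfolding p_def by (rule someI_ex) auto
    have V_ball: "V n \<subseteq> ball (p n) (r n)" for n
    proof
      fix x assume x: "x \<in> V n"
      hence "dist (p n) x \<le> diameter (V n)" using p[of n] V(2) by (intro diameter_bounded_bound) auto
      thus "x \<in> ball (p n) (r n)" using r_gt[of n] by simp
    qed
    have "limit_set X I S \<subseteq> (\<Union>k. ball (p k) (r k))" using V(1) V_ball by blast
    from open_cover_level_finite[OF open_ball this] obtain J N where
      "finite J \<and> (\<forall>w\<in>level I N. word_map S w ` X \<subseteq> (\<Union>k\<in>J. ball (p k) (r k)))"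
      by (elim exE)
    note J = conjunct1[OF this] conjunct2[OF this, rule_format]
    have "1 \<le> M * (\<Sum>n\<in>J. r n powr s)" by (rule M(2)[rule_format, OF J(1) r_pos J(2)])
    moreover have "(\<Sum>n\<in>J. r n powr s) \<le> 2 * e"
    proof -
      have "r n powr s = diameter_pow s (V n) + e * (1 / 2) ^ Suc n" for n
        using s by (cases "V n = {}") (simp_all only: r_pow diameter_pow_def, simp_all)
      hence "(\<Sum>n\<in>J. r n powr s) = (\<Sum>n\<in>J. diameter_pow s (V n)) + e * (\<Sum>n\<in>J. (1 / 2) ^ Suc n)"
        by (simp only: sum.distrib sum_distrib_left)
      moreover have "(\<Sum>n\<in>J. (1 / 2 :: real) ^ Suc n) \<le> (\<Sum>n. (1 / 2) ^ Suc n)"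
        using power_half_series J(1) by (intro sum_le_suminf) (simp_all only: sums_iff, simp_all)
      moreover have "(\<Sum>n. (1 / 2 :: real) ^ Suc n) = 1" using power_half_series by (simp only: sums_iff)
      ultimately show ?thesis
        using part[OF J(1)] mult_left_mono[of "\<Sum>n\<in>J. (1 / 2 :: real) ^ Suc n" 1 e] e by linarith
    qed
    ultimately have "1 \<le> M * (2 * e)" using M(1) by (elim order_trans) (intro mult_left_mono, simp_all)
    thus False using e by simp
  qed
qed

end

section \<open>Covering numbers of the limit set\<close>

context finite_ifs_geometry
begin

text \<open>Double counting of pairs: a stopping word \<open>v\<close> at scale
  \<open>r / \<rho>\<close>, and a ball of an optimal cover of \<open>E\<close> that meets its
  cylinder. Pulled back by \<open>v\<close>, these balls cover \<open>F\<close> at scale about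
  \<rho>, so each \<open>v\<close> has many of them; each ball occurs with at most \<open>M\<close>
  words, and there are at least \<open>(\<rho> / r) powr s\<close> words.\<close>

lemma covering_number_image_ge:
  assumes F: "F \<subseteq> X" and E: "bounded E" "\<And>w. w \<in> lists I \<Longrightarrow> word_map S w ` F \<subseteq> E"
  shows "\<exists>C>0. \<forall>r \<rho>. 0 < r \<longrightarrow> r \<le> \<rho> \<longrightarrow> \<rho> \<le> 1 \<longrightarrow>
    (\<rho> / r) powr s * real (covering_number \<rho> F) \<le> C * real (covering_number r E)"
proof -
  \<comment> \<open>Points of \<open>F\<close> whose images under \<open>v\<close> lie in one ball
    of radius \<open>r\<close> have distance at most
    \<open>2 * L * r / (\<delta> * m_min) = 2 * L / m_min * \<rho>\<close>; the summand 1 makes the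
    inequality strict.\<close>
  define \<kappa> where "\<kappa> = 2 * L / m_min + 1"
  obtain M1 :: nat where M1: "M1 > 0" and M1_le: "\<And>(r::real) (E::'a set) (J::'a set) p.
       \<lbrakk>0 < r; finite J; E \<subseteq> (\<Union>j\<in>J. ball (p j) (\<kappa> * r))\<rbrakk> \<Longrightarrow> covering_number r E \<le> M1 * card J"
    by (rule covering_number_le_of_larger_balls[of \<kappa>, where 'a = 'a and 'j = 'a]) (rule that; assumption)
  from card_cuts_meeting_ball_le obtain M :: real where
    "1 \<le> M \<and> (\<forall>\<delta> N p. 0 < \<delta> \<longrightarrow> \<delta> \<le> 1 \<longrightarrow> (\<forall>w\<in>level I N. m w \<le> \<delta>) \<longrightarrow>
      real (card {u \<in> cut \<delta> ` level I N. word_map S u ` X \<inter> ball p \<delta> \<noteq> {}}) \<le> M)" ..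
  note M = conjunct1[OF this] conjunct2[OF this, rule_format]
  have "(\<rho> / r) powr s * real (covering_number \<rho> F) \<le> real M1 * M * real (covering_number r E)"
    if r: "0 < r" "r \<le> \<rho>" "\<rho> \<le> 1" for r \<rho>
  proof -
    define \<delta> where "\<delta> = r / \<rho>"
    \<comment> \<open>The bound \<open>r \<le> \<delta>\<close> comes from
      \<open>\<rho> \<le> 1\<close>; it lets the count for balls of radius \<delta> apply to balls
      of radius \<open>r\<close>.\<close>
    have \<delta>: "0 < \<delta>" "\<delta> \<le> 1" "r \<le> \<delta>" using r by (auto simp: \<delta>_def field_simps)
    obtain N where N: "\<And>w. \<lbrakk>w \<in> lists I; N \<le> length w\<rbrakk> \<Longrightarrow> m w \<le> \<delta>"
      using m_small[OF \<delta>(1)] by blast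
    hence deep: "\<forall>w\<in>level I N. m w \<le> \<delta>" by (auto simp: level_def)
    define Z where "Z = cut \<delta> ` level I N"
    have finZ: "finite Z" using finite_I by (simp add: Z_def)
    obtain C where C: "finite C" "E \<subseteq> (\<Union>x\<in>C. ball x r)" "card C = covering_number r E"
      using covering_number_attained[OF E(1) r(1)] by blast
    let ?R = "\<lambda>v z. word_map S v ` X \<inter> ball z r \<noteq> {}"
    have local: "covering_number \<rho> F \<le> M1 * card {z\<in>C. ?R v z}" if v: "v \<in> Z" for v
    proof -
      have vI: "v \<in> lists I" and mv: "\<delta> * m_min \<le> m v"
        using v cut_properties(1,5)[OF \<delta>(1,2) deep] by (auto simp: Z_def simp del: in_lists_conv_set)
      \<comment> \<open>The new centres are chosen in \<open>F\<close>, since the lower distance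
        estimate holds only between points of \<open>X\<close>.\<close>
      define p where "p z = (SOME y. y \<in> F \<and> dist z (word_map S v y) < r)" for z
      show ?thesis
      proof (rule M1_le[where p = p])
        show "F \<subseteq> (\<Union>z\<in>{z\<in>C. ?R v z}. ball (p z) (\<kappa> * \<rho>))"
        proof
          fix x assume x: "x \<in> F"
          have "word_map S v x \<in> E" using E(2)[OF vI] x by blast
          then obtain z where z: "z \<in> C" "dist z (word_map S v x) < r" using C(2) by auto
          have p: "p z \<in> F \<and> dist z (word_map S v (p z)) < r"
            unfolding p_def by (rule someI[of _ x]) (use x z in simp)
          have "m v * dist (p z) x \<le> L * dist (word_map S v (p z)) (word_map S v x)"
            using p x F by (intro lower vI) auto
          also have "\<dots> \<le> L * (2 * r)"
            using L p z(2) dist_triangle3[of "word_map S v (p z)" "word_map S v x" z]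
            by (intro mult_left_mono) auto
          finally have "\<delta> * m_min * dist (p z) x \<le> L * (2 * r)"
            using mult_right_mono[OF mv zero_le_dist[of "p z" x]] by linarith
          hence "dist (p z) x \<le> L * (2 * r) / (\<delta> * m_min)"
            using \<delta> m_min by (simp add: field_simps)
          also have "\<dots> = 2 * L / m_min * \<rho>" using r by (simp add: \<delta>_def)
          also have "\<dots> < \<kappa> * \<rho>" using r by (simp add: \<kappa>_def algebra_simps)
          finally have "x \<in> ball (p z) (\<kappa> * \<rho>)" by simp
          moreover have "word_map S v x \<in> word_map S v ` X \<inter> ball z r" using z(2) x F by auto
          hence "?R v z" by blast
          ultimately show "x \<in> (\<Union>z\<in>{z\<in>C. ?R v z}. ball (p z) (\<kappa> * \<rho>))" using z(1) by blast
        qed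
      qed (use r C in auto)
    qed
    have "(\<Sum>v\<in>Z. \<Sum>z\<in>{z. z \<in> C \<and> ?R v z}. 1) = (\<Sum>z\<in>C. \<Sum>v\<in>{v. v \<in> Z \<and> ?R v z}. (1::real))"
      using finZ C(1) by (rule sum.swap_restrict)
    also have "\<dots> \<le> (\<Sum>z\<in>C. M)"
    proof (rule sum_mono)
      fix z assume "z \<in> C"
      have "card {v. v \<in> Z \<and> ?R v z} \<le> card {u \<in> cut \<delta> ` level I N. word_map S u ` X \<inter> ball z \<delta> \<noteq> {}}"
      proof (rule card_mono)
        have "ball z r \<subseteq> ball z \<delta>" using \<delta> by auto
        thus "{v. v \<in> Z \<and> ?R v z} \<subseteq> {u \<in> cut \<delta> ` level I N. word_map S u ` X \<inter> ball z \<delta> \<noteq> {}}"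
          unfolding Z_def by blast
      qed (use finite_I in simp)
      also have "real \<dots> \<le> M" using deep by (intro M(2) \<delta>) auto
      finally show "(\<Sum>v\<in>{v. v \<in> Z \<and> ?R v z}. 1) \<le> M" by simp
    qed
    also have "\<dots> = M * real (covering_number r E)" using C(3) by simp
    finally have count: "(\<Sum>v\<in>Z. \<Sum>z\<in>{z. z \<in> C \<and> ?R v z}. 1) \<le> M * real (covering_number r E)" .
    have "(\<rho> / r) powr s * \<delta> powr s = 1"
      using r by (simp add: \<delta>_def flip: powr_mult)
    moreover have "(\<rho> / r) powr s * 1 \<le> (\<rho> / r) powr s * (real (card Z) * \<delta> powr s)"
      unfolding Z_def by (intro mult_left_mono card_cuts_ge[OF \<delta>(1,2) deep]) simp
    ultimately have "(\<rho> / r) powr s \<le> real (card Z)" by (simp add: mult.left_commute)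
    hence "(\<rho> / r) powr s * real (covering_number \<rho> F) \<le> real (card Z) * real (covering_number \<rho> F)"
      by (intro mult_right_mono) auto
    also have "\<dots> = (\<Sum>v\<in>Z. real (covering_number \<rho> F))" by simp
    also have "\<dots> \<le> (\<Sum>v\<in>Z. real M1 * real (card {z\<in>C. ?R v z}))"
    proof (rule sum_mono)
      fix v assume "v \<in> Z"
      from local[OF this] show "real (covering_number \<rho> F) \<le> real M1 * real (card {z\<in>C. ?R v z})"
        by (metis of_nat_le_iff of_nat_mult)
    qed
    also have "\<dots> = real M1 * (\<Sum>v\<in>Z. \<Sum>z\<in>{z. z \<in> C \<and> ?R v z}. 1)"
      by (simp add: sum_distrib_left)
    also have "\<dots> \<le> real M1 * (M * real (covering_number r E))" using count by (intro mult_left_mono) auto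
    finally show ?thesis by simp
  qed
  moreover have "real M1 * M > 0" using M1 M(1) by simp
  ultimately show ?thesis by blast
qed

end

section \<open>Words of one level as letters\<close>

lemma word_map_word_map: "word_map (word_map S) ws = word_map S (concat ws)"
  by (induction ws) auto

context ifs_geometry
begin

lemma concat_in_lists:
  assumes "A \<subseteq> level I n" "ws \<in> lists A"
  shows "concat ws \<in> lists I" "length (concat ws) = length ws * n"
  using assms(2)
proof induction
  case (Cons w ws)
  { case 1 show ?case using Cons assms(1) level_subset_lists[of I n] by auto }
  { case 2 show ?case using Cons assms(1) by (auto simp: level_def) }
qed auto

text \<open>Words over \<open>A\<close> become words over \<open>I\<close> by \<open>concat\<close>,
  so \<open>L\<close> survives unchanged. Equal length makes distinct letters incomparable, and
  positive length keeps the contraction factor at most \<open>c\<close>.\<close>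

lemma subsystem:
  assumes A: "A \<subseteq> level I n" and n: "1 \<le> n"
  shows "ifs_geometry X U A (word_map S) (\<lambda>ws. m (concat ws)) L c"
proof
  note cI = concat_in_lists[OF A]
  have AI: "w \<in> lists I" "length w = n" if "w \<in> A" for w using A that by (auto simp: level_def)
  show "countable A"
    by (rule countable_subset[OF _ countable_lists[OF countable_I]]) (use A level_subset_lists in blast)
  show "word_map S w ` X \<subseteq> X" if "w \<in> A" for w using AI(1)[OF that] by (rule word_into)
  show "word_map S w ` U \<subseteq> U" if "w \<in> A" for w using AI(1)[OF that] by (rule word_into_U)
  show "word_map S u ` U \<inter> word_map S v ` U = {}" if "u \<in> A" "v \<in> A" "u \<noteq> v" for u v
    using AI[OF that(1)] AI[OF that(2)] that(3) by (intro words_disjoint) auto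
  show "dist (word_map S w x) (word_map S w y) \<le> c * dist x y" if "w \<in> A" "x \<in> X" "y \<in> X" for w x y
  proof -
    have "dist (word_map S w x) (word_map S w y) \<le> c ^ n * dist x y"
      using word_contraction[OF AI(1)[OF that(1)] that(2,3)] AI(2)[OF that(1)] by simp
    also have "\<dots> \<le> c ^ 1 * dist x y"
      using c n by (intro mult_right_mono power_decreasing) auto
    finally show ?thesis by simp
  qed
  show "0 < m (concat ws)" if "ws \<in> lists A" for ws using cI(1)[OF that] by (rule m_pos)
  show "m (concat us) * m (concat vs) \<le> m (concat (us @ vs))" if "us \<in> lists A" "vs \<in> lists A" for us vs
    using m_append[OF cI(1)[OF that(1)] cI(1)[OF that(2)]] by simp
  fix ws assume ws: "ws \<in> lists A"
  show "\<exists>z. ball z (m (concat ws) / L) \<subseteq> word_map (word_map S) ws ` U"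
    unfolding word_map_word_map using cI(1)[OF ws] by (rule inner_ball)
  fix x y assume xy: "x \<in> X" "y \<in> X"
  show "dist (word_map (word_map S) ws x) (word_map (word_map S) ws y) \<le> L * m (concat ws) * dist x y"
    unfolding word_map_word_map using cI(1)[OF ws] xy by (rule upper)
  show "m (concat ws) * dist x y \<le> L * dist (word_map (word_map S) ws x) (word_map (word_map S) ws y)"
    unfolding word_map_word_map using cI(1)[OF ws] xy by (rule lower)
qed (use compact_X U_subset c L m_Nil in auto)

lemma limit_set_subsystem:
  assumes A: "A \<subseteq> level I n" and n: "1 \<le> n"
  shows "limit_set X A (word_map S) \<subseteq> limit_set X I S"
proof
  fix x assume "x \<in> limit_set X A (word_map S)"
  then obtain \<gamma> where \<gamma>: "range \<gamma> \<subseteq> A"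
    and x: "\<And>k. 1 \<le> k \<Longrightarrow> x \<in> word_map (word_map S) (map \<gamma> [0..<k]) ` X"
    by (auto simp: limit_set_def)
  have \<gamma>I: "\<gamma> k \<in> lists I" "length (\<gamma> k) = n" for k
    using \<gamma> A by (auto simp: level_def image_subset_iff subset_iff)
  define \<gamma>' where "\<gamma>' j = \<gamma> (j div n) ! (j mod n)" for j
  have \<gamma>'I: "\<gamma>' j \<in> I" for j
  proof -
    have "\<gamma> (j div n) ! (j mod n) \<in> set (\<gamma> (j div n))"
      using \<gamma>I(2)[of "j div n"] n by (intro nth_mem) simp
    thus ?thesis using \<gamma>I(1)[of "j div n"] unfolding \<gamma>'_def in_lists_conv_set by blast
  qed
  have eq: "concat (map \<gamma> [0..<k]) = map \<gamma>' [0..<k * n]" for k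
  proof (induction k)
    case (Suc k)
    have "\<gamma> k = map \<gamma>' [k * n..<k * n + n]"
    proof (rule nth_equalityI)
      fix i assume "i < length (\<gamma> k)"
      hence "i < n" using \<gamma>I by simp
      thus "\<gamma> k ! i = map \<gamma>' [k * n..<k * n + n] ! i" by (simp add: \<gamma>'_def)
    qed (simp add: \<gamma>I)
    moreover have "[0..<Suc k * n] = [0..<k * n] @ [k * n..<k * n + n]"
      using upt_add_eq_append[of 0 "k * n" n] by (simp add: add.commute)
    ultimately show ?case using Suc by simp
  qed simp
  have "x \<in> word_map S (map \<gamma>' [0..<k]) ` X" if k: "1 \<le> k" for k
  proof -
    \<comment> \<open>Membership is known only at depths that are multiples of \<open>n\<close>; the
      nested cylinders pass it from depth \<open>k * n\<close> up to \<open>k\<close>.\<close>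
    have "k \<le> k * n" using n by (cases n) auto
    then obtain j where j: "k * n = k + j" unfolding le_iff_add by blast
    have "[0..<k * n] = [0..<k] @ [k..<k + j]" unfolding j using upt_add_eq_append[of 0 k j] by simp
    hence "word_map S (map \<gamma>' [0..<k * n]) ` X \<subseteq> word_map S (map \<gamma>' [0..<k]) ` X"
      unfolding \<open>[0..<k * n] = [0..<k] @ [k..<k + j]\<close> map_append
      using \<gamma>'I by (intro word_append_subset) auto
    moreover have "x \<in> word_map S (map \<gamma>' [0..<k * n]) ` X"
      using x[OF k] unfolding word_map_word_map eq .
    ultimately show ?thesis by (rule subsetD)
  qed
  moreover have "range \<gamma>' \<subseteq> I" using \<gamma>'I by auto
  ultimately show "x \<in> limit_set X I S" unfolding limit_set_def by auto
qed

text \<open>If all finite level sums at \<open>s\<close> were at most 1, the series would converge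
  at the larger exponent \<open>s'\<close>. A sum strictly above 1 also excludes level 0, which
  contains only the empty word of ratio 1.\<close>

lemma finite_subsystem_exists:
  assumes "\<not> (\<lambda>w. m w powr s') summable_on lists I" "0 \<le> s" "s < s'"
  obtains A n where "A \<subseteq> level I n" "1 \<le> n"
    "finite_ifs_geometry X U A (word_map S) (\<lambda>ws. m (concat ws)) L c s"
proof -
  have "\<exists>n A. finite A \<and> A \<subseteq> level I n \<and> \<not> (\<Sum>w\<in>A. m w powr s) \<le> 1"
  proof (rule ccontr)
    assume "\<not> ?thesis"
    hence "(\<Sum>w\<in>A. m w powr s) \<le> 1" if "finite A" "A \<subseteq> level I n" for A n using that by blast
    from summable_if_level_sums_bounded[OF this assms(3)] assms(1) show False by simp
  qed
  then obtain n A where A: "finite A" "A \<subseteq> level I n" "(\<Sum>w\<in>A. m w powr s) > 1"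
    by (auto simp: not_le)
  have n: "1 \<le> n"
  proof (rule ccontr)
    assume "\<not> 1 \<le> n"
    hence "n = 0" by simp
    hence "A \<subseteq> {[]}" using A(2) by simp
    hence "A = {} \<or> A = {[]}" by blast
    thus False using A(3) m_Nil by auto
  qed
  interpret sub: ifs_geometry X U A "word_map S" "\<lambda>ws. m (concat ws)" L c
    using A(2) n by (rule subsystem)
  have "finite_ifs_geometry X U A (word_map S) (\<lambda>ws. m (concat ws)) L c s"
    by unfold_locales (use A assms(2) in auto)
  thus ?thesis using A(2) n by (intro that)
qed

text \<open>Otherwise the limit set of some finite subsystem, a subset of the whole one, has
  non-zero measure at \<open>s\<close>.\<close>

lemma summable_if_hausdorff_measure_eq_0:
  assumes "hausdorff_measure s (limit_set X I S) = 0" "0 \<le> s" "s < s'"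
  shows "(\<lambda>w. m w powr s') summable_on lists I"
proof (rule ccontr)
  assume "\<not> ?thesis"
  then obtain A n where A: "A \<subseteq> level I n" "1 \<le> n"
    and fin: "finite_ifs_geometry X U A (word_map S) (\<lambda>ws. m (concat ws)) L c s"
    using assms(2,3) by (rule finite_subsystem_exists)
  have "hausdorff_premeasure \<delta> s (limit_set X A (word_map S)) \<le> hausdorff_premeasure \<delta> s (limit_set X I S)" for \<delta>
    unfolding hausdorff_premeasure_def
    using limit_set_subsystem[OF A] by (intro INF_superset_mono) auto
  hence "hausdorff_measure s (limit_set X A (word_map S)) \<le> hausdorff_measure s (limit_set X I S)"
    unfolding hausdorff_measure_def by (intro SUP_mono) auto
  thus False using assms(1) finite_ifs_geometry.hausdorff_measure_limit_set_neq_0[OF fin] by simp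
qed

lemma summable_if_gt_dim:
  assumes "real DIM('a) < s" shows "(\<lambda>w. m w powr s) summable_on lists I"
proof -
  obtain C where C: "\<And>n A. \<lbrakk>finite A; A \<subseteq> level I n\<rbrakk> \<Longrightarrow> (\<Sum>w\<in>A. m w ^ DIM('a)) \<le> C"
    using sum_m_power_le by blast
  show ?thesis
  proof (rule summable_if_level_sums_bounded[OF _ assms])
    fix n A assume A: "finite A" "A \<subseteq> level I n"
    have "(\<Sum>w\<in>A. m w powr real DIM('a)) = (\<Sum>w\<in>A. m w ^ DIM('a))"
      using A level_subset_lists[of I n] m_pos by (intro sum.cong powr_realpow) blast+
    thus "(\<Sum>w\<in>A. m w powr real DIM('a)) \<le> C" using C[OF A] by simp
  qed
qed

lemma limit_set_bounded: "bounded (limit_set X I S)"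
  using limit_set_subset compact_imp_bounded[OF compact_X] bounded_subset by blast

lemma fixed_points_subset: "fixed_points X I S \<subseteq> X"
  by (auto simp: fixed_points_def)

text \<open>The words come from a finite subsystem, the fixed points from the full system; the
  images of the latter stay in the full limit set.\<close>

lemma covering_number_limit_set_ge:
  assumes "\<not> (\<lambda>w. m w powr s') summable_on lists I" "0 \<le> s" "s < s'"
  shows "\<exists>C>0. \<forall>r \<rho>. 0 < r \<longrightarrow> r \<le> \<rho> \<longrightarrow> \<rho> \<le> 1 \<longrightarrow>
    (\<rho> / r) powr s * real (covering_number \<rho> (fixed_points X I S))
      \<le> C * real (covering_number r (limit_set X I S))"
proof -
  obtain A n where A: "A \<subseteq> level I n" "1 \<le> n"
    and fin: "finite_ifs_geometry X U A (word_map S) (\<lambda>ws. m (concat ws)) L c s"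
    using assms by (rule finite_subsystem_exists)
  show ?thesis
  proof (rule finite_ifs_geometry.covering_number_image_ge[OF fin fixed_points_subset limit_set_bounded])
    fix ws assume "ws \<in> lists A"
    hence "word_map S (concat ws) ` limit_set X I S \<subseteq> limit_set X I S"
      using concat_in_lists(1)[OF A(1)] by (intro word_limit_set)
    thus "word_map (word_map S) ws ` fixed_points X I S \<subseteq> limit_set X I S"
      unfolding word_map_word_map using fixed_points_subset_limit_set by blast
  qed
qed

text \<open>\<open>Q\<close>, which may depend on \<open>r\<close>, bounds the weighted covering
  numbers of the fixed points at all radii in \<open>{r..<1}\<close>. A point of the limit set is
  traced to the last prefix \<open>v\<close> before its ratio drops to \<open>r\<close>; the fixed
  points need at most \<open>Q * m v powr s\<close> balls at the scale seen from \<open>v\<close>,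
  and this is summable over \<open>v\<close>.\<close>

lemma covering_number_limit_set_le:
  assumes sum: "(\<lambda>w. m w powr s) summable_on lists I" and s: "0 \<le> s"
  shows "\<exists>C>0. \<forall>r Q. 0 < r \<longrightarrow> r < 1 \<longrightarrow>
    (\<forall>\<rho>. r \<le> \<rho> \<longrightarrow> \<rho> < 1 \<longrightarrow> real (covering_number \<rho> (fixed_points X I S)) \<le> Q * (r / \<rho>) powr s) \<longrightarrow>
    real (covering_number r (limit_set X I S)) \<le> C * Q"
proof -
  let ?F = "fixed_points X I S" and ?\<Lambda> = "limit_set X I S"
  obtain B where B: "0 < B" "\<And>x y. \<lbrakk>x \<in> X; y \<in> X\<rbrakk> \<Longrightarrow> dist x y \<le> B" using X_bounded by blast
  \<comment> \<open>In units of \<open>R v\<close>, \<open>L * B\<close> bounds the distance from a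
    point in the cylinder of the last letter to a fixed point in it, and 1 the distance from there
    to a centre of the cover.\<close>
  define \<eta> where "\<eta> = 1 + L * B"
  have \<eta>: "0 < \<eta>" using L B(1) by (simp add: \<eta>_def add_pos_pos)
  \<comment> \<open>A distance of \<open>2 * \<eta> * R v\<close> becomes at most
    \<open>2 * L * L * \<eta> * r\<close> under the word \<open>v\<close>, because
    \<open>m v * R v \<le> L * r\<close>.\<close>
  define \<kappa> where "\<kappa> = 2 * L * L * \<eta> + 1"
  obtain M :: nat where M: "M > 0" and M_le: "\<And>(r::real) (E::'a set) (J::('i list \<times> 'a) set) p.
       \<lbrakk>0 < r; finite J; E \<subseteq> (\<Union>j\<in>J. ball (p j) (\<kappa> * r))\<rbrakk> \<Longrightarrow> covering_number r E \<le> M * card J"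
    by (rule covering_number_le_of_larger_balls[of \<kappa>, where 'a = 'a and 'j = "'i list \<times> 'a"]) (rule that; assumption)
  define T where "T = infsum (\<lambda>w. m w powr s) (lists I)"
  have T: "(\<Sum>w\<in>W. m w powr s) \<le> T" if "finite W" "W \<subseteq> lists I" for W
    unfolding T_def using sum that by (intro finite_sum_le_infsum) auto
  have "0 \<le> T" using T[of "{}"] by simp
  have bdF: "bounded ?F"
    using fixed_points_subset_limit_set limit_set_bounded bounded_subset by blast
  have "real (covering_number r ?\<Lambda>) \<le> (real M * T + 1) * Q"
    if r: "0 < r" "r < 1" and Q: "\<And>\<rho>. \<lbrakk>r \<le> \<rho>; \<rho> < 1\<rbrakk> \<Longrightarrow> real (covering_number \<rho> ?F) \<le> Q * (r / \<rho>) powr s" for r Q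
  proof -
    have Q0: "0 \<le> Q" using Q[of r] r by simp
    define W where "W = {v\<in>lists I. r < m v}"
    have WI: "v \<in> lists I" "r < m v" if "v \<in> W" for v using that by (auto simp: W_def)
    \<comment> \<open>Each member of \<open>W\<close> adds at least \<open>r powr s\<close> to a
      convergent series.\<close>
    have "finite W \<and> card W \<le> nat \<lfloor>T / r powr s\<rfloor>"
    proof (rule finite_if_finite_subsets_card_bdd)
      fix G assume G: "G \<subseteq> W" "finite G"
      have "real (card G) * r powr s = (\<Sum>v\<in>G. r powr s)" by simp
      also have "\<dots> \<le> (\<Sum>v\<in>G. m v powr s)"
        using subsetD[OF G(1), THEN WI(2), THEN less_imp_le] r s by (intro sum_mono powr_mono2) auto
      also have "\<dots> \<le> T" using G WI(1) by (intro T) auto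
      finally have "real (card G) \<le> T / r powr s" using r by (simp add: field_simps)
      thus "card G \<le> nat \<lfloor>T / r powr s\<rfloor>" by (simp add: le_nat_floor)
    qed
    hence finW: "finite W" ..
    \<comment> \<open>The ratio \<open>m v\<close> is only known to be at most \<open>L\<close>, so
      it may exceed 1. The truncation keeps \<open>r \<le> R v < 1\<close>, the range in which
      \<open>Q\<close> is a bound.\<close>
    define R where "R v = r / min 1 (m v)" for v
    have min_pos: "0 < min 1 (m v)" if "v \<in> W" for v using m_pos[OF WI(1)[OF that]] by simp
    have R: "r \<le> R v" "R v < 1" if "v \<in> W" for v
      using min_pos[OF that] WI(2)[OF that] r by (auto simp: R_def field_simps)
    have mR: "m v * R v \<le> L * r" "r / m v \<le> R v" if "v \<in> W" for v
    proof -
      have "m v \<le> L * c ^ length v" using WI(1)[OF that] by (rule m_le)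
      also have "\<dots> \<le> L * 1" using L c by (intro mult_left_mono power_le_one) auto
      finally have "m v \<le> L" by simp
      thus "m v * R v \<le> L * r"
        using m_pos[OF WI(1)[OF that]] L r by (cases "m v \<le> 1") (auto simp: R_def mult_right_mono)
      show "r / m v \<le> R v"
        unfolding R_def using min_pos[OF that] m_pos[OF WI(1)[OF that]] r by (intro divide_left_mono) auto
    qed
    have "\<forall>v\<in>W. \<exists>C. finite C \<and> ?F \<subseteq> (\<Union>x\<in>C. ball x (R v)) \<and> card C = covering_number (R v) ?F"
    proof
      fix v assume "v \<in> W"
      hence "0 < R v" using R(1)[of v] r by simp
      from covering_number_attained[OF bdF this]
      show "\<exists>C. finite C \<and> ?F \<subseteq> (\<Union>x\<in>C. ball x (R v)) \<and> card C = covering_number (R v) ?F" by metis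
    qed
    from bchoice[OF this] obtain C where
      C: "\<forall>v\<in>W. finite (C v) \<and> ?F \<subseteq> (\<Union>x\<in>C v. ball x (R v)) \<and> card (C v) = covering_number (R v) ?F" ..
    define p where "p = (\<lambda>(v, z). word_map S v (SOME y. y \<in> X \<and> dist z y < \<eta> * R v))"
    have "?\<Lambda> \<subseteq> (\<Union>j\<in>Sigma W C. ball (p j) (\<kappa> * r))"
    proof
      fix x assume "x \<in> ?\<Lambda>"
      then obtain \<gamma> where \<gamma>: "range \<gamma> \<subseteq> I" and x: "\<And>n. 1 \<le> n \<Longrightarrow> x \<in> word_map S (map \<gamma> [0..<n]) ` X"
        by (auto simp: limit_set_def)
      have \<gamma>I: "map \<gamma> [0..<n] \<in> lists I" "\<gamma> n \<in> I" for n using \<gamma> by (auto simp: image_subset_iff)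
      obtain N where N: "\<And>w. \<lbrakk>w \<in> lists I; N \<le> length w\<rbrakk> \<Longrightarrow> m w \<le> r" using m_small[OF r(1)] by blast
      have ex: "m (map \<gamma> [0..<N]) \<le> r" by (rule N[OF \<gamma>I(1)]) simp
      \<comment> \<open>\<open>v\<close> will be the prefix just before this one; it exists because
        \<open>m [] = 1 > r\<close>.\<close>
      define n where "n = (LEAST n. m (map \<gamma> [0..<n]) \<le> r)"
      have n: "m (map \<gamma> [0..<n]) \<le> r" unfolding n_def using ex by (rule LeastI)
      have "n \<noteq> 0" using n m_Nil r by (intro notI) simp
      then obtain k where k: "n = Suc k" by (cases n) auto
      define v where "v = map \<gamma> [0..<k]"
      define i where "i = \<gamma> k"
      have vi: "v @ [i] = map \<gamma> [0..<n]" by (simp add: v_def i_def k)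
      have "\<not> m v \<le> r"
        unfolding v_def using not_less_Least[of k "\<lambda>n. m (map \<gamma> [0..<n]) \<le> r"] k by (simp add: n_def[symmetric])
      hence v: "v \<in> W" using \<gamma>I(1)[of k] by (simp add: W_def v_def del: in_lists_conv_set)
      have i: "i \<in> I" by (simp add: i_def \<gamma>I)
      have mvpos: "0 < m v" using WI(1)[OF v] by (rule m_pos)
      have "m v * m [i] \<le> m (v @ [i])" using WI(1)[OF v] i by (intro m_append) auto
      also have "\<dots> \<le> r" using n vi by simp
      finally have "m [i] \<le> r / m v" using mvpos by (simp add: field_simps)
      hence mi: "m [i] \<le> R v" using mR(2)[OF v] by simp
      have "x \<in> word_map S (v @ [i]) ` X" unfolding vi using x[of n] k by simp
      then obtain y0 where y0: "y0 \<in> X" "x = word_map S v (S i y0)" by auto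
      define y where "y = S i y0"
      have yX: "y \<in> X" using y0(1) S_into[OF i] by (auto simp: y_def)
      obtain z0 where z0: "z0 \<in> ?F" "z0 \<in> S i ` X" using fixed_point_exists[OF i] by blast
      then obtain y1 where y1: "y1 \<in> X" "z0 = S i y1" by auto
      have "dist z0 y \<le> L * m [i] * dist y1 y0"
        using upper[of "[i]" y1 y0] i y0(1) y1 by (simp add: y_def)
      also have "\<dots> \<le> L * R v * B"
        using L mi B(2)[OF y1(1) y0(1)] m_pos[of "[i]"] i R(1)[OF v] r
        by (intro mult_mono) auto
      finally have 1: "dist z0 y \<le> L * B * R v" by (simp add: mult_ac)
      obtain z where z: "z \<in> C v" "dist z z0 < R v" using C v z0(1) by fastforce
      have "dist z y < \<eta> * R v"
        using dist_triangle[of z y z0] 1 z(2) by (simp add: \<eta>_def algebra_simps)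
      hence y_near: "y \<in> X \<and> dist z y < \<eta> * R v" using yX by simp
      \<comment> \<open>The centre \<open>z\<close> need not lie in \<open>X\<close>, where the
        distance estimates hold. Its substitute is chosen from \<open>v\<close> and \<open>z\<close>
        alone, so that the centres \<open>p\<close> do not depend on \<open>x\<close>.\<close>
      define y' where "y' = (SOME y. y \<in> X \<and> dist z y < \<eta> * R v)"
      have y': "y' \<in> X \<and> dist z y' < \<eta> * R v" unfolding y'_def using y_near by (rule someI)
      have "dist (word_map S v y') (word_map S v y) \<le> L * m v * dist y' y"
        using WI(1)[OF v] y' yX by (intro upper) auto
      also have "\<dots> \<le> L * m v * (2 * \<eta> * R v)"
        using L mvpos y' y_near dist_triangle3[of y' y z] by (intro mult_left_mono) auto
      also have "\<dots> = 2 * L * \<eta> * (m v * R v)" by simp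
      also have "\<dots> \<le> 2 * L * \<eta> * (L * r)" using mR(1)[OF v] L \<eta> by (intro mult_left_mono) auto
      also have "\<dots> < \<kappa> * r" using r by (simp add: \<kappa>_def algebra_simps)
      finally have "x \<in> ball (p (v, z)) (\<kappa> * r)" using y0(2) by (simp add: p_def y'_def y_def)
      thus "x \<in> (\<Union>j\<in>Sigma W C. ball (p j) (\<kappa> * r))" using v z(1) by blast
    qed
    hence "covering_number r ?\<Lambda> \<le> M * card (Sigma W C)"
      using finW C r(1) by (intro M_le) auto
    also have "card (Sigma W C) = (\<Sum>v\<in>W. card (C v))" using finW C by (intro card_SigmaI) auto
    also have "\<dots> = (\<Sum>v\<in>W. covering_number (R v) ?F)" using C by simp
    finally have "real (covering_number r ?\<Lambda>) \<le> real (M * (\<Sum>v\<in>W. covering_number (R v) ?F))"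
      by (simp only: of_nat_le_iff)
    also have "\<dots> = real M * (\<Sum>v\<in>W. real (covering_number (R v) ?F))" by simp
    also have "\<dots> \<le> real M * (\<Sum>v\<in>W. Q * m v powr s)"
    proof (intro mult_left_mono sum_mono)
      fix v assume v: "v \<in> W"
      have "real (covering_number (R v) ?F) \<le> Q * (r / R v) powr s" using R[OF v] by (rule Q)
      also have "\<dots> = Q * (min 1 (m v)) powr s" using min_pos[OF v] r by (simp add: R_def)
      also have "\<dots> \<le> Q * m v powr s"
        using Q0 s min_pos[OF v] by (intro mult_left_mono powr_mono2) auto
      finally show "real (covering_number (R v) ?F) \<le> Q * m v powr s" .
    qed simp
    also have "\<dots> = real M * Q * (\<Sum>v\<in>W. m v powr s)" by (simp add: sum_distrib_left mult.assoc)
    also have "\<dots> \<le> real M * Q * T" using Q0 finW WI(1) by (intro mult_left_mono T) auto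
    also have "\<dots> \<le> (real M * T + 1) * Q" using Q0 by (simp add: algebra_simps)
    finally show ?thesis .
  qed
  moreover have "real M * T + 1 > 0" using \<open>0 \<le> T\<close> by (simp add: add_nonneg_pos)
  ultimately show ?thesis by blast
qed

end

section \<open>Covering classes\<close>

lemma covering_exponent_exp:
  "exp x * covering_exponent E (exp (- exp x)) = ln (real (covering_number (exp (- exp x)) E))"
proof -
  have "ln (1 / exp (- exp x)) = exp x" by (simp add: ln_div)
  thus ?thesis by (simp add: covering_exponent_def)
qed

text \<open>Multiplying by \<open>exp x\<close> turns the exponent into a logarithm, so constant
  factors in covering numbers become additive errors that \<open>\<epsilon> * exp x\<close>
  absorbs.\<close>

lemma has_covering_class_iff:
  fixes E :: "(real ^ 'n) set"
  shows "has_covering_class E g \<longleftrightarrow>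
     E \<noteq> {} \<and> bounded E \<and> g \<in> dini_class 0 (real CARD('n)) \<and>
     (\<forall>\<epsilon>>0. \<exists>x0. \<forall>x\<ge>x0. \<bar>ln (real (covering_number (exp (- exp x)) E)) - exp x * g x\<bar> \<le> \<epsilon> * exp x)"
proof -
  let ?s = "\<lambda>x. covering_exponent E (exp (- exp x))"
  have eq: "\<bar>ln (real (covering_number (exp (- exp x)) E)) - exp x * g x\<bar> \<le> \<epsilon> * exp x
      \<longleftrightarrow> \<bar>?s x - g x\<bar> \<le> \<epsilon>" for x \<epsilon>
  proof -
    have "\<bar>ln (real (covering_number (exp (- exp x)) E)) - exp x * g x\<bar> = exp x * \<bar>?s x - g x\<bar>"
      by (simp add: covering_exponent_exp[symmetric] abs_mult flip: right_diff_distrib)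
    thus ?thesis by (simp add: mult.commute)
  qed
  have "((\<lambda>x. ?s x - g x) \<longlongrightarrow> 0) at_top \<longleftrightarrow> (\<forall>\<epsilon>>0. \<exists>x0. \<forall>x\<ge>x0. \<bar>?s x - g x\<bar> \<le> \<epsilon>)"
  proof
    assume *: "((\<lambda>x. ?s x - g x) \<longlongrightarrow> 0) at_top"
    show "\<forall>\<epsilon>>0. \<exists>x0. \<forall>x\<ge>x0. \<bar>?s x - g x\<bar> \<le> \<epsilon>"
    proof (intro allI impI)
      fix \<epsilon> :: real assume "\<epsilon> > 0"
      with * have "\<forall>\<^sub>F x in at_top. \<bar>?s x - g x\<bar> < \<epsilon>"
        by (simp add: tendsto_iff dist_real_def)
      hence "\<forall>\<^sub>F x in at_top. \<bar>?s x - g x\<bar> \<le> \<epsilon>" by eventually_elim simp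
      thus "\<exists>x0. \<forall>x\<ge>x0. \<bar>?s x - g x\<bar> \<le> \<epsilon>" by (simp add: eventually_at_top_linorder)
    qed
  next
    assume *: "\<forall>\<epsilon>>0. \<exists>x0. \<forall>x\<ge>x0. \<bar>?s x - g x\<bar> \<le> \<epsilon>"
    show "((\<lambda>x. ?s x - g x) \<longlongrightarrow> 0) at_top"
      unfolding tendsto_iff eventually_at_top_linorder
    proof (intro allI impI)
      fix \<epsilon> :: real assume "\<epsilon> > 0"
      hence "\<epsilon> / 2 > 0" by simp
      then obtain x0 where x0: "\<forall>x\<ge>x0. \<bar>?s x - g x\<bar> \<le> \<epsilon> / 2" using * by blast
      have "dist (?s x - g x) 0 < \<epsilon>" if "x \<ge> x0" for x
        using x0[rule_format, OF that] \<open>\<epsilon> > 0\<close> by (simp add: dist_real_def)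
      thus "\<exists>x0. \<forall>x\<ge>x0. dist (?s x - g x) 0 < \<epsilon>" by blast
    qed
  qed
  thus ?thesis unfolding has_covering_class_def eq by blast
qed

lemma eventually_exp_dominates:
  fixes C \<epsilon> :: real
  assumes "\<epsilon> > 0" shows "\<exists>x0. \<forall>x\<ge>x0. C \<le> \<epsilon> * exp x"
proof (intro exI allI impI)
  fix x assume "C / \<epsilon> \<le> x"
  also have "x \<le> exp x" using exp_ge_add_one_self[of x] by linarith
  finally show "C \<le> \<epsilon> * exp x" using assms by (simp add: field_simps)
qed

context ifs_geometry
begin

text \<open>The combinatorial bound is used at exponent \<open>l + e\<close>. Its \<open>Q\<close>
  comes from \<open>f \<le> g\<close> and the growth of \<open>g\<close>:
  \<open>exp y * g y \<le> exp x * g x - l * (exp x - exp y)\<close> for \<open>y \<le> x\<close>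
  controls all larger radii at once.\<close>

lemma covering_exponent_limit_set_le:
  assumes F: "fixed_points X I S \<noteq> {}"
    and lim: "\<And>\<epsilon>. \<epsilon> > 0 \<Longrightarrow> \<exists>x0. \<forall>x\<ge>x0.
      ln (real (covering_number (exp (- exp x)) (fixed_points X I S))) \<le> exp x * f x + \<epsilon> * exp x"
    and f: "f \<in> dini_class 0 a" and g: "g \<in> dini_class l a" and fg: "\<And>x. f x \<le> g x"
    and l: "0 \<le> l" and sum: "\<And>s. l < s \<Longrightarrow> (\<lambda>w. m w powr s) summable_on lists I"
    and \<epsilon>: "\<epsilon> > 0"
  shows "\<exists>x0. \<forall>x\<ge>x0. ln (real (covering_number (exp (- exp x)) (limit_set X I S))) \<le> exp x * g x + \<epsilon> * exp x"
proof -
  let ?F = "fixed_points X I S" and ?\<Lambda> = "limit_set X I S"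
  \<comment> \<open>One third pays for the asymptotics of the fixed points, one for the exponent
    \<open>l + e\<close>, and one for the constant \<open>ln C + B\<close>.\<close>
  define e where "e = \<epsilon> / 3"
  have e: "e > 0" using \<epsilon> by (simp add: e_def)
  have bdF: "bounded ?F"
    using fixed_points_subset_limit_set limit_set_bounded bounded_subset by blast
  have Fpos: "1 \<le> real (covering_number r ?F)" if "0 < r" for r
    using covering_number_pos[OF bdF F that] by simp
  obtain x1 where x1: "\<forall>x\<ge>x1. ln (real (covering_number (exp (- exp x)) ?F)) \<le> exp x * f x + e * exp x"
    using lim[OF e] ..
  \<comment> \<open>The asymptotic assumption covers only small radii; by monotonicity this constant
    takes care of the larger ones.\<close>
  define B where "B = ln (real (covering_number (exp (- exp x1)) ?F))"
  have B0: "0 \<le> B" unfolding B_def using Fpos by (intro ln_ge_zero) simp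
  have F_le: "ln (real (covering_number (exp (- exp y)) ?F)) \<le> exp y * f y + e * exp y + B" for y
  proof (cases "x1 \<le> y")
    case True thus ?thesis using x1 B0 by fastforce
  next
    case False
    have "covering_number (exp (- exp y)) ?F \<le> covering_number (exp (- exp x1)) ?F"
      using False by (intro covering_number_mono bdF) auto
    hence "ln (real (covering_number (exp (- exp y)) ?F)) \<le> B"
      unfolding B_def using Fpos[of "exp (- exp y)"] by (intro ln_mono) auto
    moreover have "0 \<le> f y" using f by (auto simp: dini_class_def image_subset_iff)
    ultimately show ?thesis using e by (simp add: add_increasing)
  qed
  have "l < l + e" "0 \<le> l + e" using e l by auto
  from covering_number_limit_set_le[OF sum[OF this(1)] this(2)] obtain C where C:
    "C > 0 \<and> (\<forall>r Q. 0 < r \<longrightarrow> r < 1 \<longrightarrow>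
      (\<forall>\<rho>. r \<le> \<rho> \<longrightarrow> \<rho> < 1 \<longrightarrow> real (covering_number \<rho> ?F) \<le> Q * (r / \<rho>) powr (l + e)) \<longrightarrow>
      real (covering_number r ?\<Lambda>) \<le> C * Q)" ..
  have \<Lambda>: "?\<Lambda> \<noteq> {}" using F fixed_points_subset_limit_set by blast
  have key: "ln (real (covering_number (exp (- exp x)) ?\<Lambda>)) \<le> ln C + exp x * g x + 2 * e * exp x + B" for x
  proof -
    define r where "r = exp (- exp x)"
    define Q where "Q = exp (exp x * g x + 2 * e * exp x + B)"
    have "real (covering_number \<rho> ?F) \<le> Q * (r / \<rho>) powr (l + e)" if \<rho>: "r \<le> \<rho>" "\<rho> < 1" for \<rho>
    proof -
      have \<rho>0: "\<rho> > 0" using \<rho>(1) by (rule less_le_trans[rotated]) (simp add: r_def)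
      \<comment> \<open>Since \<open>\<rho> < 1\<close>, \<open>- ln \<rho>\<close> is positive and
        every relevant radius has the form \<open>exp (- exp y)\<close>.\<close>
      define y where "y = ln (- ln \<rho>)"
      have "- ln \<rho> > 0" using \<rho> \<rho>0 by simp
      hence ey: "exp y = - ln \<rho>" by (simp add: y_def)
      hence \<rho>_eq: "\<rho> = exp (- exp y)" using \<rho>0 by simp
      have "exp y \<le> exp x" using \<rho>(1) unfolding r_def \<rho>_eq by simp
      hence yx: "y \<le> x" by simp
      have "exp y * (g y - l) \<le> exp x * (g x - l)" using g yx by (rule dini_class_lower)
      hence "exp y * g y \<le> exp x * g x - l * (exp x - exp y)" by (simp add: algebra_simps)
      moreover have "exp y * f y \<le> exp y * g y" using fg by simp
      moreover have "e * exp y \<le> e * exp x" using e yx by simp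
      moreover have "(l + e) * (exp y - exp x) = - (l * (exp x - exp y)) - e * exp x + e * exp y"
        by (simp add: algebra_simps)
      moreover have "0 < e * exp y" using e by simp
      ultimately have "ln (real (covering_number \<rho> ?F))
          \<le> exp x * g x + 2 * e * exp x + B + (l + e) * (exp y - exp x)"
        using F_le[of y] unfolding \<rho>_eq by linarith
      hence "exp (ln (real (covering_number \<rho> ?F)))
          \<le> exp (exp x * g x + 2 * e * exp x + B + (l + e) * (exp y - exp x))"
        by (simp only: exp_le_cancel_iff)
      hence "real (covering_number \<rho> ?F) \<le> exp (exp x * g x + 2 * e * exp x + B + (l + e) * (exp y - exp x))"
        using Fpos[OF \<rho>0] by simp
      also have "\<dots> = Q * exp ((l + e) * (exp y - exp x))" by (simp add: Q_def exp_add)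
      also have "exp ((l + e) * (exp y - exp x)) = (r / \<rho>) powr (l + e)"
        by (simp add: powr_def r_def \<rho>_eq ln_div)
      finally show ?thesis .
    qed
    moreover have "0 < r" "r < 1" by (simp_all add: r_def)
    ultimately have le: "real (covering_number r ?\<Lambda>) \<le> C * Q" using C by blast
    have "1 \<le> real (covering_number r ?\<Lambda>)"
      using covering_number_pos[OF limit_set_bounded \<Lambda> \<open>0 < r\<close>] by simp
    hence "ln (real (covering_number r ?\<Lambda>)) \<le> ln (C * Q)" using le by (intro ln_mono) auto
    also have "\<dots> = ln C + (exp x * g x + 2 * e * exp x + B)"
      using C by (simp add: Q_def ln_mult)
    finally show ?thesis by (simp add: r_def)
  qed
  obtain x0 where x0: "\<forall>x\<ge>x0. ln C + B \<le> e * exp x" using eventually_exp_dominates[OF e] by blast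
  show ?thesis
  proof (intro exI allI impI)
    fix x assume "x0 \<le> x"
    hence "ln C + B \<le> e * exp x" using x0 by blast
    moreover have "\<epsilon> * exp x = 3 * (e * exp x)" by (simp add: e_def)
    ultimately show "ln (real (covering_number (exp (- exp x)) ?\<Lambda>)) \<le> exp x * g x + \<epsilon> * exp x"
      using key[of x] by linarith
  qed
qed

text \<open>By \<open>minimal_dini_le\<close> it suffices to bound
  \<open>exp y * f y + l * (exp x - exp y)\<close> for each \<open>y \<le> x\<close>. Up to errors
  this is the logarithm of the combinatorial lower bound with \<rho> and \<open>r\<close> belonging
  to \<open>y\<close> and \<open>x\<close>.\<close>

lemma covering_exponent_limit_set_ge:
  assumes F: "fixed_points X I S \<noteq> {}"
    and lim: "\<And>\<epsilon>. \<epsilon> > 0 \<Longrightarrow> \<exists>x0. \<forall>x\<ge>x0.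
      exp x * f x - \<epsilon> * exp x \<le> ln (real (covering_number (exp (- exp x)) (fixed_points X I S)))"
    and f: "f \<in> dini_class 0 a" and l: "0 \<le> l" "l \<le> a"
    and min: "\<And>h. h \<in> dini_class l a \<Longrightarrow> (\<And>x. f x \<le> h x) \<Longrightarrow> (\<And>x. g x \<le> h x)"
    and not_sum: "\<And>s. \<lbrakk>0 \<le> s; s < l\<rbrakk> \<Longrightarrow> \<not> (\<lambda>w. m w powr s) summable_on lists I"
    and \<epsilon>: "\<epsilon> > 0"
  shows "\<exists>x0. \<forall>x\<ge>x0. exp x * g x - \<epsilon> * exp x \<le> ln (real (covering_number (exp (- exp x)) (limit_set X I S)))"
proof -
  let ?F = "fixed_points X I S" and ?\<Lambda> = "limit_set X I S"
  define e where "e = \<epsilon> / 3"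
  have e: "e > 0" using \<epsilon> by (simp add: e_def)
  have bdF: "bounded ?F"
    using fixed_points_subset_limit_set limit_set_bounded bounded_subset by blast
  have Fpos: "1 \<le> real (covering_number r ?F)" if "0 < r" for r
    using covering_number_pos[OF bdF F that] by simp
  have \<Lambda>: "?\<Lambda> \<noteq> {}" using F fixed_points_subset_limit_set by blast
  have \<Lambda>pos: "1 \<le> real (covering_number r ?\<Lambda>)" if "0 < r" for r
    using covering_number_pos[OF limit_set_bounded \<Lambda> that] by simp
  obtain x1 where x1: "\<forall>x\<ge>x1. exp x * f x - e * exp x \<le> ln (real (covering_number (exp (- exp x)) ?F))"
    using lim[OF e] ..
  define B where "B = exp x1 * a"
  have fr: "0 \<le> f y" "f y \<le> a" for y using f by (auto simp: dini_class_def image_subset_iff)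
  have B0: "0 \<le> B" unfolding B_def using l by simp
  have F_ge: "exp y * f y - e * exp y - B \<le> ln (real (covering_number (exp (- exp y)) ?F))" for y
  proof (cases "x1 \<le> y")
    case True thus ?thesis using x1 B0 by fastforce
  next
    case False
    have "0 \<le> ln (real (covering_number (exp (- exp y)) ?F))" using Fpos by (intro ln_ge_zero) simp
    moreover have "exp y * f y \<le> B" unfolding B_def using False fr by (intro mult_mono) auto
    moreover have "0 < e * exp y" using e by simp
    ultimately show ?thesis by linarith
  qed
  \<comment> \<open>The series still diverges at \<open>l - e / 2\<close>, strictly between
    \<open>s\<close> and \<open>l\<close>. If \<open>l < e\<close>, \<open>s\<close> is negative;
    then the weight is at most 1 and monotonicity of covering numbers suffices.\<close>
  define s where "s = l - e"
  have "\<exists>C>0. \<forall>r \<rho>. 0 < r \<longrightarrow> r \<le> \<rho> \<longrightarrow> \<rho> \<le> 1 \<longrightarrow>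
    (\<rho> / r) powr s * real (covering_number \<rho> ?F) \<le> C * real (covering_number r ?\<Lambda>)"
  proof (cases "0 \<le> s")
    case True
    have "\<not> (\<lambda>w. m w powr (l - e / 2)) summable_on lists I"
      using True e by (intro not_sum) (auto simp: s_def)
    thus ?thesis by (rule covering_number_limit_set_ge[OF _ True]) (use e in \<open>simp add: s_def\<close>)
  next
    case False
    have "(\<rho> / r) powr s * real (covering_number \<rho> ?F) \<le> 1 * real (covering_number r ?\<Lambda>)"
      if "0 < r" "r \<le> \<rho>" for r \<rho>
    proof (intro mult_mono)
      have "(\<rho> / r) powr s \<le> (\<rho> / r) powr 0" using that False by (intro powr_mono) auto
      thus "(\<rho> / r) powr s \<le> 1" using that by simp
      show "real (covering_number \<rho> ?F) \<le> real (covering_number r ?\<Lambda>)"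
        using that covering_number_mono[OF limit_set_bounded fixed_points_subset_limit_set] by simp
    qed auto
    thus ?thesis by (intro exI[of _ 1]) simp
  qed
  then obtain C where C: "C > 0 \<and> (\<forall>r \<rho>. 0 < r \<longrightarrow> r \<le> \<rho> \<longrightarrow> \<rho> \<le> 1 \<longrightarrow>
    (\<rho> / r) powr s * real (covering_number \<rho> ?F) \<le> C * real (covering_number r ?\<Lambda>))" ..
  have key: "exp x * g x \<le> ln (real (covering_number (exp (- exp x)) ?\<Lambda>)) + ln C + B + 2 * e * exp x" for x
  proof (rule minimal_dini_le[where g = g and x = x, OF f l])
    show "g x \<le> h x" if "h \<in> dini_class l a" "\<And>x. f x \<le> h x" for h
      using that by (rule min)
  next
    fix y assume yx: "y \<le> x"
    define r where "r = exp (- exp x)"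
    define \<rho> where "\<rho> = exp (- exp y)"
    have r: "0 < r" "r \<le> \<rho>" "\<rho> \<le> 1" "0 < \<rho>" using yx by (simp_all add: r_def \<rho>_def)
    have "(\<rho> / r) powr s * real (covering_number \<rho> ?F) \<le> C * real (covering_number r ?\<Lambda>)"
      using C r by blast
    hence "ln ((\<rho> / r) powr s * real (covering_number \<rho> ?F)) \<le> ln (C * real (covering_number r ?\<Lambda>))"
      using Fpos[OF r(4)] r by (intro ln_mono) auto
    moreover have "ln ((\<rho> / r) powr s * real (covering_number \<rho> ?F)) = s * (exp x - exp y) + ln (real (covering_number \<rho> ?F))"
      using Fpos[OF r(4)] r by (subst ln_mult) (auto simp: ln_powr r_def \<rho>_def ln_div)
    moreover have "ln (C * real (covering_number r ?\<Lambda>)) = ln C + ln (real (covering_number r ?\<Lambda>))"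
      using \<Lambda>pos[OF r(1)] C by (subst ln_mult) auto
    moreover have "s * (exp x - exp y) = l * (exp x - exp y) - e * exp x + e * exp y"
      by (simp add: s_def algebra_simps)
    moreover have "e * exp y \<le> e * exp x" "0 < e * exp y" using e yx by simp_all
    ultimately show "exp y * f y + l * (exp x - exp y)
      \<le> ln (real (covering_number (exp (- exp x)) ?\<Lambda>)) + ln C + B + 2 * e * exp x"
      using F_ge[of y] unfolding r_def[symmetric] \<rho>_def[symmetric] by linarith
  qed
  obtain x0 where x0: "\<forall>x\<ge>x0. ln C + B \<le> e * exp x" using eventually_exp_dominates[OF e] by blast
  show ?thesis
  proof (intro exI allI impI)
    fix x assume "x0 \<le> x"
    hence "ln C + B \<le> e * exp x" using x0 by blast
    moreover have "\<epsilon> * exp x = 3 * (e * exp x)" by (simp add: e_def)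
    ultimately show "exp x * g x - \<epsilon> * exp x \<le> ln (real (covering_number (exp (- exp x)) ?\<Lambda>))"
      using key[of x] by linarith
  qed
qed

end

theorem theoremE:
  fixes X :: "(real ^ 'n) set"
    and I :: "'i set"
    and S :: "'i \<Rightarrow> real ^ 'n \<Rightarrow> real ^ 'n"
    and f g :: "real \<Rightarrow> real"
  assumes "CIFS X I S"
    and "has_covering_class (fixed_points X I S) f"
    and "g \<in> dini_class (hausdorff_dim (limit_set X I S)) (real CARD('n))"
    and "\<forall>x. f x \<le> g x"
    and "\<forall>h \<in> dini_class (hausdorff_dim (limit_set X I S)) (real CARD('n)).
           (\<forall>x. f x \<le> h x) \<longrightarrow> (\<forall>x. g x \<le> h x)"
  shows "has_covering_class (limit_set X I S) g"
proof -
  obtain m L c where "ifs_geometry X (interior X) I S m L c"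
    using assms(1) by (rule CIFS_ifs_geometry)
  then interpret ifs_geometry X "interior X" I S m L c .
  let ?F = "fixed_points X I S" and ?\<Lambda> = "limit_set X I S"
  define l where "l = hausdorff_dim ?\<Lambda>"
  define D where "D = {s. 0 \<le> s \<and> hausdorff_measure s ?\<Lambda> = 0}"
  have l_Inf: "l = Inf D" by (simp add: l_def hausdorff_dim_def D_def)
  have bdd: "bdd_below D" by (auto simp: D_def intro: bdd_belowI[of _ 0])
  \<comment> \<open>The infimum is informative only if \<open>D\<close> is non-empty; an exponent
    above the dimension of the space serves.\<close>
  have "real CARD('n) + 1 \<in> D"
    unfolding D_def using summable_if_gt_dim[of "real CARD('n) + 1"]
    by (auto intro!: hausdorff_measure_limit_set_eq_0)
  hence D: "D \<noteq> {}" by blast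
  have l0: "0 \<le> l" unfolding l_Inf using D by (intro cInf_greatest) (auto simp: D_def)
  \<comment> \<open>Together with \<open>not_sum\<close> this identifies the Hausdorff dimension
    with the critical exponent of the series.\<close>
  have sum: "(\<lambda>w. m w powr s) summable_on lists I" if ls: "l < s" for s
  proof -
    obtain s' where "s' \<in> D" "s' < s" using cInf_lessD[OF D ls[unfolded l_Inf]] by blast
    thus ?thesis by (intro summable_if_hausdorff_measure_eq_0[of s' s]) (auto simp: D_def)
  qed
  have not_sum: "\<not> (\<lambda>w. m w powr s) summable_on lists I" if "0 \<le> s" "s < l" for s
  proof
    assume "(\<lambda>w. m w powr s) summable_on lists I"
    hence "s \<in> D" unfolding D_def using that hausdorff_measure_limit_set_eq_0 by blast
    hence "l \<le> s" unfolding l_Inf using bdd by (intro cInf_lower)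
    thus False using that by simp
  qed
  have g: "g \<in> dini_class l (real CARD('n))" using assms(3) by (simp add: l_def)
  have gr: "l \<le> g x" "g x \<le> real CARD('n)" for x using g by (auto simp: dini_class_def image_subset_iff)
  have ln: "l \<le> real CARD('n)" using gr[of 0] by simp
  have F: "?F \<noteq> {}" "f \<in> dini_class 0 (real CARD('n))"
    and lim: "\<And>\<epsilon>. \<epsilon> > 0 \<Longrightarrow> \<exists>x0. \<forall>x\<ge>x0. \<bar>ln (real (covering_number (exp (- exp x)) ?F)) - exp x * f x\<bar> \<le> \<epsilon> * exp x"
    using assms(2) unfolding has_covering_class_iff by blast+
  \<comment> \<open>In the monotone form, lowering the floor from \<open>l\<close> to 0 only adds
    the increasing function \<open>l * exp x\<close>.\<close>
  have "g \<in> dini_class 0 (real CARD('n))"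
  proof (rule dini_classI)
    show "g x \<in> {0..real CARD('n)}" for x using gr[of x] l0 by simp
    fix x y :: real assume xy: "x \<le> y"
    show "exp x * (real CARD('n) - g x) \<le> exp y * (real CARD('n) - g y)"
      using g xy by (rule dini_class_upper)
    have "exp x * (g x - l) \<le> exp y * (g y - l)" using g xy by (rule dini_class_lower)
    moreover have "l * exp x \<le> l * exp y" using xy l0 by (intro mult_left_mono) auto
    ultimately show "exp x * (g x - 0) \<le> exp y * (g y - 0)" by (simp add: algebra_simps)
  qed
  moreover have "\<exists>x0. \<forall>x\<ge>x0. \<bar>ln (real (covering_number (exp (- exp x)) ?\<Lambda>)) - exp x * g x\<bar> \<le> \<epsilon> * exp x"
    if \<epsilon>: "\<epsilon> > 0" for \<epsilon>
  proof -
    have "\<exists>x0. \<forall>x\<ge>x0. ln (real (covering_number (exp (- exp x)) ?\<Lambda>)) \<le> exp x * g x + \<epsilon> * exp x"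
    proof (rule covering_exponent_limit_set_le[OF F(1) _ F(2) g _ l0 sum \<epsilon>])
      fix e :: real assume "e > 0"
      from lim[OF this] obtain x0 where
        "\<forall>x\<ge>x0. \<bar>ln (real (covering_number (exp (- exp x)) ?F)) - exp x * f x\<bar> \<le> e * exp x" ..
      thus "\<exists>x0. \<forall>x\<ge>x0. ln (real (covering_number (exp (- exp x)) ?F)) \<le> exp x * f x + e * exp x"
        by (intro exI[of _ x0]) (simp add: abs_le_iff algebra_simps)
    qed (use assms(4) in auto)
    then obtain x1 where x1: "\<forall>x\<ge>x1. ln (real (covering_number (exp (- exp x)) ?\<Lambda>)) \<le> exp x * g x + \<epsilon> * exp x" ..
    have "\<exists>x0. \<forall>x\<ge>x0. exp x * g x - \<epsilon> * exp x \<le> ln (real (covering_number (exp (- exp x)) ?\<Lambda>))"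
    proof (rule covering_exponent_limit_set_ge[OF F(1) _ F(2) l0 ln _ not_sum \<epsilon>])
      fix e :: real assume "e > 0"
      from lim[OF this] obtain x0 where
        x0: "\<forall>x\<ge>x0. \<bar>ln (real (covering_number (exp (- exp x)) ?F)) - exp x * f x\<bar> \<le> e * exp x" ..
      show "\<exists>x0. \<forall>x\<ge>x0. exp x * f x - e * exp x \<le> ln (real (covering_number (exp (- exp x)) ?F))"
      proof (intro exI allI impI)
        fix x assume "x0 \<le> x"
        hence "\<bar>ln (real (covering_number (exp (- exp x)) ?F)) - exp x * f x\<bar> \<le> e * exp x" using x0 by blast
        thus "exp x * f x - e * exp x \<le> ln (real (covering_number (exp (- exp x)) ?F))" by linarith
      qed
    qed (use assms(5) in \<open>auto simp: l_def\<close>)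
    then obtain x2 where x2: "\<forall>x\<ge>x2. exp x * g x - \<epsilon> * exp x \<le> ln (real (covering_number (exp (- exp x)) ?\<Lambda>))" ..
    show ?thesis
    proof (intro exI allI impI)
      fix x assume "max x1 x2 \<le> x"
      hence "ln (real (covering_number (exp (- exp x)) ?\<Lambda>)) \<le> exp x * g x + \<epsilon> * exp x"
        "exp x * g x - \<epsilon> * exp x \<le> ln (real (covering_number (exp (- exp x)) ?\<Lambda>))"
        using x1 x2 by simp_all
      thus "\<bar>ln (real (covering_number (exp (- exp x)) ?\<Lambda>)) - exp x * g x\<bar> \<le> \<epsilon> * exp x" by linarith
    qed
  qed
  moreover have "?\<Lambda> \<noteq> {}" using F(1) fixed_points_subset_limit_set by blast
  ultimately show ?thesis unfolding has_covering_class_iff using limit_set_bounded by blast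
qed

end
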